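(* Let $n\ge 2$, let $E\subset \mathbb{R}^n$ be a Borel subset, and let $B\subset \mathbb{R}^n$ be a ball such that $\mathcal H^n (E)= \mathcal H^n (B)$. Then $\operatorname{fav}_{n-1}E\ge \operatorname{fav}_{n-1}B$.
   Context: $\mathcal H^k$ denotes the $k$-dimensional Hausdorff measure, normalized so that the $k$-dimensional unit cube has $\mathcal H^k$-measure $1$. For a Borel set $E\subset\mathbb{R}^n$ and an integer $1\le k\le n$, the $k$-dimensional mean shadow area $\operatorname{fav}_k E\in[0,+\infty]$ is the average of $\mathcal H^k(\pi_V(E))$ over all $k$-dimensional linear subspaces $V\subset\mathbb{R}^n$, where $\pi_V$ is the orthogonal projection onto $V$ and the average is taken with respect to the $\mathrm{O}(n)$-invariant probability measure on the Grassmannian of $k$-dimensional linear subspaces of $\mathbb{R}^n$. *)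

theory Defs
  imports "HOL-Probability.Probability"
begin

section \<open>Hausdorff measure\<close>

text \<open>
  Covers are countable families of bounded sets of diameter at most \<open>\<delta>\<close>. Boundedness is
  required because \<^const>\<open>diameter\<close> is a real number, unspecified for unbounded sets. The empty
  set has weight \<open>0\<close> also for \<open>k = 0\<close> (where \<open>0 ^ 0 = 1\<close>), so countable covers include finite ones.
\<close>

definition hausdorff_premeasure :: "nat \<Rightarrow> real \<Rightarrow> 'a::metric_space set \<Rightarrow> ennreal" where
  "hausdorff_premeasure k \<delta> A =
     (INF U \<in> {U :: nat \<Rightarrow> 'a set. A \<subseteq> (\<Union>i. U i) \<and> (\<forall>i. bounded (U i) \<and> diameter (U i) \<le> \<delta>)}.
        \<Sum>i. if U i = {} then 0 else ennreal (diameter (U i) ^ k))"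

definition unnormalized_hausdorff :: "nat \<Rightarrow> 'a::metric_space set \<Rightarrow> ennreal" where
  "unnormalized_hausdorff k A = (SUP \<delta> \<in> {0<..}. hausdorff_premeasure k \<delta> A)"

text \<open>
  The \<open>k\<close>-dimensional unit cube spanned by some \<open>k\<close> of the coordinate axes; all choices of
  the axes give isometric cubes. Meaningful for \<open>k \<le> CARD('n)\<close>.
\<close>

definition unit_cube_of_dim :: "nat \<Rightarrow> (real ^ 'n) set" where
  "unit_cube_of_dim k =
     (let I = (SOME I :: 'n set. card I = k)
      in {x. (\<forall>i \<in> I. 0 \<le> x $ i \<and> x $ i \<le> 1) \<and> (\<forall>i. i \<notin> I \<longrightarrow> x $ i = 0)})"

text \<open>
  The measure of the cube is positive and finite for \<open>k \<le> CARD('n)\<close>, so this is the multiple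
  of the unnormalized measure that gives the cube measure \<open>1\<close>. As an outer measure it is defined
  on all sets, including projections of Borel sets, which need not be Borel.
\<close>

definition hausdorff_measure :: "nat \<Rightarrow> (real ^ 'n) set \<Rightarrow> ennreal" where
  "hausdorff_measure k A =
     unnormalized_hausdorff k A / unnormalized_hausdorff k (unit_cube_of_dim k :: (real ^ 'n) set)"

section \<open>The Grassmannian and its invariant probability measure\<close>

definition orth_proj :: "'a::euclidean_space set \<Rightarrow> 'a \<Rightarrow> 'a" where
  "orth_proj V x = (THE y. y \<in> V \<and> (\<forall>w \<in> V. orthogonal (x - y) w))"

definition grassmannian :: "nat \<Rightarrow> (real ^ 'n) set set" where
  "grassmannian k = {V. subspace V \<and> dim V = k}"

text \<open>
  The topology of the Grassmannian is induced by the embedding that sends \<open>V\<close> to the matrix of the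
  orthogonal projection onto \<open>V\<close>. Its Borel sets are the preimages of the Borel sets of matrices.
\<close>

definition grassmann_borel :: "nat \<Rightarrow> (real ^ 'n) set measure" where
  "grassmann_borel k =
     vimage_algebra (grassmannian k) (\<lambda>V. matrix (orth_proj V)) (borel :: (real ^ 'n ^ 'n) measure)"

definition invariant_grassmann_prob :: "nat \<Rightarrow> (real ^ 'n) set measure \<Rightarrow> bool" where
  "invariant_grassmann_prob k \<mu> \<longleftrightarrow>
     prob_space \<mu> \<and> sets \<mu> = sets (grassmann_borel k) \<and>
     (\<forall>g. orthogonal_transformation g \<longrightarrow> distr \<mu> \<mu> (\<lambda>V. g ` V) = \<mu>)"

text \<open>Such a measure exists and is unique for \<open>k \<le> CARD('n)\<close>.\<close>

definition grassmann_measure :: "nat \<Rightarrow> (real ^ 'n) set measure" where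
  "grassmann_measure k = (THE \<mu>. invariant_grassmann_prob k \<mu>)"

section \<open>Mean shadow area\<close>

text \<open>
  For Borel \<open>E\<close> the integrand is in general only measurable with respect to the completion of the
  measure, but \<open>nn_integral_completion\<close> shows that passing to the completion does not
  change the integral.
\<close>

definition fav :: "nat \<Rightarrow> (real ^ 'n) set \<Rightarrow> ennreal" where
  "fav k E = (\<integral>\<^sup>+ V. hausdorff_measure k (orth_proj V ` E) \<partial>grassmann_measure k)"

end

theory Submission
  imports Defs "HOL-Complex_Analysis.Great_Picard"
begin

text \<open>
  Choose finitely many unit vectors \<open>v\<^sub>j\<close> with weights \<open>c\<^sub>j\<close> that sample the directions evenly, so that
  \<open>\<Sum>\<^sub>j c\<^sub>j \<bar>v\<^sub>j \<bullet> e\<bar>\<close> is nearly a constant \<open>R\<close> times \<open>norm e\<close>, and let \<open>\<psi> y = \<Sum>\<^sub>j c\<^sub>j sqrt (1 + (v\<^sub>j \<bullet> y)\<^sup>2)\<close>.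
  The gradients of \<open>\<psi>\<close> fill nearly the ball of radius \<open>R\<close>. Transporting a compact set \<open>K\<close> to a ball slightly smaller
  than that one by the gradient \<open>\<nabla>\<psi> \<circ> \<nabla>\<phi>\<close> with \<open>\<phi>\<close> convex, and displacing \<open>K\<close> for a short time \<open>t\<close> along
  it, multiplies the volume by at least the factor of the Brunn-Minkowski inequality, since \<open>\<nabla>\<phi>\<close> can be replaced by a
  piecewise constant map and the inequality applied on each piece. On the other hand the displacement can
  be done in one direction \<open>v\<^sub>j\<close> at a time; by monotonicity each such step lengthens the intersections with lines
  parallel to \<open>v\<^sub>j\<close> by at most \<open>2 t c\<^sub>j\<close>, hence adds at most \<open>2 t c\<^sub>j\<close> times the shadow along \<open>v\<^sub>j\<close> to the volume.
  Letting \<open>t\<close> tend to \<open>0\<close> bounds the average shadow of \<open>K\<close> from below, and for a ball the Minkowski sum with the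
  segments \<open>[-t c\<^sub>j v\<^sub>j, t c\<^sub>j v\<^sub>j]\<close> shows that this bound is attained.
\<close>

section \<open>Hausdorff measure and Lebesgue measure\<close>

text \<open>The obstacle is that \<open>K\<close> need not be convex. A line meets a convex set in
  an interval, so adding the segment \<open>[-t c\<^sub>j v\<^sub>j, t c\<^sub>j v\<^sub>j]\<close>
  by a Minkowski sum raises its volume by exactly \<open>2 t c\<^sub>j\<close> times the shadow; but
  when a slice has many components, each of them grows by that much, and the shadow no longer
  controls the volume. A monotone displacement avoids this: along a line the shifts are ordered like
  the points they move, so the shifts of successive pieces occupy non-overlapping parts of
  \<open>[-t c\<^sub>j, t c\<^sub>j]\<close>, and the total gain is at most
  \<open>2 t c\<^sub>j\<close> for any number of components. That \<psi> is a sum of functions of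
  single inner products \<open>v\<^sub>j \<bullet> y\<close> is what splits the displacement into
  steps; each of these functions has an increasing derivative, which keeps the partly displaced
  relation monotone along the next direction. The function \<open>sqrt (1 + s\<^sup>2)\<close> is a
  differentiable substitute for \<open>\<bar>s\<bar>\<close>, with the same growth at infinity and
  slopes below 1. The constant \<open>R\<close> is the mean width of a unit segment.\<close>

abbreviation cover_weight :: "nat \<Rightarrow> 'a::metric_space set \<Rightarrow> ennreal" where
  "cover_weight k S \<equiv> (if S = {} then 0 else ennreal (diameter S ^ k))"

lemma hausdorff_premeasure_le:
  assumes "A \<subseteq> (\<Union>i. U i)" "\<And>i. bounded (U i)" "\<And>i. diameter (U i) \<le> \<delta>"
  shows "hausdorff_premeasure k \<delta> A \<le> (\<Sum>i. cover_weight k (U i))"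
  unfolding hausdorff_premeasure_def by (rule INF_lower) (use assms in auto)

lemma hausdorff_premeasure_less:
  assumes "hausdorff_premeasure k \<delta> A < x"
  obtains U where "A \<subseteq> (\<Union>i. U i)" "\<And>i::nat. bounded (U i)" "\<And>i. diameter (U i) \<le> \<delta>"
    "(\<Sum>i. cover_weight k (U i)) < x"
  using assms unfolding hausdorff_premeasure_def INF_less_iff by auto

lemma hausdorff_premeasure_mono: "A \<subseteq> B \<Longrightarrow> hausdorff_premeasure k \<delta> A \<le> hausdorff_premeasure k \<delta> B"
  unfolding hausdorff_premeasure_def by (rule INF_superset_mono) auto

lemma hausdorff_premeasure_antimono:
  "\<delta> \<le> \<delta>' \<Longrightarrow> hausdorff_premeasure k \<delta>' A \<le> hausdorff_premeasure k \<delta> A"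
  unfolding hausdorff_premeasure_def by (rule INF_superset_mono) (auto intro: order_trans)

lemma hausdorff_premeasure_empty: "0 \<le> \<delta> \<Longrightarrow> hausdorff_premeasure k \<delta> {} = 0"
  using hausdorff_premeasure_le[of "{}" "\<lambda>_. {}" \<delta> k] by simp

text \<open>Nearly optimal covers of the sets \<open>A i\<close>, with errors that add up to
  \<open>e\<close>, are merged into one sequence through the pairing
  \<open>prod_decode\<close>.\<close>

lemma hausdorff_premeasure_UN_le:
  "hausdorff_premeasure k \<delta> (\<Union>i. A i) \<le> (\<Sum>i::nat. hausdorff_premeasure k \<delta> (A i))"
proof (rule ennreal_le_epsilon)
  fix e :: real assume fin: "(\<Sum>i. hausdorff_premeasure k \<delta> (A i)) < top" and e: "0 < e"
  have "\<exists>U. A i \<subseteq> (\<Union>j. U j) \<and> (\<forall>j::nat. bounded (U j) \<and> diameter (U j) \<le> \<delta>) \<and>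
     (\<Sum>j. cover_weight k (U j)) \<le> hausdorff_premeasure k \<delta> (A i) + ennreal (e * (1/2)^Suc i)" for i
  proof -
    have "hausdorff_premeasure k \<delta> (A i) \<le> (\<Sum>i. hausdorff_premeasure k \<delta> (A i))"
      using sum_le_suminf[OF summableI, of "{i}" "\<lambda>i. hausdorff_premeasure k \<delta> (A i)"] by simp
    then have "hausdorff_premeasure k \<delta> (A i) < top" using fin by (rule order.strict_trans1)
    then have "hausdorff_premeasure k \<delta> (A i) < hausdorff_premeasure k \<delta> (A i) + ennreal (e * (1/2)^Suc i)"
      using e by (cases "hausdorff_premeasure k \<delta> (A i)") (auto simp: add_nonneg_pos simp flip: ennreal_plus intro!: ennreal_lessI)
    then show ?thesis by (elim hausdorff_premeasure_less) (auto intro: less_imp_le)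
  qed
  then have "\<exists>U. \<forall>i. A i \<subseteq> (\<Union>j. U i j) \<and> (\<forall>j::nat. bounded (U i j) \<and> diameter (U i j) \<le> \<delta>) \<and>
     (\<Sum>j. cover_weight k (U i j)) \<le> hausdorff_premeasure k \<delta> (A i) + ennreal (e * (1/2)^Suc i)"
    by (intro choice allI)
  then obtain U where U: "\<And>i. A i \<subseteq> (\<Union>j. U i j)" "\<And>i j::nat. bounded (U i j)" "\<And>i j. diameter (U i j) \<le> \<delta>"
    "\<And>i. (\<Sum>j. cover_weight k (U i j)) \<le> hausdorff_premeasure k \<delta> (A i) + ennreal (e * (1/2)^Suc i)"
    by blast
  define W where "W n = (case prod_decode n of (i, j) \<Rightarrow> U i j)" for n
  have "hausdorff_premeasure k \<delta> (\<Union>i. A i) \<le> (\<Sum>n. cover_weight k (W n))"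
  proof (rule hausdorff_premeasure_le)
    show "(\<Union>i. A i) \<subseteq> (\<Union>n. W n)"
    proof
      fix x assume "x \<in> (\<Union>i. A i)"
      then obtain i j where "x \<in> U i j" using U(1) by blast
      then have "x \<in> W (prod_encode (i, j))" by (simp add: W_def)
      then show "x \<in> (\<Union>n. W n)" by blast
    qed
  qed (auto simp: W_def U split: prod.split)
  also have "\<dots> = (\<Sum>n. (\<lambda>(i, j). cover_weight k (U i j)) (prod_decode n))"
    by (intro suminf_cong) (auto simp: W_def split: prod.split)
  also have "\<dots> = (\<Sum>i. \<Sum>j. cover_weight k (U i j))"
    by (rule suminf_ennreal_2dimen) simp
  also have "\<dots> \<le> (\<Sum>i. hausdorff_premeasure k \<delta> (A i) + ennreal (e * (1/2)^Suc i))"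
    by (intro suminf_le U summableI)
  also have "\<dots> = (\<Sum>i. hausdorff_premeasure k \<delta> (A i)) + (\<Sum>i. ennreal (e * (1/2)^Suc i))"
    by (rule suminf_add[symmetric]) (auto intro: summableI)
  also have "(\<Sum>i. ennreal (e * (1/2)^Suc i)) = ennreal (e * 1)"
    using e by (intro suminf_ennreal_eq sums_mult power_half_series) auto
  finally show "hausdorff_premeasure k \<delta> (\<Union>i. A i) \<le> (\<Sum>i. hausdorff_premeasure k \<delta> (A i)) + ennreal e"
    by simp
qed

section \<open>The Hausdorff outer measure and its restriction to Borel sets\<close>

lemma hausdorff_premeasure_le_unnormalized:
  "0 < \<delta> \<Longrightarrow> hausdorff_premeasure k \<delta> A \<le> unnormalized_hausdorff k A"
  unfolding unnormalized_hausdorff_def by (rule SUP_upper) auto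

lemma unnormalized_hausdorff_mono: "A \<subseteq> B \<Longrightarrow> unnormalized_hausdorff k A \<le> unnormalized_hausdorff k B"
  unfolding unnormalized_hausdorff_def by (intro SUP_mono' hausdorff_premeasure_mono)

lemma unnormalized_hausdorff_empty [simp]: "unnormalized_hausdorff k {} = 0"
  unfolding unnormalized_hausdorff_def by (simp add: hausdorff_premeasure_empty cong: SUP_cong_simp)

lemma unnormalized_hausdorff_UN_le:
  "unnormalized_hausdorff k (\<Union>i. A i) \<le> (\<Sum>i::nat. unnormalized_hausdorff k (A i))"
  unfolding unnormalized_hausdorff_def[of k "\<Union>i. A i"]
proof (rule SUP_least)
  fix \<delta> :: real assume "\<delta> \<in> {0<..}"
  then show "hausdorff_premeasure k \<delta> (\<Union>i. A i) \<le> (\<Sum>i::nat. unnormalized_hausdorff k (A i))"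
    by (intro order_trans[OF hausdorff_premeasure_UN_le] suminf_le summableI hausdorff_premeasure_le_unnormalized) auto
qed

lemma unnormalized_hausdorff_Un_le:
  "unnormalized_hausdorff k (A \<union> B) \<le> unnormalized_hausdorff k A + unnormalized_hausdorff k B"
proof -
  have "unnormalized_hausdorff k (\<Union>i::nat. if i = 0 then A else if i = 1 then B else {})
    \<le> (\<Sum>i::nat. unnormalized_hausdorff k (if i = 0 then A else if i = 1 then B else {}))"
    by (rule unnormalized_hausdorff_UN_le)
  also have "\<dots> = (\<Sum>i\<in>{0,1::nat}. unnormalized_hausdorff k (if i = 0 then A else if i = 1 then B else {}))"
    by (rule suminf_finite) auto
  also have "\<dots> = unnormalized_hausdorff k A + unnormalized_hausdorff k B" by simp
  also have "(\<Union>i::nat. if i = 0 then A else if i = 1 then B else {}) = A \<union> B"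
    by (auto split: if_splits)
  finally show ?thesis .
qed

text \<open>Turns the supremum over all scales into one along an increasing sequence, where suprema
  commute with sums. The initial scale \<open>d\<close> is left free so that it can be taken below a
  given separation.\<close>

lemma unnormalized_hausdorff_SUP_seq:
  assumes "0 < d"
  shows "unnormalized_hausdorff k A = (SUP n. hausdorff_premeasure k (d / real (Suc n)) A)"
proof (rule antisym)
  show "unnormalized_hausdorff k A \<le> (SUP n. hausdorff_premeasure k (d / real (Suc n)) A)"
    unfolding unnormalized_hausdorff_def
  proof (rule SUP_least)
    fix \<delta> :: real assume "\<delta> \<in> {0<..}"
    then obtain n where "d / \<delta> < real n" "n > 0" using assms
      by (metis divide_pos_pos greaterThan_iff of_nat_0_less_iff order_less_trans reals_Archimedean2)
    then have "d / real (Suc n) \<le> \<delta>" using \<open>\<delta> \<in> {0<..}\<close> assms by (simp add: field_simps)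
    then show "hausdorff_premeasure k \<delta> A \<le> (SUP n. hausdorff_premeasure k (d / real (Suc n)) A)"
      by (intro SUP_upper2[of n] hausdorff_premeasure_antimono) auto
  qed
  show "(SUP n. hausdorff_premeasure k (d / real (Suc n)) A) \<le> unnormalized_hausdorff k A"
    by (intro SUP_least hausdorff_premeasure_le_unnormalized) (use assms in auto)
qed

text \<open>A set of diameter at most \<delta> cannot meet both \<open>A\<close> and
  \<open>B\<close>, so a cover of the union splits into covers of the two parts with no set counted
  twice.\<close>

lemma hausdorff_premeasure_separated:
  assumes sep: "\<And>a b. a \<in> A \<Longrightarrow> b \<in> B \<Longrightarrow> \<delta> < dist a b"
  shows "hausdorff_premeasure k \<delta> A + hausdorff_premeasure k \<delta> B \<le> hausdorff_premeasure k \<delta> (A \<union> B)"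
  unfolding hausdorff_premeasure_def[of k \<delta> "A \<union> B"]
proof (rule INF_greatest)
  fix U :: "nat \<Rightarrow> 'a set"
  assume "U \<in> {U. A \<union> B \<subseteq> (\<Union>i. U i) \<and> (\<forall>i. bounded (U i) \<and> diameter (U i) \<le> \<delta>)}"
  then have U: "A \<union> B \<subseteq> (\<Union>i. U i)" "\<And>i. bounded (U i)" "\<And>i. diameter (U i) \<le> \<delta>" by auto
  then have "0 \<le> \<delta>" using diameter_ge_0 order_trans by blast
  define V where "V S i = (if U i \<inter> S = {} then {} else U i)" for S i
  have V: "hausdorff_premeasure k \<delta> S \<le> (\<Sum>i. cover_weight k (V S i))" if "S \<subseteq> A \<union> B" for S
    by (rule hausdorff_premeasure_le) (use that U \<open>0 \<le> \<delta>\<close> in \<open>auto simp: V_def\<close>, blast)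
  have disj: "U i \<inter> A = {} \<or> U i \<inter> B = {}" for i
  proof (rule ccontr)
    assume "\<not> ?thesis"
    then obtain a b where ab: "a \<in> A" "a \<in> U i" "b \<in> B" "b \<in> U i" by auto
    then have "dist a b \<le> \<delta>" using diameter_bounded_bound[OF U(2), of a i b] U(3)[of i] by auto
    then show False using sep[OF ab(1,3)] by simp
  qed
  then have w: "cover_weight k (V A i) + cover_weight k (V B i) \<le> cover_weight k (U i)" for i
    using disj[of i] unfolding V_def by (cases "U i \<inter> A = {}"; cases "U i \<inter> B = {}") simp_all
  have "hausdorff_premeasure k \<delta> A + hausdorff_premeasure k \<delta> B
     \<le> (\<Sum>i. cover_weight k (V A i)) + (\<Sum>i. cover_weight k (V B i))"
    by (intro add_mono V) auto
  also have "\<dots> = (\<Sum>i. cover_weight k (V A i) + cover_weight k (V B i))"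
    by (rule suminf_add) (auto intro: summableI)
  also have "\<dots> \<le> (\<Sum>i. cover_weight k (U i))" by (intro suminf_le w summableI)
  finally show "hausdorff_premeasure k \<delta> A + hausdorff_premeasure k \<delta> B \<le> (\<Sum>i. cover_weight k (U i))" .
qed

lemma unnormalized_hausdorff_separated:
  assumes "0 < d" and sep: "\<And>a b. a \<in> A \<Longrightarrow> b \<in> B \<Longrightarrow> d \<le> dist a b"
  shows "unnormalized_hausdorff k A + unnormalized_hausdorff k B \<le> unnormalized_hausdorff k (A \<union> B)"
proof -
  \<comment> \<open>Starting at \<open>d / 2\<close> puts every scale strictly below the distance
    \<open>d\<close> between the two sets.\<close>
  have inc: "incseq (\<lambda>n. hausdorff_premeasure k (d / 2 / real (Suc n)) S)" for S :: "'a set"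
    by (intro incseq_SucI hausdorff_premeasure_antimono) (use assms(1) in \<open>auto simp: field_simps\<close>)
  have "unnormalized_hausdorff k A + unnormalized_hausdorff k B =
     (SUP n. hausdorff_premeasure k (d / 2 / real (Suc n)) A + hausdorff_premeasure k (d / 2 / real (Suc n)) B)"
    unfolding unnormalized_hausdorff_SUP_seq[OF half_gt_zero[OF assms(1)]] by (rule ennreal_SUP_add[OF inc inc, symmetric])
  also have "\<dots> \<le> (SUP n. hausdorff_premeasure k (d / 2 / real (Suc n)) (A \<union> B))"
  proof (intro SUP_mono' hausdorff_premeasure_separated)
    fix n a b assume "a \<in> A" "b \<in> B"
    then have "d \<le> dist a b" by (rule sep)
    moreover have "d / 2 / real (Suc n) \<le> d / 2" using assms(1) by (simp add: field_simps)
    ultimately show "d / 2 / real (Suc n) < dist a b" using assms(1) by linarith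
  qed
  also have "\<dots> = unnormalized_hausdorff k (A \<union> B)"
    using assms(1) by (simp add: unnormalized_hausdorff_SUP_seq[of "d/2"])
  finally show ?thesis .
qed

lemma ennreal_suminf_tail_less:
  fixes f :: "nat \<Rightarrow> ennreal"
  assumes "(\<Sum>i. f i) < top" "0 < e"
  obtains n where "(\<Sum>i. f (i + n)) < ennreal e"
proof -
  have fin: "f i < top" for i
    using sum_le_suminf[OF summableI, of "{i}" f] assms(1) by (auto intro: order.strict_trans1)
  define g where "g i = enn2real (f i)" for i
  have fg: "f i = ennreal (g i)" for i using fin[of i] by (simp add: g_def less_top)
  have g0: "0 \<le> g i" for i by (simp add: g_def)
  have sg: "summable g"
    using assms(1) g0 by (intro summable_suminf_not_top) (auto simp: fg)
  have "(\<lambda>n. \<Sum>i. g (i + n)) \<longlonglongrightarrow> 0" by (rule suminf_exist_split2[OF sg])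
  then obtain n where "\<bar>\<Sum>i. g (i + n)\<bar> < e"
    using assms(2) unfolding LIMSEQ_iff by (metis diff_zero order_refl real_norm_def)
  moreover have "(\<Sum>i. f (i + n)) = ennreal (\<Sum>i. g (i + n))"
    unfolding fg by (intro suminf_ennreal2 g0 summable_ignore_initial_segment sg)
  ultimately show thesis using that[of n] assms(2) by (simp add: ennreal_lessI)
qed

text \<open>Caratheodory's criterion for closed sets. The parts \<open>Y n\<close> of
  \<open>X\<close> at distance at least \<open>1 / (n + 1)\<close> from \<open>F\<close> fall under
  the separated case; what is left of \<open>X - F\<close> lies in the shells \<open>D n\<close>,
  whose measures form a convergent series, so that its tail can be made small.\<close>

lemma unnormalized_hausdorff_closed_additive:
  assumes F: "closed F"
  shows "unnormalized_hausdorff k (F \<inter> X) + unnormalized_hausdorff k (X - F) = unnormalized_hausdorff k X"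
    (is "?H (F \<inter> X) + ?H (X - F) = ?H X")
proof (rule antisym)
  have "X = (F \<inter> X) \<union> (X - F)" by auto
  then show "?H X \<le> ?H (F \<inter> X) + ?H (X - F)" using unnormalized_hausdorff_Un_le by metis
  show "?H (F \<inter> X) + ?H (X - F) \<le> ?H X"
  proof (cases "F = {} \<or> ?H X = top")
    case True
    then show ?thesis by auto
  next
    case False
    then have F0: "F \<noteq> {}" and fin: "?H X < top" by (auto simp: less_top)
    define Y where "Y n = {x \<in> X. 1 / real (Suc n) \<le> infdist x F}" for n
    define D where "D n = Y (Suc n) - Y n" for n
    have D: "1 / real (Suc (Suc n)) \<le> infdist x F \<and> infdist x F < 1 / real (Suc n)" if "x \<in> D n" for x n
      using that by (auto simp: D_def Y_def)
    have DX: "D n \<subseteq> X" for n by (auto simp: D_def Y_def)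
    \<comment> \<open>Shells whose indices differ by at least 2 are at positive distance from each
      other; \<open>r\<close> selects those with even (\<open>r = 0\<close>) or odd
      (\<open>r = 1\<close>) index.\<close>
    have sum_le: "(\<Sum>i<N. ?H (D (2 * i + r))) \<le> ?H (\<Union>i<N. D (2 * i + r))" for N r
    proof (induction N)
      case (Suc N)
      have "(\<Sum>i<Suc N. ?H (D (2 * i + r))) \<le> ?H (\<Union>i<N. D (2 * i + r)) + ?H (D (2 * N + r))"
        using Suc by (simp add: add_right_mono)
      also have "\<dots> \<le> ?H ((\<Union>i<N. D (2 * i + r)) \<union> D (2 * N + r))"
      proof (rule unnormalized_hausdorff_separated)
        \<comment> \<open>Earlier shells are at distance at least \<open>1 / m\<close> from
          \<open>F\<close>, the new one within \<open>1 / (m + 1)\<close>. For \<open>N = 0\<close>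
          there is no earlier shell and \<open>m\<close> may be 0, so an arbitrary positive gap is
          used.\<close>
        define m where "m = real (2 * N + r)"
        have "1 / (m + 1) < 1 / m \<or> N = 0" by (auto simp: m_def field_simps)
        then show "0 < (if N = 0 then 1 else 1 / m - 1 / (m + 1))" by auto
        fix a b assume "a \<in> (\<Union>i<N. D (2 * i + r))" "b \<in> D (2 * N + r)"
        then obtain i where i: "i < N" "a \<in> D (2 * i + r)" by auto
        have "1 / m \<le> 1 / real (Suc (Suc (2 * i + r)))"
          using i(1) by (auto simp: m_def intro!: divide_left_mono)
        also have "\<dots> \<le> infdist a F" using D[OF i(2)] by simp
        finally have 1: "1 / m \<le> infdist a F" .
        have 2: "infdist b F < 1 / (m + 1)" using D[OF \<open>b \<in> _\<close>] by (simp add: m_def add_ac)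
        have "infdist a F \<le> infdist b F + dist a b" by (rule infdist_triangle)
        with 1 2 i(1) show "(if N = 0 then 1 else 1 / m - 1 / (m + 1)) \<le> dist a b" by auto
      qed
      also have "(\<Union>i<N. D (2 * i + r)) \<union> D (2 * N + r) = (\<Union>i<Suc N. D (2 * i + r))"
        by (auto simp: lessThan_Suc)
      finally show ?case .
    qed simp
    have sum2: "(\<Sum>i. ?H (D (2 * i + r))) \<le> ?H X" for r
      unfolding suminf_eq_SUP
      by (intro SUP_least order_trans[OF sum_le] unnormalized_hausdorff_mono) (use DX in auto)
    have "(\<Sum>i. ?H (D i)) \<le> ?H X + ?H X"
      unfolding suminf_eq_SUP
    proof (rule SUP_least)
      fix N :: nat
      have "(\<Sum>i<N. ?H (D i)) \<le> (\<Sum>i<2 * N. ?H (D i))" by (rule sum_mono2) auto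
      also have "\<dots> = (\<Sum>i<N. ?H (D (2 * i))) + (\<Sum>i<N. ?H (D (2 * i + 1)))"
        by (induction N) (simp_all add: algebra_simps)
      also have "\<dots> \<le> (\<Sum>i. ?H (D (2 * i + 0))) + (\<Sum>i. ?H (D (2 * i + 1)))"
        by (intro add_mono order_trans[OF sum_le_suminf[OF summableI]]) auto
      also have "\<dots> \<le> ?H X + ?H X" by (intro add_mono sum2)
      finally show "(\<Sum>i<N. ?H (D i)) \<le> ?H X + ?H X" .
    qed
    also have "\<dots> < top" using fin by simp
    finally have Dfin: "(\<Sum>i. ?H (D i)) < top" .
    show ?thesis
    proof (rule ennreal_le_epsilon)
      fix e :: real assume "0 < e"
      obtain n where n: "(\<Sum>i. ?H (D (i + n))) < ennreal e"
        using ennreal_suminf_tail_less[OF Dfin \<open>0 < e\<close>] .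
      have Ymono: "Y i \<subseteq> Y j" if "i \<le> j" for i j
      proof -
        have "1 / real (Suc j) \<le> 1 / real (Suc i)" using that by (simp add: field_simps)
        then show ?thesis by (auto simp: Y_def)
      qed
      have "X - F \<subseteq> Y n \<union> (\<Union>i. D (i + n))"
      proof
        fix x assume x: "x \<in> X - F"
        then have "0 < infdist x F" using F F0
          by (metis DiffD2 in_closed_iff_infdist_zero infdist_nonneg less_eq_real_def)
        then obtain m where "inverse (real (Suc m)) < infdist x F" using reals_Archimedean by blast
        then have xm: "x \<in> Y m" using x by (auto simp: Y_def divide_inverse)
        show "x \<in> Y n \<union> (\<Union>i. D (i + n))"
        proof (cases "x \<in> Y n")
          case False
          define p where "p = (LEAST m. x \<in> Y m)"
          have p: "x \<in> Y p" unfolding p_def by (rule LeastI[of _ m]) fact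
          have "n < p" using False p Ymono[of p n] by (meson in_mono not_le_imp_less)
          moreover have "x \<notin> Y (p - 1)"
            using not_less_Least[of "p - 1" "\<lambda>m. x \<in> Y m"] \<open>n < p\<close> by (auto simp: p_def[symmetric])
          ultimately have "x \<in> D ((p - 1 - n) + n)" using p by (auto simp: D_def)
          then show ?thesis by blast
        qed auto
      qed
      then have "?H (X - F) \<le> ?H (Y n \<union> (\<Union>i. D (i + n)))" by (rule unnormalized_hausdorff_mono)
      also have "\<dots> \<le> ?H (Y n) + ?H (\<Union>i. D (i + n))" by (rule unnormalized_hausdorff_Un_le)
      also have "\<dots> \<le> ?H (Y n) + ennreal e"
        using n unnormalized_hausdorff_UN_le[of k "\<lambda>i. D (i + n)"] by (intro add_left_mono) auto
      finally have "?H (F \<inter> X) + ?H (X - F) \<le> (?H (F \<inter> X) + ?H (Y n)) + ennreal e"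
        by (metis add.assoc add_left_mono)
      also have "?H (F \<inter> X) + ?H (Y n) \<le> ?H ((F \<inter> X) \<union> Y n)"
      proof (rule unnormalized_hausdorff_separated[of "1 / real (Suc n)"])
        fix a b assume "a \<in> F \<inter> X" "b \<in> Y n"
        then have "infdist b F \<le> dist b a" by (intro infdist_le) auto
        then show "1 / real (Suc n) \<le> dist a b" using \<open>b \<in> Y n\<close> by (auto simp: Y_def dist_commute)
      qed simp
      also have "\<dots> \<le> ?H X" by (rule unnormalized_hausdorff_mono) (auto simp: Y_def)
      finally show "?H (F \<inter> X) + ?H (X - F) \<le> ?H X + ennreal e" by (simp add: add_right_mono)
    qed
  qed
qed

definition hausdorff_borel :: "nat \<Rightarrow> 'a::metric_space measure" where
  "hausdorff_borel k = measure_of UNIV (sets borel) (unnormalized_hausdorff k)"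

lemma sets_hausdorff_borel [simp, measurable_cong]: "sets (hausdorff_borel k) = sets borel"
  and space_hausdorff_borel [simp]: "space (hausdorff_borel k) = UNIV"
  unfolding hausdorff_borel_def using sets.sigma_sets_eq[of borel]
  by (auto simp: space_measure_of_conv)

text \<open>Closed sets belong to the lambda system of the outer measure, hence so do all Borel
  sets, and Caratheodory's lemma makes the outer measure countably additive there.\<close>

lemma emeasure_hausdorff_borel:
  assumes "A \<in> sets borel"
  shows "emeasure (hausdorff_borel k) A = unnormalized_hausdorff k A"
proof (rule emeasure_measure_of[OF hausdorff_borel_def])
  interpret sigma_algebra UNIV "UNIV :: 'a set set" using sigma_algebra_Pow[of UNIV] by simp
  let ?L = "lambda_system UNIV UNIV (unnormalized_hausdorff k) :: 'a set set"
  have oms: "outer_measure_space UNIV (unnormalized_hausdorff k :: 'a set \<Rightarrow> ennreal)"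
    unfolding outer_measure_space_def positive_def increasing_def countably_subadditive_def
    by (auto simp: unnormalized_hausdorff_mono unnormalized_hausdorff_UN_le)
  have ms: "measure_space UNIV ?L (unnormalized_hausdorff k)" by (rule caratheodory_lemma[OF oms])
  have closed: "F \<in> ?L" if "closed F" for F
    unfolding lambda_system_def
    using unnormalized_hausdorff_closed_additive[OF that] by (auto simp: Diff_eq Int_commute)
  have "sigma_algebra UNIV ?L" using ms by (simp add: measure_space_def)
  then have sub: "sets borel \<subseteq> ?L"
    unfolding borel_eq_closed using closed
    by (subst sets_measure_of) (use sigma_algebra.sigma_sets_subset[of UNIV ?L "Collect closed"] in auto)
  show "positive (sets (hausdorff_borel k)) (unnormalized_hausdorff k)" by (simp add: positive_def)
  show "countably_additive (sets (hausdorff_borel k :: 'a measure)) (unnormalized_hausdorff k)"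
    unfolding countably_additive_def sets_hausdorff_borel
  proof (intro allI impI)
    fix A :: "nat \<Rightarrow> 'a set"
    assume "range A \<subseteq> sets borel" "disjoint_family A" "(\<Union>i. A i) \<in> sets borel"
    moreover from this have "range A \<subseteq> ?L" "(\<Union>i. A i) \<in> ?L" using sub by auto
    ultimately show "(\<Sum>i. unnormalized_hausdorff k (A i)) = unnormalized_hausdorff k (\<Union>i. A i)"
      using ms unfolding measure_space_def countably_additive_def by simp
  qed
qed (use assms in auto)

text \<open>The sets of a cover are cut down to \<open>A\<close> before they are mapped, because
  \<open>f\<close> is known to be non-expanding only there.\<close>

lemma unnormalized_hausdorff_image_le:
  assumes f: "\<And>x y. x \<in> A \<Longrightarrow> y \<in> A \<Longrightarrow> dist (f x) (f y) \<le> dist x y"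
  shows "unnormalized_hausdorff k (f ` A) \<le> unnormalized_hausdorff k A"
  unfolding unnormalized_hausdorff_def
proof (rule SUP_mono')
  fix \<delta> :: real
  show "hausdorff_premeasure k \<delta> (f ` A) \<le> hausdorff_premeasure k \<delta> A"
    unfolding hausdorff_premeasure_def[of k \<delta> A]
  proof (rule INF_greatest)
    fix U :: "nat \<Rightarrow> 'a set"
    assume "U \<in> {U. A \<subseteq> (\<Union>i. U i) \<and> (\<forall>i. bounded (U i) \<and> diameter (U i) \<le> \<delta>)}"
    then have U: "A \<subseteq> (\<Union>i. U i)" "\<And>i. bounded (U i)" "\<And>i. diameter (U i) \<le> \<delta>" by auto
    have bd: "bounded (f ` (U i \<inter> A)) \<and> diameter (f ` (U i \<inter> A)) \<le> diameter (U i)" for i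
    proof (cases "U i \<inter> A = {}")
      case False
      then obtain a where a: "a \<in> U i" "a \<in> A" by auto
      have le: "dist (f x) (f y) \<le> diameter (U i)" if "x \<in> U i \<inter> A" "y \<in> U i \<inter> A" for x y
        using f[of x y] diameter_bounded_bound[OF U(2), of x i y] that by auto
      have "bounded (f ` (U i \<inter> A))"
        unfolding bounded_def using le[of a] a by (intro exI[of _ "f a"] exI[of _ "diameter (U i)"]) auto
      moreover have "diameter (f ` (U i \<inter> A)) \<le> diameter (U i)"
        unfolding diameter_def[of "f ` _"] using a le
        by (auto intro!: cSUP_least)
      ultimately show ?thesis ..
    qed (auto simp: diameter_ge_0 U)
    have "hausdorff_premeasure k \<delta> (f ` A) \<le> (\<Sum>i. cover_weight k (f ` (U i \<inter> A)))"
    proof (rule hausdorff_premeasure_le)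
      show "f ` A \<subseteq> (\<Union>i. f ` (U i \<inter> A))" using U(1) by blast
      show "diameter (f ` (U i \<inter> A)) \<le> \<delta>" for i using bd[of i] U(3)[of i] by linarith
    qed (use bd in auto)
    also have "\<dots> \<le> (\<Sum>i. cover_weight k (U i))"
      using bd by (intro suminf_le summableI) (auto intro!: ennreal_leI power_mono diameter_ge_0)
    finally show "hausdorff_premeasure k \<delta> (f ` A) \<le> (\<Sum>i. cover_weight k (U i))" .
  qed
qed

lemma unnormalized_hausdorff_isometry:
  fixes f :: "'a::metric_space \<Rightarrow> 'b::metric_space"
  assumes f: "\<And>x y. x \<in> A \<Longrightarrow> y \<in> A \<Longrightarrow> dist (f x) (f y) = dist x y"
  shows "unnormalized_hausdorff k (f ` A) = unnormalized_hausdorff k A"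
proof (rule antisym)
  show "unnormalized_hausdorff k (f ` A) \<le> unnormalized_hausdorff k A"
    by (rule unnormalized_hausdorff_image_le) (simp add: f)
  have inj: "inj_on f A" by (rule inj_onI) (metis f dist_eq_0_iff)
  have "unnormalized_hausdorff k (inv_into A f ` (f ` A)) \<le> unnormalized_hausdorff k (f ` A)"
    by (rule unnormalized_hausdorff_image_le) (auto simp: inj f)
  then show "unnormalized_hausdorff k A \<le> unnormalized_hausdorff k (f ` A)" by (simp add: inj)
qed

section \<open>Cubes have positive and finite Hausdorff measure\<close>

lemma hausdorff_premeasure_le_finite:
  assumes G: "finite G" and A: "A \<subseteq> (\<Union>g\<in>G. U g)"
    and U: "\<And>g. g \<in> G \<Longrightarrow> bounded (U g) \<and> diameter (U g) \<le> \<delta>" and "0 \<le> \<delta>"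
  shows "hausdorff_premeasure k \<delta> A \<le> (\<Sum>g\<in>G. cover_weight k (U g))"
proof -
  obtain h where h: "bij_betw h {..<card G} G" using ex_bij_betw_nat_finite[OF G] by (auto simp: atLeast0LessThan)
  define W where "W i = (if i < card G then U (h i) else {})" for i
  have hG: "h i \<in> G" if "i < card G" for i using h that by (auto simp: bij_betw_def)
  have "hausdorff_premeasure k \<delta> A \<le> (\<Sum>i. cover_weight k (W i))"
  proof (rule hausdorff_premeasure_le)
    show "A \<subseteq> (\<Union>i. W i)"
    proof
      fix x assume "x \<in> A"
      then obtain g where "g \<in> G" "x \<in> U g" using A by auto
      moreover obtain i where "i < card G" "h i = g"
        using h \<open>g \<in> G\<close> unfolding bij_betw_def by (metis imageE lessThan_iff)
      ultimately show "x \<in> (\<Union>i. W i)" by (auto simp: W_def)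
    qed
  qed (use U hG \<open>0 \<le> \<delta>\<close> in \<open>auto simp: W_def\<close>)
  also have "\<dots> = (\<Sum>i<card G. cover_weight k (W i))"
    by (rule suminf_finite) (auto simp: W_def)
  also have "\<dots> = (\<Sum>i<card G. cover_weight k (U (h i)))" by (rule sum.cong) (auto simp: W_def)
  also have "\<dots> = (\<Sum>g\<in>G. cover_weight k (U g))" by (rule sum.reindex_bij_betw[OF h])
  finally show ?thesis .
qed

definition coordinate_cube :: "'n set \<Rightarrow> real \<Rightarrow> (real ^ 'n) set" where
  "coordinate_cube I r = {x. (\<forall>i\<in>I. \<bar>x $ i\<bar> \<le> r) \<and> (\<forall>i. i \<notin> I \<longrightarrow> x $ i = 0)}"

text \<open>Cutting the cube into \<open>m ^ k\<close> cells of diameter at most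
  \<open>2 * r * k / m\<close> gives the sum \<open>(2 * r * k) ^ k\<close>, the same for every
  \<open>m\<close>. Only finiteness is at stake, so the diameter is estimated crudely by the sum of
  the coordinates.\<close>

lemma unnormalized_hausdorff_coordinate_cube_finite:
  fixes I :: "'n::finite set"
  assumes "0 < r"
  shows "unnormalized_hausdorff (card I) (coordinate_cube I r) < top"
proof -
  define k where "k = card I"
  have "unnormalized_hausdorff k (coordinate_cube I r) \<le> ennreal ((2 * r * real k) ^ k)"
    unfolding unnormalized_hausdorff_def
  proof (rule SUP_least)
    fix \<delta> :: real assume "\<delta> \<in> {0<..}"
    then have \<delta>: "0 < \<delta>" by simp
    obtain m where m: "2 * r * real k / \<delta> < real m" "0 < m"
      by (metis gr0I less_nat_zero_code of_nat_0_less_iff order_less_trans reals_Archimedean2 zero_less_one of_nat_1 not_less_iff_gr_or_eq)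
    define cell where "cell f = {x \<in> coordinate_cube I r. \<forall>i\<in>I. - r + 2 * r * real (f i) / real m \<le> x $ i \<and>
       x $ i \<le> - r + 2 * r * real (Suc (f i)) / real m}" for f :: "'n \<Rightarrow> nat"
    have d: "dist x y \<le> 2 * r * real k / real m" if "x \<in> cell f" "y \<in> cell f" for x y f
    proof -
      have "dist x y \<le> (\<Sum>i\<in>UNIV. \<bar>(x - y) $ i\<bar>)" unfolding dist_norm by (rule norm_le_l1_cart)
      also have "\<dots> = (\<Sum>i\<in>I. \<bar>(x - y) $ i\<bar>)"
        using that by (intro sum.mono_neutral_right) (auto simp: cell_def coordinate_cube_def)
      also have "\<dots> \<le> (\<Sum>i\<in>I. 2 * r / real m)"
      proof (rule sum_mono)
        fix i assume "i \<in> I"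
        have "2 * r * real (Suc (f i)) / real m = 2 * r * real (f i) / real m + 2 * r / real m"
          by (simp add: algebra_simps add_divide_distrib)
        with that \<open>i \<in> I\<close> show "\<bar>(x - y) $ i\<bar> \<le> 2 * r / real m"
          by (force simp: cell_def abs_le_iff)
      qed
      finally show ?thesis by (simp add: k_def mult_ac)
    qed
    have bd: "bounded (cell f) \<and> diameter (cell f) \<le> 2 * r * real k / real m" for f
    proof (cases "cell f = {}")
      case False
      then obtain a where a: "a \<in> cell f" by auto
      have "bounded (cell f)" unfolding bounded_def using d[OF a] by blast
      moreover have "diameter (cell f) \<le> 2 * r * real k / real m"
        unfolding diameter_def using a d by (auto intro!: cSUP_least)
      ultimately show ?thesis ..
    qed (use assms in simp)
    have le\<delta>: "2 * r * real k / real m \<le> \<delta>" using m \<delta> by (simp add: field_simps)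
    have "hausdorff_premeasure k \<delta> (coordinate_cube I r) \<le> (\<Sum>f\<in>(I \<rightarrow>\<^sub>E {..<m}). cover_weight k (cell f))"
    proof (rule hausdorff_premeasure_le_finite)
      show "coordinate_cube I r \<subseteq> (\<Union>f\<in>(I \<rightarrow>\<^sub>E {..<m}). cell f)"
      proof
        fix x assume x: "x \<in> coordinate_cube I r"
        have "\<exists>j<m. - r + 2 * r * real j / real m \<le> x $ i \<and> x $ i \<le> - r + 2 * r * real (Suc j) / real m"
          if "i \<in> I" for i
        proof -
          have xi: "- r \<le> x $ i" "x $ i \<le> r" using x that by (auto simp: coordinate_cube_def)
          define t where "t = (x $ i + r) * real m / (2 * r)"
          have t: "0 \<le> t" unfolding t_def using xi assms by (intro divide_nonneg_pos mult_nonneg_nonneg) auto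
          have "(x $ i + r) * real m \<le> (2 * r) * real m" using xi by (intro mult_right_mono) auto
          then have t': "t \<le> real m" using assms by (simp add: t_def field_simps)
          have xt: "x $ i = - r + 2 * r * t / real m" using m assms by (simp add: t_def)
          have mono: "- r + 2 * r * a / real m \<le> - r + 2 * r * b / real m" if "a \<le> b" for a b
            using that m assms by (simp add: divide_right_mono)
          show ?thesis
          proof (cases "t = real m")
            case True
            \<comment> \<open>The far face belongs to the last cell, of index \<open>m - 1\<close>;
              rounding \<open>t\<close> down would give \<open>m\<close>.\<close>
            then show ?thesis using m unfolding xt True by (intro exI[of _ "m - 1"] conjI mono) auto
          next
            case False
            define j where "j = nat \<lfloor>t\<rfloor>"
            have "real j \<le> t" "t \<le> real (Suc j)" using t t' by (simp_all add: j_def) linarith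
            moreover have "real j < real m" using False t' \<open>real j \<le> t\<close> by linarith
            ultimately show ?thesis unfolding xt by (intro exI[of _ j] conjI mono) auto
          qed
        qed
        then obtain f where f: "\<forall>i\<in>I. f i < m \<and> - r + 2 * r * real (f i) / real m \<le> x $ i \<and> x $ i \<le> - r + 2 * r * real (Suc (f i)) / real m"
          by metis
        then have "x \<in> cell (restrict f I)" "restrict f I \<in> I \<rightarrow>\<^sub>E {..<m}" using x by (auto simp: cell_def)
        then show "x \<in> (\<Union>f\<in>(I \<rightarrow>\<^sub>E {..<m}). cell f)" by blast
      qed
      show "bounded (cell f) \<and> diameter (cell f) \<le> \<delta>" for f using bd[of f] le\<delta> by auto
    qed (use \<delta> in \<open>auto intro!: finite_PiE\<close>)
    also have "\<dots> \<le> (\<Sum>f\<in>(I \<rightarrow>\<^sub>E {..<m}). ennreal ((2 * r * real k / real m) ^ k))"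
      using bd by (intro sum_mono) (auto intro!: ennreal_leI power_mono diameter_ge_0)
    also have "\<dots> = of_nat (m ^ k) * ennreal ((2 * r * real k / real m) ^ k)"
      by (simp add: card_PiE k_def)
    also have "\<dots> = ennreal (real (m ^ k) * (2 * r * real k / real m) ^ k)"
      using assms by (simp add: ennreal_mult ennreal_of_nat_eq_real_of_nat)
    also have "real (m ^ k) * (2 * r * real k / real m) ^ k = (2 * r * real k) ^ k"
      using m by (simp add: power_divide)
    finally show "hausdorff_premeasure k \<delta> (coordinate_cube I r) \<le> ennreal ((2 * r * real k) ^ k)" .
  qed
  then show ?thesis by (simp add: k_def order.strict_trans1)
qed

lemma unit_cube_of_dim_eq:
  assumes "k \<le> CARD('n)"
  obtains I :: "'n::finite set" where "card I = k"
    "unit_cube_of_dim k = {x. (\<forall>i \<in> I. 0 \<le> x $ i \<and> x $ i \<le> 1) \<and> (\<forall>i. i \<notin> I \<longrightarrow> x $ i = 0)}"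
proof
  have "\<exists>I::'n set. card I = k" using assms by (metis obtain_subset_with_card_n)
  then show "card (SOME I::'n set. card I = k) = k" by (rule someI_ex)
qed (simp add: unit_cube_of_dim_def Let_def)

lemma unnormalized_hausdorff_unit_cube_finite:
  assumes "k \<le> CARD('n::finite)"
  shows "unnormalized_hausdorff k (unit_cube_of_dim k :: (real ^ 'n) set) < top"
proof -
  obtain I :: "'n set" where I: "card I = k"
    "unit_cube_of_dim k = {x. (\<forall>i \<in> I. 0 \<le> x $ i \<and> x $ i \<le> 1) \<and> (\<forall>i. i \<notin> I \<longrightarrow> x $ i = 0)}"
    using unit_cube_of_dim_eq[OF assms] .
  have "unnormalized_hausdorff k (unit_cube_of_dim k :: (real ^ 'n) set) \<le> unnormalized_hausdorff (card I) (coordinate_cube I 1)"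
    unfolding I by (intro unnormalized_hausdorff_mono) (auto simp: coordinate_cube_def)
  then show ?thesis using unnormalized_hausdorff_coordinate_cube_finite[of 1 I] by (auto intro: order.strict_trans1)
qed

lemma emeasure_lborel_cbox_cart:
  fixes a b :: "real ^ 'n::finite"
  assumes "\<And>i. a $ i \<le> b $ i"
  shows "emeasure lborel (cbox a b) = ennreal (\<Prod>i\<in>UNIV. b $ i - a $ i)"
proof -
  have "cbox a b \<noteq> {}" using assms by (simp add: interval_eq_empty_cart(2) not_less)
  moreover have "emeasure lborel (cbox a b) = ennreal (measure lborel (cbox a b))"
    by (rule emeasure_eq_ennreal_measure) (use emeasure_lborel_cbox_finite[of a b] in auto)
  ultimately show ?thesis using content_cbox_cart[of a b] by simp
qed

text \<open>Comparison with Lebesgue measure. Each set \<open>U i\<close> of a cover of the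
  \<open>k\<close>-cube is thickened to a box around one of its points, with half side
  \<open>diameter (U i)\<close> in the \<open>k\<close> axes of the cube and the whole unit interval
  in the others. These boxes have volume \<open>2 ^ k\<close> times the weight of \<open>U i\<close>
  and cover the unit cube of full dimension, so the weights add up to at least
  \<open>1 / 2 ^ k\<close>.\<close>

lemma unnormalized_hausdorff_unit_cube_pos:
  assumes "k \<le> CARD('n::finite)"
  shows "0 < unnormalized_hausdorff k (unit_cube_of_dim k :: (real ^ 'n) set)"
proof -
  obtain I :: "'n set" where I: "card I = k"
    "unit_cube_of_dim k = {x. (\<forall>i \<in> I. 0 \<le> x $ i \<and> x $ i \<le> 1) \<and> (\<forall>i. i \<notin> I \<longrightarrow> x $ i = 0)}" (is "_ = ?Q")
    using unit_cube_of_dim_eq[OF assms] .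
  have "ennreal (1 / 2 ^ k) \<le> hausdorff_premeasure k 1 ?Q"
    unfolding hausdorff_premeasure_def
  proof (rule INF_greatest)
    fix U :: "nat \<Rightarrow> (real ^ 'n) set"
    assume "U \<in> {U. ?Q \<subseteq> (\<Union>i. U i) \<and> (\<forall>i. bounded (U i) \<and> diameter (U i) \<le> 1)}"
    then have U: "?Q \<subseteq> (\<Union>i. U i)" "\<And>i. bounded (U i)" by auto
    define p where "p i = (SOME x. x \<in> U i)" for i
    have p: "p i \<in> U i" if "U i \<noteq> {}" for i using that by (auto simp: p_def some_in_eq)
    define B where "B i = (if U i = {} then {} else
      cbox (\<chi> j. if j \<in> I then p i $ j - diameter (U i) else 0) (\<chi> j. if j \<in> I then p i $ j + diameter (U i) else 1))" for i
    have B: "emeasure lborel (B i) = ennreal (2 ^ k) * cover_weight k (U i)" for i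
    proof (cases "U i = {}")
      case False
      have "emeasure lborel (B i) = ennreal (\<Prod>j\<in>UNIV. if j \<in> I then 2 * diameter (U i) else 1)"
        unfolding B_def using False diameter_ge_0[OF U(2), of i]
        by (simp only: if_False, subst emeasure_lborel_cbox_cart)
          (simp, intro arg_cong[where f=ennreal] prod.cong refl, simp)
      also have "(\<Prod>j\<in>UNIV. if j \<in> I then 2 * diameter (U i) else 1) = (2 * diameter (U i)) ^ k"
        by (simp add: prod.If_cases I(1))
      also have "ennreal \<dots> = ennreal (2 ^ k) * cover_weight k (U i)"
        using False diameter_ge_0[OF U(2), of i] by (simp add: power_mult_distrib ennreal_mult)
      finally show ?thesis .
    qed (simp add: B_def)
    have "cbox 0 (1 :: real ^ 'n) \<subseteq> (\<Union>i. B i)"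
    proof
      fix x :: "real ^ 'n" assume x: "x \<in> cbox 0 1"
      define y where "y = (\<chi> j. if j \<in> I then x $ j else 0)"
      have "y \<in> ?Q" using x by (auto simp: y_def mem_box_cart)
      then obtain i where i: "y \<in> U i" using U(1) by auto
      then have "U i \<noteq> {}" by auto
      have "\<bar>x $ j - p i $ j\<bar> \<le> diameter (U i)" if "j \<in> I" for j
      proof -
        have "\<bar>x $ j - p i $ j\<bar> = \<bar>(y - p i) $ j\<bar>" using that by (simp add: y_def)
        also have "\<dots> \<le> norm (y - p i)" by (rule component_le_norm_cart)
        also have "\<dots> \<le> diameter (U i)"
          using diameter_bounded_bound[OF U(2) i p[OF \<open>U i \<noteq> {}\<close>]] by (simp add: dist_norm)
        finally show ?thesis .
      qed
      then have "x \<in> B i" using x \<open>U i \<noteq> {}\<close> by (force simp: B_def mem_box_cart abs_le_iff)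
      then show "x \<in> (\<Union>i. B i)" by blast
    qed
    then have "emeasure lborel (cbox 0 (1 :: real ^ 'n)) \<le> emeasure lborel (\<Union>i. B i)"
      by (intro emeasure_mono) (auto simp: B_def)
    also have "\<dots> \<le> (\<Sum>i. emeasure lborel (B i))"
      by (intro emeasure_subadditive_countably) (auto simp: B_def)
    also have "\<dots> = ennreal (2 ^ k) * (\<Sum>i. cover_weight k (U i))" by (simp add: B)
    finally have "1 \<le> ennreal (2 ^ k) * (\<Sum>i. cover_weight k (U i))"
      by (simp add: emeasure_lborel_cbox_cart)
    then have "ennreal (1 / 2 ^ k) * 1 \<le> ennreal (1 / 2 ^ k) * (ennreal (2 ^ k) * (\<Sum>i. cover_weight k (U i)))"
      by (rule mult_left_mono) simp
    also have "\<dots> = (\<Sum>i. cover_weight k (U i))"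
      unfolding mult.assoc[symmetric] by (simp flip: ennreal_mult)
    finally show "ennreal (1 / 2 ^ k) \<le> (\<Sum>i. cover_weight k (U i))" by simp
  qed
  also have "\<dots> \<le> unnormalized_hausdorff k ?Q" by (rule hausdorff_premeasure_le_unnormalized) simp
  finally show ?thesis unfolding I(2) by (rule order.strict_trans2[rotated]) simp
qed

text \<open>Uniqueness of Haar measure by Fubini. In the double integral of
  \<open>indicator A x * indicator C y\<close>, translating \<open>x\<close> by \<open>y\<close>,
  exchanging the integrals and translating \<open>y\<close> by \<open>- x\<close> leads to
  \<open>indicator A y * indicator C (y - x)\<close>; integrating out \<open>x\<close> leaves a
  constant times the volume of \<open>A\<close>. The conclusion is a product, so that infinite or
  vanishing values need no separate treatment.\<close>

lemma translation_invariant_measure_proportional: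
  fixes M :: "'a::euclidean_space measure"
  assumes sets [measurable_cong]: "sets M = sets borel" and sf: "sigma_finite_measure M"
    and inv: "\<And>v. distr M borel (\<lambda>x. v + x) = M"
    and A [measurable]: "A \<in> sets borel" and D [measurable]: "D \<in> sets borel"
  shows "emeasure M A * emeasure lborel D = emeasure M D * emeasure lborel A"
proof -
  interpret M: sigma_finite_measure M by fact
  interpret P: pair_sigma_finite M lborel ..
  define C :: "'a set" where "C = cbox 0 One"
  have C [measurable]: "C \<in> sets borel" by (simp add: C_def)
  have C1: "emeasure lborel C = 1" by (simp add: C_def emeasure_lborel_cbox_eq)
  have main: "emeasure M A = emeasure M {x. - x \<in> C} * emeasure lborel A" if [measurable]: "A \<in> sets borel" for A
  proof -
    have "emeasure M A = (\<integral>\<^sup>+ y. \<integral>\<^sup>+ x. indicator A x * indicator C y \<partial>M \<partial>lborel)"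
      by (simp add: nn_integral_multc nn_integral_cmult C1 sets)
    also have "\<dots> = (\<integral>\<^sup>+ y. \<integral>\<^sup>+ x. indicator A (y + x) * indicator C y \<partial>M \<partial>lborel)"
    proof (rule nn_integral_cong)
      fix y :: 'a
      have "(\<integral>\<^sup>+ x. indicator A x * indicator C y \<partial>M) = (\<integral>\<^sup>+ x. indicator A x * indicator C y \<partial>distr M borel (\<lambda>x. y + x))"
        by (simp add: inv)
      also have "\<dots> = (\<integral>\<^sup>+ x. indicator A (y + x) * indicator C y \<partial>M)"
        by (subst nn_integral_distr) auto
      finally show "(\<integral>\<^sup>+ x. indicator A x * indicator C y \<partial>M) = (\<integral>\<^sup>+ x. indicator A (y + x) * indicator C y \<partial>M)" .
    qed
    also have "\<dots> = (\<integral>\<^sup>+ x. \<integral>\<^sup>+ y. indicator A (y + x) * indicator C y \<partial>lborel \<partial>M)"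
      by (rule P.Fubini') measurable
    also have "\<dots> = (\<integral>\<^sup>+ x. \<integral>\<^sup>+ y. indicator A y * indicator C (y - x) \<partial>lborel \<partial>M)"
    proof (rule nn_integral_cong)
      fix x :: 'a
      have "(\<integral>\<^sup>+ y. indicator A y * indicator C (y - x) \<partial>lborel)
        = (\<integral>\<^sup>+ y. indicator A y * indicator C (y - x) \<partial>distr lborel borel ((+) x))"
        by (simp add: lborel_distr_plus)
      also have "\<dots> = (\<integral>\<^sup>+ y. indicator A (x + y) * indicator C (x + y - x) \<partial>lborel)"
        by (subst nn_integral_distr) auto
      finally show "(\<integral>\<^sup>+ y. indicator A (y + x) * indicator C y \<partial>lborel) = (\<integral>\<^sup>+ y. indicator A y * indicator C (y - x) \<partial>lborel)"
        by (simp add: add.commute)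
    qed
    also have "\<dots> = (\<integral>\<^sup>+ y. \<integral>\<^sup>+ x. indicator A y * indicator C (y - x) \<partial>M \<partial>lborel)"
      by (rule P.Fubini'[symmetric]) measurable
    also have "\<dots> = (\<integral>\<^sup>+ y. indicator A y * emeasure M {x. - x \<in> C} \<partial>lborel)"
    proof (rule nn_integral_cong)
      fix y :: 'a
      have "(\<integral>\<^sup>+ x. indicator C (y - x) \<partial>M) = (\<integral>\<^sup>+ x. indicator C (y - x) \<partial>distr M borel (\<lambda>x. y + x))"
        by (simp add: inv)
      also have "\<dots> = (\<integral>\<^sup>+ x. indicator C (y - (y + x)) \<partial>M)"
        by (subst nn_integral_distr) auto
      also have "\<dots> = (\<integral>\<^sup>+ x. indicator {x. - x \<in> C} x \<partial>M)"
        by (intro nn_integral_cong) (auto simp: indicator_def)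
      also have "\<dots> = emeasure M {x. - x \<in> C}"
        by (rule nn_integral_indicator) measurable
      finally show "(\<integral>\<^sup>+ x. indicator A y * indicator C (y - x) \<partial>M) = indicator A y * emeasure M {x. - x \<in> C}"
        by (subst nn_integral_cmult) (auto simp: sets)
    qed
    also have "\<dots> = emeasure M {x. - x \<in> C} * emeasure lborel A"
      by (simp add: nn_integral_multc mult.commute)
    finally show ?thesis .
  qed
  show ?thesis unfolding main[OF A] main[OF D] by (simp add: mult_ac)
qed

text \<open>The image measure is translation invariant, hence a multiple of \<open>lborel\<close>;
  the unit ball is its own preimage, which shows that the factor is 1.\<close>

lemma lborel_distr_orthogonal:
  fixes g :: "'a::euclidean_space \<Rightarrow> 'a"
  assumes g: "orthogonal_transformation g"
  shows "distr lborel borel g = lborel"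
proof -
  have lin: "linear g" and nrm: "norm (g x) = norm x" for x
    using g by (auto simp: orthogonal_transformation_def orthogonal_transformation_norm)
  have [measurable]: "g \<in> borel_measurable borel"
    by (intro borel_measurable_continuous_onI linear_continuous_on) (simp add: lin linear_conv_bounded_linear[symmetric])
  define M where "M = distr lborel borel g"
  have sM [measurable_cong]: "sets M = sets borel" by (simp add: M_def)
  have ball: "emeasure M (ball 0 r) = emeasure lborel (ball (0::'a) r)" for r
  proof -
    have "g -` ball 0 r = ball 0 r" by (auto simp: nrm)
    then show ?thesis by (simp add: M_def emeasure_distr)
  qed
  have sf: "sigma_finite_measure M"
  proof
    show "\<exists>A. countable A \<and> A \<subseteq> sets M \<and> \<Union> A = space M \<and> (\<forall>a\<in>A. emeasure M a \<noteq> \<infinity>)"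
    proof (intro exI[of _ "range (\<lambda>n::nat. ball 0 (real n))"] conjI)
      show "\<Union> (range (\<lambda>n::nat. ball (0::'a) (real n))) = space M"
        by (auto simp: M_def reals_Archimedean2)
      show "\<forall>a\<in>range (\<lambda>n::nat. ball 0 (real n)). emeasure M a \<noteq> \<infinity>"
        using emeasure_bounded_finite[of "ball (0::'a) _"] by (auto simp: ball less_top)
    qed (auto simp: sM)
  qed
  have inv: "distr M borel (\<lambda>x. v + x) = M" for v
  proof -
    obtain u where u: "g u = v" using orthogonal_transformation_surj[OF g] by (metis surjD)
    have "distr M borel (\<lambda>x. v + x) = distr lborel borel (\<lambda>x. v + g x)"
      unfolding M_def by (subst distr_distr) (auto simp: o_def)
    also have "(\<lambda>x. v + g x) = g \<circ> (+) u" by (auto simp: u linear_add[OF lin])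
    also have "distr lborel borel (g \<circ> (+) u) = distr (distr lborel borel ((+) u)) borel g"
      by (subst distr_distr) auto
    finally show ?thesis by (simp add: lborel_distr_plus M_def)
  qed
  have "M = lborel"
  proof (rule measure_eqI)
    fix A assume "A \<in> sets M"
    then have A: "A \<in> sets borel" by (simp add: sM)
    have "emeasure M A * emeasure lborel (ball (0::'a) 1) = emeasure M (ball (0::'a) 1) * emeasure lborel A"
      by (rule translation_invariant_measure_proportional[OF sM sf inv A]) simp
    then have "emeasure lborel (ball (0::'a) 1) * emeasure M A = emeasure lborel (ball (0::'a) 1) * emeasure lborel A"
      by (simp add: ball mult.commute)
    moreover have "emeasure lborel (ball (0::'a) 1) \<noteq> 0"
      using content_ball_pos[of 1 "0::'a"] by (auto simp: measure_def)
    moreover have "emeasure lborel (ball (0::'a) 1) \<noteq> top"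
      using emeasure_bounded_finite[of "ball (0::'a) 1"] by (simp add: less_top)
    ultimately show "emeasure M A = emeasure lborel A"
      by (simp add: ennreal_mult_cancel_left)
  qed (simp add: sM)
  then show ?thesis by (simp add: M_def)
qed

lemma emeasure_lborel_orthogonal_image:
  fixes g :: "'a::euclidean_space \<Rightarrow> 'a"
  assumes g: "orthogonal_transformation g" and A: "A \<in> sets borel"
  shows "g ` A \<in> sets borel" "emeasure lborel (g ` A) = emeasure lborel A"
proof -
  have h: "orthogonal_transformation (inv g)" by (rule orthogonal_transformation_inv[OF g])
  have lin: "linear (inv g)" using h by (simp add: orthogonal_transformation_def)
  have [measurable]: "inv g \<in> borel_measurable borel"
    by (intro borel_measurable_continuous_onI linear_continuous_on) (simp add: lin linear_conv_bounded_linear[symmetric])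
  have eq: "g ` A = inv g -` A"
    using bij_vimage_eq_inv_image[OF orthogonal_transformation_bij[OF h], of A]
    by (simp add: inv_inv_eq[OF orthogonal_transformation_bij[OF g]])
  show "g ` A \<in> sets borel" unfolding eq using A by (rule measurable_sets_borel[rotated]) measurable
  have "emeasure lborel A = emeasure (distr lborel borel (inv g)) A" by (simp add: lborel_distr_orthogonal[OF h])
  also have "\<dots> = emeasure lborel (g ` A)" using A by (simp add: emeasure_distr eq)
  finally show "emeasure lborel (g ` A) = emeasure lborel A" by simp
qed

text \<open>Normalised Hausdorff measure of codimension 1 on the hyperplane orthogonal to
  \<open>v\<close>. It is kept as a measure on the whole space, supported on the hyperplane, so that
  all directions share the Borel sets of the space.\<close>

definition hyperplane_measure :: "real ^ 'n \<Rightarrow> (real ^ 'n) measure" where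
  "hyperplane_measure v =
     scale_measure (inverse (unnormalized_hausdorff (CARD('n) - 1) (unit_cube_of_dim (CARD('n) - 1) :: (real ^ 'n) set)))
       (density (hausdorff_borel (CARD('n) - 1)) (indicator {x. v \<bullet> x = 0}))"

lemma sets_hyperplane_measure [simp, measurable_cong]: "sets (hyperplane_measure v) = sets borel"
  and space_hyperplane_measure [simp]: "space (hyperplane_measure v) = UNIV"
  by (simp_all add: hyperplane_measure_def space_scale_measure)

lemma emeasure_hyperplane_measure:
  fixes v :: "real ^ 'n"
  assumes A [measurable]: "A \<in> sets borel"
  shows "emeasure (hyperplane_measure v) A = hausdorff_measure (CARD('n) - 1) (A \<inter> {x. v \<bullet> x = 0})"
proof -
  have "emeasure (density (hausdorff_borel (CARD('n) - 1)) (indicator {x. v \<bullet> x = 0})) A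
      = (\<integral>\<^sup>+ x. indicator {x. v \<bullet> x = 0} x * indicator A x \<partial>hausdorff_borel (CARD('n) - 1))"
    by (rule emeasure_density) auto
  also have "\<dots> = (\<integral>\<^sup>+ x. indicator (A \<inter> {x. v \<bullet> x = 0}) x \<partial>hausdorff_borel (CARD('n) - 1))"
    by (intro nn_integral_cong) (auto simp: indicator_def)
  also have "\<dots> = unnormalized_hausdorff (CARD('n) - 1) (A \<inter> {x. v \<bullet> x = 0})"
    by (subst nn_integral_indicator) (auto intro!: emeasure_hausdorff_borel sets.Int)
  finally show ?thesis
    by (simp add: hyperplane_measure_def hausdorff_measure_def divide_ennreal_def mult.commute)
qed

lemma hausdorff_measure_isometry:
  fixes f :: "real ^ 'n \<Rightarrow> real ^ 'n"
  assumes "\<And>x y. x \<in> A \<Longrightarrow> y \<in> A \<Longrightarrow> dist (f x) (f y) = dist x y"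
  shows "hausdorff_measure k (f ` A) = hausdorff_measure k A"
  by (simp add: hausdorff_measure_def unnormalized_hausdorff_isometry[OF assms])

lemma hausdorff_measure_mono: "A \<subseteq> B \<Longrightarrow> hausdorff_measure k A \<le> hausdorff_measure k B"
  unfolding hausdorff_measure_def by (intro divide_right_mono_ennreal unnormalized_hausdorff_mono)

lemma hausdorff_measure_less_top_iff:
  fixes A :: "(real ^ 'n) set"
  assumes "k \<le> CARD('n)"
  shows "hausdorff_measure k A < top \<longleftrightarrow> unnormalized_hausdorff k A < top"
  using unnormalized_hausdorff_unit_cube_pos[OF assms] unnormalized_hausdorff_unit_cube_finite[OF assms]
  unfolding hausdorff_measure_def
  by (cases "unnormalized_hausdorff k A"; cases "unnormalized_hausdorff k (unit_cube_of_dim k :: (real ^ 'n) set)")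
    (auto simp: divide_ennreal ennreal_top_divide less_top)

lemma hausdorff_measure_unit_cube:
  assumes "k \<le> CARD('n::finite)"
  shows "hausdorff_measure k (unit_cube_of_dim k :: (real ^ 'n) set) = 1"
  using unnormalized_hausdorff_unit_cube_pos[OF assms] unnormalized_hausdorff_unit_cube_finite[OF assms]
  unfolding hausdorff_measure_def by (simp add: ennreal_divide_self)

section \<open>Measures on hyperplanes and the decomposition of volume into lines\<close>

lemma orthogonal_transformation_borel_measurable:
  fixes g :: "'a::euclidean_space \<Rightarrow> 'a"
  assumes "orthogonal_transformation g"
  shows "g \<in> borel_measurable borel"
  by (intro borel_measurable_continuous_onI linear_continuous_on)
    (use assms in \<open>simp add: orthogonal_transformation_def linear_conv_bounded_linear[symmetric]\<close>)

text \<open>The cube that normalises the Hausdorff measure lies in an arbitrarily chosen coordinate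
  hyperplane. Here \<open>i\<close> is the one axis missing from that choice, and rotating it to
  \<open>v\<close> carries the cube into the hyperplane orthogonal to \<open>v\<close>.\<close>

lemma hyperplane_rotation:
  fixes v :: "real ^ 'n"
  assumes v: "norm v = 1"
  obtains g I i where "orthogonal_transformation g" "I = UNIV - {i}" "g (axis i 1) = v" "card I = CARD('n) - 1"
    "unit_cube_of_dim (CARD('n) - 1) = {x::real^'n. (\<forall>i \<in> I. 0 \<le> x $ i \<and> x $ i \<le> 1) \<and> (\<forall>i. i \<notin> I \<longrightarrow> x $ i = 0)}"
    "\<And>x. v \<bullet> g x = x $ i"
proof -
  obtain I :: "'n set" where I: "card I = CARD('n) - 1"
    "unit_cube_of_dim (CARD('n) - 1) = {x. (\<forall>i \<in> I. 0 \<le> x $ i \<and> x $ i \<le> 1) \<and> (\<forall>i. i \<notin> I \<longrightarrow> x $ i = 0)}"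
    using unit_cube_of_dim_eq[of "CARD('n) - 1", where 'n='n] by auto
  have "card (UNIV - I) = 1" using I(1) card_Diff_subset[of I UNIV] by (simp add: card_gt_0_iff Suc_le_eq)
  then obtain i where "UNIV - I = {i}" by (auto simp: card_1_singleton_iff)
  then have I': "I = UNIV - {i}" by auto
  obtain g :: "real ^ 'n \<Rightarrow> real ^ 'n" where g: "orthogonal_transformation g" "g (axis i 1) = v"
    by (rule orthogonal_transformation_exists_1[of "axis i 1" v]) (simp_all add: v norm_axis_1)
  have "v \<bullet> g x = x $ i" for x
    using g by (metis cart_eq_inner_axis inner_commute orthogonal_transformation_def)
  then show thesis using that g I I' by blast
qed

lemma hyperplane_measure_bounded_finite:
  fixes v :: "real ^ 'n"
  assumes v: "norm v = 1" and A: "A \<in> sets borel" "bounded A"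
  shows "emeasure (hyperplane_measure v) A < top"
proof -
  obtain g I i where g: "orthogonal_transformation g" and I: "I = UNIV - {i}" and "g (axis i 1) = v"
    and cI: "card I = CARD('n) - 1" and "unit_cube_of_dim (CARD('n) - 1) =
      {x::real^'n. (\<forall>i \<in> I. 0 \<le> x $ i \<and> x $ i \<le> 1) \<and> (\<forall>i. i \<notin> I \<longrightarrow> x $ i = 0)}"
    and vg: "\<And>x. v \<bullet> g x = x $ i"
    by (rule hyperplane_rotation[OF v]) blast
  obtain r where r: "0 < r" "\<And>x. x \<in> A \<Longrightarrow> norm x \<le> r" using A(2) by (auto simp: bounded_pos)
  have "A \<inter> {x. v \<bullet> x = 0} \<subseteq> g ` coordinate_cube I r"
  proof
    fix x assume x: "x \<in> A \<inter> {x. v \<bullet> x = 0}"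
    obtain y where y: "x = g y" using orthogonal_transformation_surj[OF g] by (metis surjD)
    have "norm y \<le> r" using r(2)[of x] x y orthogonal_transformation_norm[OF g, of y] by auto
    then have "\<bar>y $ j\<bar> \<le> r" for j using component_le_norm_cart[of y j] by linarith
    moreover have "y $ i = 0" using x y vg by auto
    ultimately show "x \<in> g ` coordinate_cube I r" using y I by (auto simp: coordinate_cube_def)
  qed
  then have "unnormalized_hausdorff (card I) (A \<inter> {x. v \<bullet> x = 0}) \<le> unnormalized_hausdorff (card I) (g ` coordinate_cube I r)"
    by (rule unnormalized_hausdorff_mono)
  also have "\<dots> = unnormalized_hausdorff (card I) (coordinate_cube I r)"
    by (rule unnormalized_hausdorff_isometry) (use g orthogonal_transformation_isometry[of g] in blast)
  also have "\<dots> < top" by (rule unnormalized_hausdorff_coordinate_cube_finite[OF r(1)])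
  finally show ?thesis by (simp add: emeasure_hyperplane_measure[OF A(1)] hausdorff_measure_less_top_iff cI)
qed

lemma sigma_finite_measureI_bounded:
  fixes M :: "'a::euclidean_space measure"
  assumes "sets M = sets borel" "\<And>r. emeasure M (cball 0 r) < top"
  shows "sigma_finite_measure M"
proof
  have "space M = UNIV" using sets_eq_imp_space_eq[OF assms(1)] by simp
  then show "\<exists>A. countable A \<and> A \<subseteq> sets M \<and> \<Union> A = space M \<and> (\<forall>a\<in>A. emeasure M a \<noteq> \<infinity>)"
    using assms by (intro exI[of _ "range (\<lambda>n::nat. cball 0 (real n))"])
      (auto simp: less_top intro: real_arch_simple)
qed

lemma sigma_finite_hyperplane_measure:
  "norm v = 1 \<Longrightarrow> sigma_finite_measure (hyperplane_measure v)"
  by (rule sigma_finite_measureI_bounded) (auto intro: hyperplane_measure_bounded_finite)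

lemma emeasure_hyperplane_measure_shift:
  fixes v :: "real ^ 'n"
  assumes w: "v \<bullet> w = 0"
  shows "distr (hyperplane_measure v) borel (\<lambda>x. w + x) = hyperplane_measure v"
proof (rule measure_eqI)
  fix A assume "A \<in> sets (distr (hyperplane_measure v) borel ((+) w))"
  then have A: "A \<in> sets borel" by simp
  have m: "(\<lambda>x. w + x) -` A \<in> sets borel" by (rule measurable_sets_borel[OF _ A]) simp
  have "emeasure (distr (hyperplane_measure v) borel ((+) w)) A
    = hausdorff_measure (CARD('n) - 1) ((\<lambda>x. w + x) -` A \<inter> {x. v \<bullet> x = 0})"
    using A m by (simp add: emeasure_distr emeasure_hyperplane_measure)
  also have "\<dots> = hausdorff_measure (CARD('n) - 1) ((\<lambda>x. w + x) ` ((\<lambda>x. w + x) -` A \<inter> {x. v \<bullet> x = 0}))"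
    by (rule hausdorff_measure_isometry[symmetric]) simp
  also have "(\<lambda>x. w + x) ` ((\<lambda>x. w + x) -` A \<inter> {x. v \<bullet> x = 0}) = A \<inter> {x. v \<bullet> x = 0}"
  proof (rule set_eqI)
    fix x
    have "x \<in> A \<inter> {x. v \<bullet> x = 0} \<Longrightarrow> x - w \<in> (\<lambda>x. w + x) -` A \<inter> {x. v \<bullet> x = 0}"
      using w by (auto simp: inner_diff_right)
    then show "x \<in> (\<lambda>x. w + x) ` ((\<lambda>x. w + x) -` A \<inter> {x. v \<bullet> x = 0}) \<longleftrightarrow> x \<in> A \<inter> {x. v \<bullet> x = 0}"
      using w by (auto simp: inner_add_right image_iff intro!: bexI[of _ "x - w"])
  qed
  finally show "emeasure (distr (hyperplane_measure v) borel ((+) w)) A = emeasure (hyperplane_measure v) A"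
    using A by (simp add: emeasure_hyperplane_measure)
qed simp

lemma AE_hyperplane_measure: "AE x in hyperplane_measure v. v \<bullet> x = 0"
proof -
  have "emeasure (hyperplane_measure v) (- {x. v \<bullet> x = 0}) = 0"
    by (subst emeasure_hyperplane_measure) (auto simp: hausdorff_measure_def)
  then show ?thesis
    by (intro AE_I[of _ _ "- {x. v \<bullet> x = 0}"]) auto
qed

text \<open>The iterated integral defines a translation invariant measure \<open>M\<close>, hence a
  multiple of \<open>lborel\<close>. The factor is read off from a rotated unit cube
  \<open>D\<close> with one edge along \<open>v\<close>: its slices have length 1 over a cube of
  dimension \<open>CARD('n) - 1\<close>, whose Hausdorff measure is 1 by normalisation.\<close>

theorem emeasure_lborel_slices:
  fixes v :: "real ^ 'n"
  assumes v: "norm v = 1" and A: "A \<in> sets borel"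
  shows "emeasure lborel A = (\<integral>\<^sup>+ s. emeasure lborel {t. s + t *\<^sub>R v \<in> A} \<partial>hyperplane_measure v)"
proof -
  interpret N: sigma_finite_measure "hyperplane_measure v" by (rule sigma_finite_hyperplane_measure[OF v])
  interpret P: pair_sigma_finite "hyperplane_measure v" "lborel :: real measure" ..
  define M where "M = distr (hyperplane_measure v \<Otimes>\<^sub>M lborel) borel (\<lambda>(s, t). s + t *\<^sub>R v)"
  have sM [measurable_cong, simp]: "sets M = sets borel" by (simp add: M_def)
  have meas [measurable]: "(\<lambda>(s, t). s + t *\<^sub>R v) \<in> borel_measurable (hyperplane_measure v \<Otimes>\<^sub>M lborel)"
    by measurable
  have nnM: "(\<integral>\<^sup>+ x. f x \<partial>M) = (\<integral>\<^sup>+ s. \<integral>\<^sup>+ t. f (s + t *\<^sub>R v) \<partial>lborel \<partial>hyperplane_measure v)"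
    if [measurable]: "f \<in> borel_measurable borel" for f
    unfolding M_def by (subst nn_integral_distr, measurable, subst lborel.nn_integral_fst[symmetric]) auto
  have eM: "emeasure M A = (\<integral>\<^sup>+ s. emeasure lborel {t. s + t *\<^sub>R v \<in> A} \<partial>hyperplane_measure v)"
    if [measurable]: "A \<in> sets borel" for A
  proof -
    have "emeasure M A = (\<integral>\<^sup>+ x. indicator A x \<partial>M)" by simp
    also have "\<dots> = (\<integral>\<^sup>+ s. \<integral>\<^sup>+ t. indicator A (s + t *\<^sub>R v) \<partial>lborel \<partial>hyperplane_measure v)"
      by (rule nnM) simp
    also have "\<dots> = (\<integral>\<^sup>+ s. \<integral>\<^sup>+ t. indicator {t. s + t *\<^sub>R v \<in> A} t \<partial>lborel \<partial>hyperplane_measure v)"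
      by (intro nn_integral_cong) (auto simp: indicator_def)
    finally show ?thesis by (simp add: nn_integral_indicator)
  qed
  have inv: "distr M borel (\<lambda>x. w + x) = M" for w
  proof (rule measure_eqI)
    fix A assume "A \<in> sets (distr M borel (\<lambda>x. w + x))"
    then have [measurable]: "A \<in> sets borel" by simp
    \<comment> \<open>The component of \<open>w\<close> along \<open>v\<close> is absorbed by the
      inner integral, and the orthogonal component by the invariance of the hyperplane
      measure.\<close>
    define a where "a = v \<bullet> w"
    define w' where "w' = w - a *\<^sub>R v"
    have w': "v \<bullet> w' = 0" "w = w' + a *\<^sub>R v"
      using v by (auto simp: w'_def a_def inner_diff_right dot_square_norm)
    define f where "f s = (\<integral>\<^sup>+ t. indicator A (s + t *\<^sub>R v) \<partial>lborel)" for s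
    have [measurable]: "f \<in> borel_measurable borel" unfolding f_def by measurable
    have "emeasure (distr M borel (\<lambda>x. w + x)) A = (\<integral>\<^sup>+ x. indicator A x \<partial>distr M borel (\<lambda>x. w + x))"
      by simp
    also have "\<dots> = (\<integral>\<^sup>+ x. indicator A (w + x) \<partial>M)" by (subst nn_integral_distr) auto
    also have "\<dots> = (\<integral>\<^sup>+ s. \<integral>\<^sup>+ t. indicator A (w + (s + t *\<^sub>R v)) \<partial>lborel \<partial>hyperplane_measure v)"
      by (rule nnM) simp
    also have "\<dots> = (\<integral>\<^sup>+ s. f (w' + s) \<partial>hyperplane_measure v)"
    proof (rule nn_integral_cong)
      fix s
      have "f (w' + s) = (\<integral>\<^sup>+ t. indicator A (w' + s + t *\<^sub>R v) \<partial>distr lborel borel ((+) a))"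
        by (simp add: f_def lborel_distr_plus)
      also have "\<dots> = (\<integral>\<^sup>+ t. indicator A (w' + s + (a + t) *\<^sub>R v) \<partial>lborel)"
        by (subst nn_integral_distr) auto
      finally show "(\<integral>\<^sup>+ t. indicator A (w + (s + t *\<^sub>R v)) \<partial>lborel) = f (w' + s)"
        by (simp add: w'(2) algebra_simps)
    qed
    also have "\<dots> = (\<integral>\<^sup>+ s. f s \<partial>distr (hyperplane_measure v) borel (\<lambda>x. w' + x))"
      by (subst nn_integral_distr) auto
    also have "\<dots> = (\<integral>\<^sup>+ s. f s \<partial>hyperplane_measure v)"
      by (simp add: emeasure_hyperplane_measure_shift[OF w'(1)])
    also have "\<dots> = (\<integral>\<^sup>+ x. indicator A x \<partial>M)"
      unfolding f_def by (rule nnM[symmetric]) simp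
    finally show "emeasure (distr M borel (\<lambda>x. w + x)) A = emeasure M A" by simp
  qed simp
  have sf: "sigma_finite_measure M"
  proof (rule sigma_finite_measureI_bounded)
    fix r :: real
    have "emeasure M (cball 0 r) \<le> (\<integral>\<^sup>+ s. ennreal (2 * \<bar>r\<bar>) * indicator (cball 0 r) s \<partial>hyperplane_measure v)"
      unfolding eM[OF borel_closed[OF closed_cball]]
    proof (rule nn_integral_mono_AE, use AE_hyperplane_measure[of v] in eventually_elim)
      fix s :: "real ^ 'n" assume s: "v \<bullet> s = 0"
      have nrm: "(norm s)\<^sup>2 + t\<^sup>2 = (norm (s + t *\<^sub>R v))\<^sup>2" for t
        unfolding power2_norm_eq_inner using s v
        by (simp add: inner_add_left inner_add_right inner_commute[of s v] norm_eq_1 power2_eq_square)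
      have *: "norm s \<le> r \<and> \<bar>t\<bar> \<le> r" if "norm (s + t *\<^sub>R v) \<le> r" for t
      proof -
        have r: "0 \<le> r" using that norm_ge_zero order_trans by blast
        have le: "(norm s)\<^sup>2 + t\<^sup>2 \<le> r\<^sup>2" unfolding nrm using that by (intro power_mono) auto
        have "(norm s)\<^sup>2 \<le> r\<^sup>2" "\<bar>t\<bar>\<^sup>2 \<le> r\<^sup>2" using le by (auto intro: order_trans[rotated])
        then show ?thesis using r power2_le_imp_le by blast
      qed
      show "emeasure lborel {t. s + t *\<^sub>R v \<in> cball 0 r} \<le> ennreal (2 * \<bar>r\<bar>) * indicator (cball 0 r) s"
      proof (cases "norm s \<le> r")
        case True
        have "emeasure lborel {t. s + t *\<^sub>R v \<in> cball 0 r} \<le> emeasure lborel {-\<bar>r\<bar>..\<bar>r\<bar>}"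
          using * by (intro emeasure_mono) force+
        then show ?thesis using True by simp
      next
        case False
        then have "{t. s + t *\<^sub>R v \<in> cball 0 r} = {}" using * by auto
        then show ?thesis by simp
      qed
    qed
    also have "\<dots> = ennreal (2 * \<bar>r\<bar>) * emeasure (hyperplane_measure v) (cball 0 r)"
      by (rule nn_integral_cmult_indicator) simp
    also have "\<dots> < top"
      using hyperplane_measure_bounded_finite[OF v, of "cball 0 r"] by (simp add: ennreal_mult_less_top)
    finally show "emeasure M (cball 0 r) < top" .
  qed simp
  obtain g I i where g: "orthogonal_transformation g" and I: "I = UNIV - {i}"
    and gi: "g (axis i 1) = v" and "card I = CARD('n) - 1" and Q: "unit_cube_of_dim (CARD('n) - 1) =
      {x::real^'n. (\<forall>i \<in> I. 0 \<le> x $ i \<and> x $ i \<le> 1) \<and> (\<forall>i. i \<notin> I \<longrightarrow> x $ i = 0)}" (is "_ = ?Q")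
    and vg: "\<And>x. v \<bullet> g x = x $ i"
    by (rule hyperplane_rotation[OF v]) blast
  have lin: "linear g" using g by (simp add: orthogonal_transformation_def)
  define D where "D = g ` cbox 0 1"
  have D: "D \<in> sets borel" "emeasure lborel D = 1"
    unfolding D_def using emeasure_lborel_orthogonal_image[OF g, of "cbox 0 1"]
    by (auto simp: emeasure_lborel_cbox_cart)
  have clQ: "closed ?Q"
  proof -
    have "?Q = cbox 0 (\<chi> j. if j \<in> I then 1 else 0)"
      by (auto simp: mem_box_cart split: if_splits)
    then show ?thesis by (simp add: closed_cbox)
  qed
  have gQ [measurable]: "g ` ?Q \<in> sets borel"
    by (intro emeasure_lborel_orthogonal_image[OF g] borel_closed clQ)
  have "emeasure M D = (\<integral>\<^sup>+ s. indicator (g ` ?Q) s \<partial>hyperplane_measure v)"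
    unfolding eM[OF D(1)]
  proof (rule nn_integral_cong_AE, use AE_hyperplane_measure[of v] in eventually_elim)
    fix s :: "real ^ 'n" assume s: "v \<bullet> s = 0"
    obtain y where y: "s = g y" using orthogonal_transformation_surj[OF g] by (metis surjD)
    have yi: "y $ i = 0" using s y vg by simp
    have inj: "inj g" by (rule orthogonal_transformation_inj[OF g])
    have "s + t *\<^sub>R v = g (y + t *\<^sub>R axis i 1)" for t by (simp add: y gi linear_add[OF lin] linear_scale[OF lin])
    then have e1: "s + t *\<^sub>R v \<in> D \<longleftrightarrow> y + t *\<^sub>R axis i 1 \<in> cbox 0 1" for t
      by (simp add: D_def inj_image_mem_iff[OF inj])
    have e2: "y + t *\<^sub>R axis i 1 \<in> cbox 0 1 \<longleftrightarrow> y \<in> ?Q \<and> t \<in> {0..1}" for t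
      using yi by (auto simp: mem_box_cart I axis_def split: if_splits)
    have e3: "y \<in> ?Q \<longleftrightarrow> s \<in> g ` ?Q" by (simp only: y inj_image_mem_iff[OF inj])
    have "{t. s + t *\<^sub>R v \<in> D} = (if s \<in> g ` ?Q then {0..1} else {})"
      unfolding e1 e2 e3 by auto
    then show "emeasure lborel {t. s + t *\<^sub>R v \<in> D} = indicator (g ` ?Q) s" by simp
  qed
  also have "\<dots> = emeasure (hyperplane_measure v) (g ` ?Q)" by simp
  also have "\<dots> = hausdorff_measure (CARD('n) - 1) (g ` ?Q)"
  proof -
    have "g ` ?Q \<inter> {x. v \<bullet> x = 0} = g ` ?Q" using vg I by auto
    then show ?thesis by (simp add: emeasure_hyperplane_measure)
  qed
  also have "\<dots> = hausdorff_measure (CARD('n) - 1) ?Q"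
    by (rule hausdorff_measure_isometry) (use g orthogonal_transformation_isometry[of g] in blast)
  also have "\<dots> = 1" using hausdorff_measure_unit_cube[of "CARD('n) - 1", where 'n='n] Q by simp
  finally have MD: "emeasure M D = 1" .
  have "emeasure M A * emeasure lborel D = emeasure M D * emeasure lborel A"
    by (rule translation_invariant_measure_proportional[OF sM sf inv A D(1)])
  then show ?thesis by (simp add: MD D(2) eM[OF A])
qed

text \<open>Translation invariance again leaves one constant to be found. In full dimension the
  chosen axes are all the axes, so the normalising cube is \<open>cbox 0 1\<close>, of volume
  1.\<close>

theorem hausdorff_measure_eq_lborel:
  fixes A :: "(real ^ 'n) set"
  assumes A: "A \<in> sets borel"
  shows "hausdorff_measure CARD('n) A = emeasure lborel A"
proof -
  let ?Q = "unit_cube_of_dim CARD('n) :: (real ^ 'n) set"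
  define M :: "(real ^ 'n) measure" where "M = hausdorff_borel CARD('n)"
  have sM [simp]: "sets M = sets borel" by (simp add: M_def)
  have eM: "emeasure M A = unnormalized_hausdorff CARD('n) A" if "A \<in> sets borel" for A
    using that by (simp add: M_def emeasure_hausdorff_borel)
  have Q: "?Q = cbox 0 1"
  proof -
    obtain I :: "'n set" where I: "card I = CARD('n)"
      "?Q = {x. (\<forall>i \<in> I. 0 \<le> x $ i \<and> x $ i \<le> 1) \<and> (\<forall>i. i \<notin> I \<longrightarrow> x $ i = 0)}"
      using unit_cube_of_dim_eq[of "CARD('n)", where 'n='n] by auto
    then have "I = UNIV" by (metis card_subset_eq finite subset_UNIV)
    then show ?thesis using I(2) by (auto simp: mem_box_cart)
  qed
  have "emeasure M A * emeasure lborel ?Q = emeasure M ?Q * emeasure lborel A"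
  proof (rule translation_invariant_measure_proportional[OF sM])
    show "sigma_finite_measure M"
    proof (rule sigma_finite_measureI_bounded)
      fix r :: real
      have "(cball 0 r :: (real ^ 'n) set) \<subseteq> coordinate_cube UNIV (\<bar>r\<bar> + 1)"
      proof
        fix x :: "real ^ 'n" assume "x \<in> cball 0 r"
        then have "\<bar>x $ i\<bar> \<le> \<bar>r\<bar> + 1" for i using component_le_norm_cart[of x i] by (simp add: )
        then show "x \<in> coordinate_cube UNIV (\<bar>r\<bar> + 1)" by (simp add: coordinate_cube_def)
      qed
      then have "emeasure M (cball 0 r) \<le> unnormalized_hausdorff CARD('n) (coordinate_cube UNIV (\<bar>r\<bar> + 1) :: (real ^ 'n) set)"
        by (simp add: eM unnormalized_hausdorff_mono)
      also have "\<dots> < top" by (rule unnormalized_hausdorff_coordinate_cube_finite) simp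
      finally show "emeasure M (cball 0 r) < top" .
    qed simp
    show "distr M borel (\<lambda>x. v + x) = M" for v
    proof (rule measure_eqI)
      fix A assume "A \<in> sets (distr M borel (\<lambda>x. v + x))"
      then have A: "A \<in> sets borel" by simp
      have "(\<lambda>x. v + x) -` A \<in> sets borel" by (rule measurable_sets_borel[OF _ A]) simp
      then have "emeasure (distr M borel (\<lambda>x. v + x)) A = unnormalized_hausdorff CARD('n) ((\<lambda>x. v + x) -` A)"
        using A by (subst emeasure_distr) (auto simp: eM M_def emeasure_hausdorff_borel)
      also have "\<dots> = unnormalized_hausdorff CARD('n) ((\<lambda>x. v + x) ` ((\<lambda>x. v + x) -` A))"
        by (rule unnormalized_hausdorff_isometry[symmetric]) simp
      also have "(\<lambda>x. v + x) ` ((\<lambda>x. v + x) -` A) = A" by (simp add: surj_plus)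
      finally show "emeasure (distr M borel (\<lambda>x. v + x)) A = emeasure M A" using A by (simp add: eM)
    qed simp
  qed (use A in \<open>auto simp: Q\<close>)
  moreover have "emeasure lborel ?Q = 1" by (simp add: Q emeasure_lborel_cbox_cart)
  moreover have "emeasure M ?Q = unnormalized_hausdorff CARD('n) ?Q" by (rule eM) (simp add: Q)
  ultimately have "unnormalized_hausdorff CARD('n) A = emeasure lborel A * unnormalized_hausdorff CARD('n) ?Q"
    using A by (simp add: eM mult.commute)
  then show ?thesis
    using unnormalized_hausdorff_unit_cube_pos[of "CARD('n)", where 'n='n] unnormalized_hausdorff_unit_cube_finite[of "CARD('n)", where 'n='n]
    unfolding hausdorff_measure_def by (simp add: ennreal_mult_divide_eq)
qed

section \<open>The Brunn--Minkowski inequality\<close>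

text \<open>Continuity from above along the closed neighbourhoods \<open>N k\<close> of
  \<open>S\<close>, each of which contains one of the sets \<open>T\<close>. All passages from an
  approximate volume estimate to an exact one go through this lemma, for \<open>lborel\<close> as
  well as for the measures on hyperplanes.\<close>

lemma emeasure_compact_upper_semicontinuous:
  fixes M :: "'a::heine_borel measure"
  assumes sets: "sets M = sets borel" and S: "compact S"
    and fin: "\<And>B. bounded B \<Longrightarrow> B \<in> sets borel \<Longrightarrow> emeasure M B < top"
    and approx: "\<And>e. e > 0 \<Longrightarrow> \<exists>T\<in>sets borel. c \<le> emeasure M T \<and> (\<forall>x\<in>T. \<exists>y\<in>S. dist x y \<le> e)"
  shows "c \<le> emeasure M S"
proof (cases "S = {}")
  case True
  then obtain T where "c \<le> emeasure M T" "T = {}" using approx[of 1] by auto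
  then show ?thesis by simp
next
  case False
  define N where "N k = {x. infdist x S \<le> 1 / real (Suc k)}" for k
  have cl: "closed (N k)" for k
    unfolding N_def by (intro closed_Collect_le continuous_intros)
  have dec: "decseq N"
  proof (rule decseq_SucI)
    fix k
    have "1 / real (Suc (Suc k)) \<le> 1 / real (Suc k)" by (simp add: field_simps)
    then show "N (Suc k) \<subseteq> N k" unfolding N_def using order_trans by blast
  qed
  have bdd: "bounded (N k)" for k
  proof -
    obtain a r where r: "\<And>y. y \<in> S \<Longrightarrow> dist a y \<le> r"
      using compact_imp_bounded[OF S] by (auto simp: bounded_def)
    have "dist a x \<le> r + 1" if "x \<in> N k" for x
    proof -
      obtain y where y: "y \<in> S" "infdist x S = dist x y"
        using infdist_attains_inf[of S x] False compact_imp_closed[OF S] by auto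
      have "1 / real (Suc k) \<le> 1" by simp
      moreover have "dist x y \<le> 1 / real (Suc k)" using that y by (simp add: N_def)
      ultimately have "dist x y \<le> 1" by linarith
      then show ?thesis using r[OF y(1)] dist_triangle[of a x y] by (simp add: dist_commute)
    qed
    then show ?thesis unfolding bounded_def by blast
  qed
  have "(\<lambda>k. emeasure M (N k)) \<longlonglongrightarrow> emeasure M (\<Inter>k. N k)"
    by (rule Lim_emeasure_decseq) (use dec cl bdd fin[of "N _"] in \<open>auto simp: sets less_top\<close>)
  moreover have "(\<Inter>k. N k) = S"
  proof (rule antisym)
    show "S \<subseteq> (\<Inter>k. N k)" by (auto simp: N_def)
    show "(\<Inter>k. N k) \<subseteq> S"
    proof
      fix x assume x: "x \<in> (\<Inter>k. N k)"
      have "infdist x S \<le> 0"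
      proof (rule ccontr)
        assume "\<not> ?thesis"
        then obtain k where "inverse (real (Suc k)) < infdist x S" using reals_Archimedean[of "infdist x S"] by auto
        then show False using x by (auto simp: N_def divide_inverse not_le[symmetric])
      qed
      then have "infdist x S = 0" using infdist_nonneg[of x S] by linarith
      then show "x \<in> S" using in_closed_iff_infdist_zero[OF compact_imp_closed[OF S] False] by simp
    qed
  qed
  moreover have "c \<le> emeasure M (N k)" for k
  proof -
    obtain T where T: "T \<in> sets borel" "c \<le> emeasure M T" "\<forall>x\<in>T. \<exists>y\<in>S. dist x y \<le> 1 / real (Suc k)"
      using approx[of "1 / real (Suc k)"] by auto
    have "T \<subseteq> N k" using T(3) by (force simp: N_def intro: infdist_le2)
    then show ?thesis using T(2) cl[of k] emeasure_mono[of T "N k" M] by (auto simp: sets)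
  qed
  ultimately show ?thesis by (intro LIMSEQ_le_const) auto
qed

lemma emeasure_lborel_bounded: "bounded A \<Longrightarrow> emeasure lborel A < top"
  using emeasure_bounded_finite[of A] by (simp add: top.not_eq_extremum)

lemma emeasure_lborel_eq_measure: "bounded A \<Longrightarrow> emeasure lborel A = ennreal (measure lborel A)"
  using emeasure_lborel_bounded[of A] by (intro emeasure_eq_ennreal_measure) auto

definition minkowski_sum :: "'a::plus set \<Rightarrow> 'a set \<Rightarrow> 'a set" where
  "minkowski_sum A B = {x + y | x y. x \<in> A \<and> y \<in> B}"

lemma minkowski_sum_mono: "A \<subseteq> A' \<Longrightarrow> B \<subseteq> B' \<Longrightarrow> minkowski_sum A B \<subseteq> minkowski_sum A' B'"
  unfolding minkowski_sum_def by blast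

lemma minkowski_sum_commute: "minkowski_sum A B = minkowski_sum B (A :: 'a::ab_semigroup_add set)"
  unfolding minkowski_sum_def by (metis add.commute)

lemma bounded_minkowski_sum:
  "bounded A \<Longrightarrow> bounded B \<Longrightarrow> bounded (minkowski_sum A (B :: 'a::real_normed_vector set))"
proof -
  assume "bounded A" "bounded B"
  then obtain a b where "\<And>x. x \<in> A \<Longrightarrow> norm x \<le> a" "\<And>x. x \<in> B \<Longrightarrow> norm x \<le> b"
    by (auto simp: bounded_iff)
  then show ?thesis
    unfolding bounded_iff minkowski_sum_def by (intro exI[of _ "a + b"]) (auto intro: norm_triangle_mono)
qed

lemma open_minkowski_sum:
  "open B \<Longrightarrow> open (minkowski_sum A (B :: 'a::real_normed_vector set))"
proof -
  assume "open B"
  have "minkowski_sum A B = (\<Union>x\<in>A. (+) x ` B)" by (auto simp: minkowski_sum_def)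
  then show ?thesis using \<open>open B\<close> by (auto intro: open_translation)
qed

lemma compact_minkowski_sum:
  "compact A \<Longrightarrow> compact B \<Longrightarrow> compact (minkowski_sum A (B :: 'a::real_normed_vector set))"
  unfolding minkowski_sum_def by (rule compact_sums)

section \<open>Brunn-Minkowski for finite unions of boxes\<close>

definition box_family :: "'a::euclidean_space set set \<Rightarrow> bool" where
  "box_family F \<longleftrightarrow> finite F \<and> F \<noteq> {} \<and> (\<forall>X\<in>F. X \<noteq> {} \<and> (\<exists>a b. X = box a b)) \<and> pairwise disjnt F"

lemma box_family_props:
  assumes "box_family F"
  shows "open (\<Union>F)" "bounded (\<Union>F)" "\<Union>F \<noteq> {}" "0 < measure lborel (\<Union>F)"
proof -
  show "open (\<Union>F)" using assms by (auto simp: box_family_def intro!: open_Union)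
  have "bounded X" if "X \<in> F" for X using assms that by (auto simp: box_family_def bounded_box)
  then show "bounded (\<Union>F)" using assms by (intro bounded_Union) (auto simp: box_family_def)
  show "\<Union>F \<noteq> {}" using assms by (auto simp: box_family_def)
  then obtain x where "x \<in> \<Union>F" by blast
  then obtain r where r: "0 < r" "ball x r \<subseteq> \<Union>F"
    using \<open>open (\<Union>F)\<close> open_contains_ball by metis
  have "0 < measure lborel (ball x r)" by (rule content_ball_pos[OF r(1)])
  also have "\<dots> \<le> measure lborel (\<Union>F)"
    using r(2) \<open>open (\<Union>F)\<close> emeasure_lborel_bounded[OF \<open>bounded (\<Union>F)\<close>]
    by (intro measure_mono_fmeasurable) (auto simp: fmeasurable_def)
  finally show "0 < measure lborel (\<Union>F)" .
qed

text \<open>Empty pieces are discarded: a box on the wrong side of the cut disappears from the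
  family, which makes its cardinality drop and the induction on the number of boxes work.\<close>

definition cut :: "'a set set \<Rightarrow> 'a set \<Rightarrow> 'a set set" where
  "cut F H = (\<lambda>X. X \<inter> H) ` F - {{}}"

lemma Union_cut: "\<Union>(cut F H) = \<Union>F \<inter> H"
  by (auto simp: cut_def)

lemma box_Int_halfspace:
  fixes a b :: "'a::euclidean_space"
  assumes i: "i \<in> Basis"
  shows "\<exists>a' b'. box a b \<inter> {x. x \<bullet> i < s} = box a' b'" "\<exists>a' b'. box a b \<inter> {x. s < x \<bullet> i} = box a' b'"
proof -
  have "box a b \<inter> {x. x \<bullet> i < s} = box a (\<Sum>j\<in>Basis. (if j = i then min (b \<bullet> i) s else b \<bullet> j) *\<^sub>R j)"
  proof (rule set_eqI)
    fix x
    have "x \<bullet> j < (if j = i then min (b \<bullet> i) s else b \<bullet> j) \<longleftrightarrow> x \<bullet> j < b \<bullet> j \<and> (j = i \<longrightarrow> x \<bullet> j < s)" for j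
      by simp
    then have "(\<forall>j\<in>Basis. a \<bullet> j < x \<bullet> j \<and> x \<bullet> j < (if j = i then min (b \<bullet> i) s else b \<bullet> j)) \<longleftrightarrow>
      (\<forall>j\<in>Basis. a \<bullet> j < x \<bullet> j \<and> x \<bullet> j < b \<bullet> j) \<and> x \<bullet> i < s"
      using i by blast
    then show "x \<in> box a b \<inter> {x. x \<bullet> i < s} \<longleftrightarrow>
      x \<in> box a (\<Sum>j\<in>Basis. (if j = i then min (b \<bullet> i) s else b \<bullet> j) *\<^sub>R j)"
      by (simp add: mem_box)
  qed
  then show "\<exists>a' b'. box a b \<inter> {x. x \<bullet> i < s} = box a' b'" by blast
  have "box a b \<inter> {x. s < x \<bullet> i} = box (\<Sum>j\<in>Basis. (if j = i then max (a \<bullet> i) s else a \<bullet> j) *\<^sub>R j) b"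
  proof (rule set_eqI)
    fix x
    have "(if j = i then max (a \<bullet> i) s else a \<bullet> j) < x \<bullet> j \<longleftrightarrow> a \<bullet> j < x \<bullet> j \<and> (j = i \<longrightarrow> s < x \<bullet> j)" for j
      by simp
    then have "(\<forall>j\<in>Basis. (if j = i then max (a \<bullet> i) s else a \<bullet> j) < x \<bullet> j \<and> x \<bullet> j < b \<bullet> j) \<longleftrightarrow>
      (\<forall>j\<in>Basis. a \<bullet> j < x \<bullet> j \<and> x \<bullet> j < b \<bullet> j) \<and> s < x \<bullet> i"
      using i by blast
    then show "x \<in> box a b \<inter> {x. s < x \<bullet> i} \<longleftrightarrow>
      x \<in> box (\<Sum>j\<in>Basis. (if j = i then max (a \<bullet> i) s else a \<bullet> j) *\<^sub>R j) b"
      by (simp add: mem_box)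
  qed
  then show "\<exists>a' b'. box a b \<inter> {x. s < x \<bullet> i} = box a' b'" by blast
qed

lemma box_family_cut:
  assumes F: "box_family F" and H: "\<And>a b. \<exists>a' b'. box a b \<inter> H = box a' b'" and ne: "\<Union>F \<inter> H \<noteq> {}"
  shows "box_family (cut F H)" "card (cut F H) \<le> card F"
    "X \<in> F \<Longrightarrow> X \<inter> H = {} \<Longrightarrow> card (cut F H) < card F"
proof -
  have fin: "finite F" using F by (simp add: box_family_def)
  have 1: "X \<noteq> {} \<and> (\<exists>a b. X = box a b)" if "X \<in> cut F H" for X
    using that F H unfolding cut_def box_family_def by (metis DiffE imageE insertCI)
  have "pairwise disjnt (cut F H)"
  proof (rule pairwiseI)
    fix X Y assume "X \<in> cut F H" "Y \<in> cut F H" "X \<noteq> Y"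
    then obtain X' Y' where "X' \<in> F" "Y' \<in> F" "X = X' \<inter> H" "Y = Y' \<inter> H" "X' \<noteq> Y'" by (auto simp: cut_def)
    then show "disjnt X Y" using F by (auto simp: box_family_def pairwise_def disjnt_def)
  qed
  moreover have "cut F H \<noteq> {}" using ne Union_cut[of F H] by auto
  ultimately show "box_family (cut F H)"
    unfolding box_family_def using 1 fin by (auto simp: cut_def)
  have "card (cut F H) \<le> card ((\<lambda>X. X \<inter> H) ` F)"
    unfolding cut_def using fin by (intro card_mono) auto
  also have "\<dots> \<le> card F" by (rule card_image_le[OF fin])
  finally show "card (cut F H) \<le> card F" .
  assume X: "X \<in> F" "X \<inter> H = {}"
  have "card (cut F H) \<le> card ((\<lambda>X. X \<inter> H) ` (F - {X}))"
    unfolding cut_def using fin X by (intro card_mono) auto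
  also have "\<dots> \<le> card (F - {X})" using fin by (intro card_image_le) auto
  also have "\<dots> < card F" using fin X by (intro card_Diff1_less) auto
  finally show "card (cut F H) < card F" .
qed

lemma measure_halfspace_split:
  fixes B :: "'a::euclidean_space set"
  assumes i: "i \<in> Basis" and B: "open B" "bounded B"
  shows "measure lborel B = measure lborel (B \<inter> {x. x \<bullet> i < t}) + measure lborel (B \<inter> {x. t < x \<bullet> i})"
proof -
  have "measure lborel B = measure lborel ((B \<inter> {x. x \<bullet> i < t}) \<union> (B \<inter> {x. t < x \<bullet> i}))"
  proof (rule measure_eq_AE)
    have "negligible {x::'a. x \<bullet> i = t}" by (rule negligible_standard_hyperplane[OF i])
    then have "{x::'a. x \<bullet> i = t} \<in> null_sets lborel"
      by (simp add: negligible_iff_null_sets null_sets_completion_iff)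
    then have "AE x in lborel. x \<notin> {x::'a. x \<bullet> i = t}" by (rule AE_not_in)
    then show "AE x in lborel. (x \<in> B) = (x \<in> B \<inter> {x. x \<bullet> i < t} \<union> B \<inter> {x. t < x \<bullet> i})"
      by eventually_elim auto
  qed (use B in \<open>auto intro!: borel_open open_Int open_Un open_halfspace_component_lt open_halfspace_component_gt\<close>)
  also have "\<dots> = measure lborel (B \<inter> {x. x \<bullet> i < t}) + measure lborel (B \<inter> {x. t < x \<bullet> i})"
    using B emeasure_lborel_bounded[of "B \<inter> _"]
    by (intro measure_Union) (auto simp: bounded_Int less_top[symmetric] intro!: borel_open open_Int open_halfspace_component_lt open_halfspace_component_gt)
  finally show ?thesis .
qed

lemma measure_halfspace_continuous:
  fixes B :: "'a::euclidean_space set"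
  assumes i: "i \<in> Basis" and B: "open B" "bounded B"
  shows "continuous_on UNIV (\<lambda>t. measure lborel (B \<inter> {x. x \<bullet> i < t}))"
  unfolding continuous_on_sequentially
proof (intro ballI allI impI, elim conjE)
  fix u :: "nat \<Rightarrow> real" and t assume u: "u \<longlonglongrightarrow> t"
  have sets: "B \<inter> {x. x \<bullet> i < s} \<in> sets lborel" for s
    using B by (auto intro!: borel_open open_Int open_halfspace_component_lt)
  have lim: "AE x in lborel. (\<lambda>k. indicator (B \<inter> {x. x \<bullet> i < u k}) x :: real) \<longlonglongrightarrow> indicator (B \<inter> {x. x \<bullet> i < t}) x"
  proof -
    have "negligible {x::'a. x \<bullet> i = t}" by (rule negligible_standard_hyperplane[OF i])
    then have "{x::'a. x \<bullet> i = t} \<in> null_sets lborel"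
      by (simp add: negligible_iff_null_sets null_sets_completion_iff)
    then have "AE x in lborel. x \<notin> {x::'a. x \<bullet> i = t}" by (rule AE_not_in)
    then show ?thesis
    proof eventually_elim
      case (elim x)
      then consider "x \<bullet> i < t" | "t < x \<bullet> i" by force
      then have "\<forall>\<^sub>F k in sequentially. indicator (B \<inter> {x. x \<bullet> i < u k}) x = (indicator (B \<inter> {x. x \<bullet> i < t}) x :: real)"
      proof cases
        case 1
        show ?thesis using order_tendstoD(1)[OF u 1] by eventually_elim (use 1 in \<open>auto simp: indicator_def\<close>)
      next
        case 2
        show ?thesis using order_tendstoD(2)[OF u 2] by eventually_elim (use 2 in \<open>auto simp: indicator_def\<close>)
      qed
      then show ?case by (rule tendsto_eventually)
    qed
  qed
  have "(\<lambda>k. \<integral>x. indicator (B \<inter> {x. x \<bullet> i < u k}) x \<partial>lborel) \<longlonglongrightarrow> (\<integral>x. (indicator (B \<inter> {x. x \<bullet> i < t}) x :: real) \<partial>lborel)"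
  proof (rule integral_dominated_convergence[where w="indicator B"])
    show "integrable lborel (indicator B :: 'a \<Rightarrow> real)"
      using B emeasure_lborel_bounded[OF B(2)] by (intro integrable_real_indicator) auto
    show "AE x in lborel. norm (indicator (B \<inter> {x. x \<bullet> i < u k}) x :: real) \<le> indicator B x" for k
      by (auto simp: indicator_def)
  qed (use sets lim in \<open>auto intro!: borel_measurable_indicator\<close>)
  then show "((\<lambda>t. measure lborel (B \<inter> {x. x \<bullet> i < t})) \<circ> u) \<longlonglongrightarrow> measure lborel (B \<inter> {x. x \<bullet> i < t})"
    using sets by (simp add: o_def)
qed

text \<open>The volume cut off by a moving hyperplane is continuous, so a set can be cut in any
  prescribed ratio \<open>q\<close>. This is how the cut of one family of boxes is matched in the
  other.\<close>

lemma measure_halfspace_IVT: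
  fixes B :: "'a::euclidean_space set"
  assumes i: "i \<in> Basis" and B: "open B" "bounded B" and q: "0 \<le> q" "q \<le> 1"
  obtains t where "measure lborel (B \<inter> {x. x \<bullet> i < t}) = q * measure lborel B"
    "measure lborel (B \<inter> {x. t < x \<bullet> i}) = (1 - q) * measure lborel B"
proof -
  obtain r where r: "0 < r" "\<And>x. x \<in> B \<Longrightarrow> norm x \<le> r" using B(2) by (auto simp: bounded_pos)
  have xi: "- r \<le> x \<bullet> i" "x \<bullet> i \<le> r" if "x \<in> B" for x
    using r(2)[OF that] Basis_le_norm[OF i, of x] by (auto simp: abs_le_iff)
  have lo: "B \<inter> {x. x \<bullet> i < - r - 1} = {}" using xi(1) by force
  have hi: "B \<inter> {x. x \<bullet> i < r + 1} = B" using xi(2) by force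
  have "\<exists>t\<ge>- r - 1. t \<le> r + 1 \<and> measure lborel (B \<inter> {x. x \<bullet> i < t}) = q * measure lborel B"
  proof (rule IVT')
    show "measure lborel (B \<inter> {x. x \<bullet> i < - r - 1}) \<le> q * measure lborel B"
      unfolding lo using q by (simp add: measure_nonneg)
    show "q * measure lborel B \<le> measure lborel (B \<inter> {x. x \<bullet> i < r + 1})"
      unfolding hi using q by (simp add: mult_left_le_one_le measure_nonneg)
  qed (use r in \<open>auto intro!: continuous_on_subset[OF measure_halfspace_continuous[OF i B]]\<close>)
  then obtain t where t: "measure lborel (B \<inter> {x. x \<bullet> i < t}) = q * measure lborel B" by blast
  moreover have "measure lborel (B \<inter> {x. t < x \<bullet> i}) = (1 - q) * measure lborel B"
    unfolding left_diff_distrib mult_1 using t measure_halfspace_split[OF i B, of t] by linarith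
  ultimately show thesis by (rule that)
qed

text \<open>The case of two boxes with edges \<open>u i\<close> and \<open>w i\<close>. After
  division by the right-hand side, the inequality of arithmetic and geometric means is applied to
  the ratios \<open>u i / (u i + w i)\<close> and \<open>w i / (u i + w i)\<close>, which add up to
  1 for each \<open>i\<close>.\<close>

lemma root_prod_add_le:
  fixes u w :: "'a \<Rightarrow> real"
  assumes S: "finite S" "S \<noteq> {}" and u: "\<And>i. i \<in> S \<Longrightarrow> 0 < u i" and w: "\<And>i. i \<in> S \<Longrightarrow> 0 < w i"
  shows "root (card S) (\<Prod>i\<in>S. u i) + root (card S) (\<Prod>i\<in>S. w i) \<le> root (card S) (\<Prod>i\<in>S. u i + w i)"
proof -
  let ?n = "card S"
  have n: "0 < ?n" using S by (simp add: card_gt_0_iff)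
  have amgm: "root ?n (\<Prod>i\<in>S. x i) \<le> (\<Sum>i\<in>S. x i) / ?n" if "\<And>i. i \<in> S \<Longrightarrow> 0 < x i" for x :: "'a \<Rightarrow> real"
    using arith_geom_mean[OF S, of x] that n
    by (simp add: root_powr_inverse prod_pos less_imp_le sum_divide_distrib)
  have uw: "0 < u i + w i" if "i \<in> S" for i using u w that by (simp add: add_pos_pos)
  have P: "0 < (\<Prod>i\<in>S. u i + w i)" using uw by (rule prod_pos)
  have "root ?n (\<Prod>i\<in>S. u i / (u i + w i)) + root ?n (\<Prod>i\<in>S. w i / (u i + w i))
    \<le> (\<Sum>i\<in>S. u i / (u i + w i)) / ?n + (\<Sum>i\<in>S. w i / (u i + w i)) / ?n"
    using u w uw by (intro add_mono amgm) auto
  also have "\<dots> = (\<Sum>i\<in>S. u i / (u i + w i) + w i / (u i + w i)) / ?n"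
    by (simp add: sum.distrib add_divide_distrib)
  also have "(\<Sum>i\<in>S. u i / (u i + w i) + w i / (u i + w i)) = (\<Sum>i\<in>S. 1)"
  proof (rule sum.cong[OF refl])
    fix i assume "i \<in> S"
    then show "u i / (u i + w i) + w i / (u i + w i) = 1"
      using uw[of i] unfolding add_divide_distrib[symmetric] by simp
  qed
  finally have "(root ?n (\<Prod>i\<in>S. u i) + root ?n (\<Prod>i\<in>S. w i)) / root ?n (\<Prod>i\<in>S. u i + w i) \<le> 1"
    using n by (simp add: prod_dividef real_root_divide add_divide_distrib)
  then show ?thesis using P n by (simp add: pos_divide_le_eq)
qed

lemma measure_box_Basis: "box a b \<noteq> {} \<Longrightarrow> measure lborel (box a (b::'a::euclidean_space)) = (\<Prod>i\<in>Basis. b \<bullet> i - a \<bullet> i)"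
  by (auto simp: measure_def emeasure_lborel_box_eq box_eq_empty inner_diff_left not_le prod_nonneg less_imp_le
      split: if_splits)

text \<open>The induction of Hadwiger and Ohmann on the number of boxes. A coordinate hyperplane
  separates two boxes of one family, and the other family is cut by a parallel hyperplane in the
  same volume ratio. Either side then has fewer boxes in total, and the Minkowski sums of
  corresponding sides lie in opposite open half-spaces, so their volumes add. A single pair of boxes
  is \<open>root_prod_add_le\<close>.\<close>

lemma brunn_minkowski_boxes:
  fixes F G :: "'a::euclidean_space set set"
  assumes "box_family F" "box_family G"
  shows "root DIM('a) (measure lborel (\<Union>F)) + root DIM('a) (measure lborel (\<Union>G))
     \<le> root DIM('a) (measure lborel (minkowski_sum (\<Union>F) (\<Union>G)))"
  using assms
proof (induction "card F + card G" arbitrary: F G rule: less_induct)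
  case less
  let ?r = "root DIM('a)"
  let ?m = "measure lborel"
  have n: "0 < DIM('a)" by simp
  have step: "?r (?m (\<Union>F)) + ?r (?m (\<Union>G)) \<le> ?r (?m (minkowski_sum (\<Union>F) (\<Union>G)))"
    if F: "box_family F" and G: "box_family G" and PQ: "P \<in> F" "Q \<in> F" "P \<noteq> Q"
      and IH: "\<And>F' G' :: 'a set set. card F' + card G' < card F + card G \<Longrightarrow> box_family F' \<Longrightarrow> box_family G' \<Longrightarrow>
        ?r (?m (\<Union>F')) + ?r (?m (\<Union>G')) \<le> ?r (?m (minkowski_sum (\<Union>F') (\<Union>G')))"
    for F G :: "'a set set" and P Q
  proof -
    \<comment> \<open>Disjoint nonempty boxes are separated in some coordinate. Which of them lies
      below is unknown, hence the fresh choice of \<open>P\<close> and \<open>Q\<close>.\<close>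
    have "\<exists>P\<in>F. \<exists>Q\<in>F. \<exists>i\<in>Basis. \<exists>s. P \<inter> {x. s < x \<bullet> i} = {} \<and> Q \<inter> {x. x \<bullet> i < s} = {}"
    proof -
      obtain a b c d where ab: "P = box a b" "Q = box c d" "P \<noteq> {}" "Q \<noteq> {}" "P \<inter> Q = {}"
        using F PQ unfolding box_family_def pairwise_def disjnt_def by metis
      then obtain i where i: "i \<in> Basis" "b \<bullet> i \<le> c \<bullet> i \<or> d \<bullet> i \<le> a \<bullet> i"
        using ab(3-5) unfolding ab(1,2) disjoint_interval(4) box_eq_empty(1) by blast
      then show ?thesis
      proof (elim disjE)
        assume "b \<bullet> i \<le> c \<bullet> i"
        then have "P \<inter> {x. b \<bullet> i < x \<bullet> i} = {}" "Q \<inter> {x. x \<bullet> i < b \<bullet> i} = {}"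
          using i ab by (force simp: mem_box)+
        then show ?thesis using PQ i by blast
      next
        assume "d \<bullet> i \<le> a \<bullet> i"
        then have "Q \<inter> {x. d \<bullet> i < x \<bullet> i} = {}" "P \<inter> {x. x \<bullet> i < d \<bullet> i} = {}"
          using i ab by (force simp: mem_box)+
        then show ?thesis using PQ i by blast
      qed
    qed
    then obtain P Q i s where PQ: "P \<in> F" "Q \<in> F" and i: "i \<in> Basis"
      and s: "P \<inter> {x. s < x \<bullet> i} = {}" "Q \<inter> {x. x \<bullet> i < s} = {}" by blast
    define L R where "L t = {x::'a. x \<bullet> i < t}" and "R t = {x::'a. t < x \<bullet> i}" for t
    note LR = box_Int_halfspace[OF i]
    have opens: "open (L t)" "open (R t)" for t
      unfolding L_def R_def by (rule open_halfspace_component_lt open_halfspace_component_gt)+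
    note pF = box_family_props[OF F] and pG = box_family_props[OF G]
    have mF: "?m (\<Union>F) = ?m (\<Union>F \<inter> L s) + ?m (\<Union>F \<inter> R s)"
      unfolding L_def R_def by (rule measure_halfspace_split[OF i pF(1,2)])
    \<comment> \<open>A nonempty open box does not fit into the hyperplane
      \<open>x \<bullet> i = s\<close>, so each side of the cut keeps at least one box.\<close>
    have neg0: "\<exists>x\<in>P. x \<bullet> i < s" if "P \<in> F" "P \<inter> {x. s < x \<bullet> i} = {}" for P
    proof (rule ccontr)
      assume *: "\<not> ?thesis"
      have "open P" "P \<noteq> {}" using F that(1) by (auto simp: box_family_def)
      moreover have "P \<subseteq> {x. x \<bullet> i = s}" using * that(2) by force
      ultimately show False
        using open_not_negligible negligible_subset negligible_standard_hyperplane[OF i] by metis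
    qed
    have pos0: "\<exists>x\<in>Q. s < x \<bullet> i" if "Q \<in> F" "Q \<inter> {x. x \<bullet> i < s} = {}" for Q
    proof (rule ccontr)
      assume *: "\<not> ?thesis"
      have "open Q" "Q \<noteq> {}" using F that(1) by (auto simp: box_family_def)
      moreover have "Q \<subseteq> {x. x \<bullet> i = s}" using * that(2) by force
      ultimately show False
        using open_not_negligible negligible_subset negligible_standard_hyperplane[OF i] by metis
    qed
    have FL: "box_family (cut F (L s))" "card (cut F (L s)) < card F"
      using box_family_cut[OF F LR(1)[of _ _ s]] neg0[OF PQ(1) s(1)] PQ s unfolding L_def by blast+
    have FR: "box_family (cut F (R s))" "card (cut F (R s)) < card F"
      using box_family_cut[OF F LR(2)[of _ _ s]] pos0[OF PQ(2) s(2)] PQ s unfolding R_def by blast+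
    define q where "q = ?m (\<Union>F \<inter> L s) / ?m (\<Union>F)"
    have mL: "0 < ?m (\<Union>F \<inter> L s)" and mR: "0 < ?m (\<Union>F \<inter> R s)"
      using box_family_props(4)[OF FL(1)] box_family_props(4)[OF FR(1)] by (simp_all add: Union_cut)
    have q: "0 < q" "q < 1" using mF mL mR by (simp_all add: q_def)
    have qL: "?m (\<Union>F \<inter> L s) = q * ?m (\<Union>F)" using pF(4) by (simp add: q_def)
    have qR: "?m (\<Union>F \<inter> R s) = (1 - q) * ?m (\<Union>F)" using mF qL by (simp add: algebra_simps)
    obtain t where tL: "?m (\<Union>G \<inter> L t) = q * ?m (\<Union>G)" and tR: "?m (\<Union>G \<inter> R t) = (1 - q) * ?m (\<Union>G)"
      unfolding L_def R_def using measure_halfspace_IVT[OF i pG(1,2), of q] q by auto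
    have "\<Union>G \<inter> L t \<noteq> {}" "\<Union>G \<inter> R t \<noteq> {}" using tL tR q pG(4) by (metis measure_empty mult_eq_0_iff order_less_irrefl diff_gt_0_iff_gt)+
    then have GL: "box_family (cut G (L t))" "card (cut G (L t)) \<le> card G"
      and GR: "box_family (cut G (R t))" "card (cut G (R t)) \<le> card G"
      using box_family_cut[OF G LR(1)[of _ _ t]] box_family_cut[OF G LR(2)[of _ _ t]] unfolding L_def R_def by blast+
    let ?A = "minkowski_sum (\<Union>F \<inter> L s) (\<Union>G \<inter> L t)" and ?B = "minkowski_sum (\<Union>F \<inter> R s) (\<Union>G \<inter> R t)"
    let ?S = "?r (?m (\<Union>F)) + ?r (?m (\<Union>G))"
    have S0: "0 \<le> ?S" by (simp add: real_root_ge_zero measure_nonneg)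
    have IHL: "?r (q * ?m (\<Union>F)) + ?r (q * ?m (\<Union>G)) \<le> ?r (?m ?A)"
      using IH[of "cut F (L s)" "cut G (L t)"] FL GL by (simp add: Union_cut qL tL)
    have IHR: "?r ((1 - q) * ?m (\<Union>F)) + ?r ((1 - q) * ?m (\<Union>G)) \<le> ?r (?m ?B)"
      using IH[of "cut F (R s)" "cut G (R t)"] FR GR by (simp add: Union_cut qR tR)
    \<comment> \<open>Both families are cut in the same ratio, so the factor \<open>p\<close> can be
      taken out of both roots; the two inductive bounds then enter with the weights \<open>q\<close>
      and \<open>1 - q\<close>, which add up to 1.\<close>
    have pow: "p * ?S ^ DIM('a) \<le> m" if "?r (p * ?m (\<Union>F)) + ?r (p * ?m (\<Union>G)) \<le> ?r m" "0 \<le> p" "0 \<le> m" for p m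
    proof -
      have "?r p * ?S \<le> ?r m" using that(1) by (simp add: real_root_mult algebra_simps)
      then have "(?r p * ?S) ^ DIM('a) \<le> ?r m ^ DIM('a)"
        using S0 that by (intro power_mono) (auto simp: real_root_ge_zero)
      then show ?thesis using that n by (simp add: power_mult_distrib real_root_pow_pos2)
    qed
    have "?A \<union> ?B \<subseteq> minkowski_sum (\<Union>F) (\<Union>G)" by (intro Un_least minkowski_sum_mono) auto
    moreover have "?A \<inter> ?B = {}"
    proof -
      have "z \<bullet> i < s + t" if "z \<in> ?A" for z
        using that unfolding minkowski_sum_def L_def by (auto simp: inner_add_left intro: add_strict_mono)
      moreover have "s + t < z \<bullet> i" if "z \<in> ?B" for z
        using that unfolding minkowski_sum_def R_def by (auto simp: inner_add_left intro: add_strict_mono)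
      ultimately show ?thesis using order_less_asym by blast
    qed
    moreover have oA: "open ?A" "open ?B" "open (minkowski_sum (\<Union>F) (\<Union>G))"
      using pG(1) opens by (auto intro!: open_minkowski_sum open_Int)
    moreover have bS: "bounded ?A" "bounded ?B" "bounded (minkowski_sum (\<Union>F) (\<Union>G))"
      using pF(2) pG(2) by (auto intro!: bounded_minkowski_sum bounded_Int)
    ultimately have "?m ?A + ?m ?B \<le> ?m (minkowski_sum (\<Union>F) (\<Union>G))"
      using emeasure_lborel_bounded[OF bS(1)] emeasure_lborel_bounded[OF bS(2)] emeasure_lborel_bounded[OF bS(3)]
      by (subst measure_Union[symmetric]) (auto intro!: measure_mono_fmeasurable simp: fmeasurable_def borel_open open_Un)
    moreover have "q * ?S ^ DIM('a) \<le> ?m ?A" using pow[OF IHL] q by (simp add: measure_nonneg)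
    moreover have "(1 - q) * ?S ^ DIM('a) \<le> ?m ?B" using pow[OF IHR] q by (simp add: measure_nonneg)
    ultimately have "?S ^ DIM('a) \<le> ?m (minkowski_sum (\<Union>F) (\<Union>G))" by (simp add: algebra_simps)
    then have "?r (?S ^ DIM('a)) \<le> ?r (?m (minkowski_sum (\<Union>F) (\<Union>G)))" using n by simp
    then show ?thesis using S0 n by (simp add: real_root_power_cancel)
  qed
  note F = less.prems(1) and G = less.prems(2)
  consider (1) "\<exists>P\<in>F. \<exists>Q\<in>F. P \<noteq> Q" | (2) "\<exists>P\<in>G. \<exists>Q\<in>G. P \<noteq> Q"
    | (3) "\<forall>P\<in>F. \<forall>Q\<in>F. P = Q" "\<forall>P\<in>G. \<forall>Q\<in>G. P = Q" by meson
  then show ?case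
  proof cases
    case 1
    then obtain P Q where "P \<in> F" "Q \<in> F" "P \<noteq> Q" by blast
    then show ?thesis by (rule step[OF F G]) (use less.hyps in auto)
  next
    case 2
    then obtain P Q where PQ: "P \<in> G" "Q \<in> G" "P \<noteq> Q" by blast
    have "?r (?m (\<Union>G)) + ?r (?m (\<Union>F)) \<le> ?r (?m (minkowski_sum (\<Union>G) (\<Union>F)))"
      by (rule step[OF G F PQ]) (use less.hyps in \<open>auto simp: add.commute\<close>)
    then show ?thesis by (simp only: minkowski_sum_commute[of "\<Union>G"] add.commute[of "?r (?m (\<Union>G))"])
  next
    case 3
    obtain X where X: "X \<in> F" using F by (auto simp: box_family_def)
    obtain Y where Y: "Y \<in> G" using G by (auto simp: box_family_def)
    have "P = X" if "P \<in> F" for P by (rule bspec[OF bspec[OF 3(1) that] X])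
    then have "F = {X}" using X by blast
    have "P = Y" if "P \<in> G" for P by (rule bspec[OF bspec[OF 3(2) that] Y])
    then have "G = {Y}" using Y by blast
    have XY: "\<Union>F = X" "\<Union>G = Y" by (simp_all add: \<open>F = {X}\<close> \<open>G = {Y}\<close>)
    obtain a b c d where X: "X = box a b" "X \<noteq> {}" and Y: "Y = box c d" "Y \<noteq> {}"
      using F G X Y by (auto simp: box_family_def) metis
    have ab: "a \<bullet> i < b \<bullet> i" and cd: "c \<bullet> i < d \<bullet> i" if "i \<in> Basis" for i
      using X Y that by (auto simp: box_eq_empty not_le)
    have ne: "box (a + c) (b + d) \<noteq> {}" using ab cd by (force simp: box_eq_empty inner_add_left)
    have sub: "box (a + c) (b + d) \<subseteq> minkowski_sum X Y"
    proof
      fix z assume z: "z \<in> box (a + c) (b + d)"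
      \<comment> \<open>Relative position of \<open>z\<close> along the \<open>i\<close>-th edge of
        the sum box. The point of \<open>X\<close> at the same relative position leaves a remainder
        in \<open>Y\<close>.\<close>
      define p where "p i = (z \<bullet> i - a \<bullet> i - c \<bullet> i) / ((b \<bullet> i - a \<bullet> i) + (d \<bullet> i - c \<bullet> i))" for i
      define x where "x = (\<Sum>i\<in>Basis. (a \<bullet> i + p i * (b \<bullet> i - a \<bullet> i)) *\<^sub>R i)"
      have p: "0 < p i" "p i < 1" if "i \<in> Basis" for i
        using z ab[OF that] cd[OF that] that by (auto simp: p_def mem_box inner_add_left field_simps)
      have pm: "p i * ((b \<bullet> i - a \<bullet> i) + (d \<bullet> i - c \<bullet> i)) = z \<bullet> i - a \<bullet> i - c \<bullet> i" if "i \<in> Basis" for i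
        using ab[OF that] cd[OF that] by (simp add: p_def)
      have lt: "0 < p i * e \<and> p i * e < e" if "i \<in> Basis" "0 < e" for i e
        using p[OF that(1)] that(2) by simp
      have "x \<in> X"
        unfolding X mem_box
      proof (intro ballI)
        fix i :: 'a assume i: "i \<in> Basis"
        have "x \<bullet> i = a \<bullet> i + p i * (b \<bullet> i - a \<bullet> i)" using i by (simp add: x_def)
        moreover have "0 < p i * (b \<bullet> i - a \<bullet> i) \<and> p i * (b \<bullet> i - a \<bullet> i) < b \<bullet> i - a \<bullet> i"
          by (rule lt[OF i]) (use ab[OF i] in simp)
        ultimately show "a \<bullet> i < x \<bullet> i \<and> x \<bullet> i < b \<bullet> i" by linarith
      qed
      moreover have "z - x \<in> Y"
        unfolding Y mem_box
      proof (intro ballI)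
        fix i :: 'a assume i: "i \<in> Basis"
        have xi: "x \<bullet> i = a \<bullet> i + p i * (b \<bullet> i - a \<bullet> i)" using i by (simp add: x_def)
        have "(z - x) \<bullet> i = c \<bullet> i + p i * (d \<bullet> i - c \<bullet> i)"
          unfolding inner_diff_left xi using pm[OF i] by (simp add: algebra_simps)
        moreover have "0 < p i * (d \<bullet> i - c \<bullet> i) \<and> p i * (d \<bullet> i - c \<bullet> i) < d \<bullet> i - c \<bullet> i"
          by (rule lt[OF i]) (use cd[OF i] in simp)
        ultimately show "c \<bullet> i < (z - x) \<bullet> i \<and> (z - x) \<bullet> i < d \<bullet> i" by linarith
      qed
      ultimately show "z \<in> minkowski_sum X Y" unfolding minkowski_sum_def by (force intro: exI[of _ x] exI[of _ "z - x"])
    qed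
    have bS: "bounded (minkowski_sum X Y)" "open (minkowski_sum X Y)"
      using X Y by (auto intro: bounded_minkowski_sum open_minkowski_sum bounded_box)
    have "?r (?m X) + ?r (?m Y) \<le> ?r (?m (box (a + c) (b + d)))"
      using root_prod_add_le[of Basis "\<lambda>i. b \<bullet> i - a \<bullet> i" "\<lambda>i. d \<bullet> i - c \<bullet> i"] X Y ab cd
      by (simp add: measure_box_Basis ne inner_add_left algebra_simps)
    also have "\<dots> \<le> ?r (?m (minkowski_sum X Y))"
      using sub bS emeasure_lborel_bounded[OF bS(1)]
      by (intro real_root_le_mono n measure_mono_fmeasurable) (auto simp: fmeasurable_def)
    finally show ?thesis by (simp add: XY)
  qed
qed

text \<open>Finitely many small cubes centred in \<open>S\<close> cover it. Their union is divided
  into boxes with disjoint interiors, and passing to the interiors costs only a null set.\<close>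

lemma compact_box_family_approx:
  fixes S :: "'a::euclidean_space set"
  assumes S: "compact S" "S \<noteq> {}" and e: "0 < e"
  obtains F where "box_family F" "measure lborel S \<le> measure lborel (\<Union>F)" "\<And>x. x \<in> \<Union>F \<Longrightarrow> \<exists>y\<in>S. dist x y \<le> e"
proof -
  \<comment> \<open>The distance is estimated by the sum of the absolute coordinates, hence the
    division by the dimension.\<close>
  define d where "d = e / DIM('a)"
  have d: "0 < d" using e by (simp add: d_def)
  have near: "dist x y \<le> e" if "x \<in> cbox (y - d *\<^sub>R One) (y + d *\<^sub>R One)" for x y :: 'a
  proof -
    have "dist x y \<le> (\<Sum>i\<in>Basis. \<bar>(x - y) \<bullet> i\<bar>)" unfolding dist_norm by (rule norm_le_l1)
    also have "\<dots> \<le> (\<Sum>i\<in>(Basis::'a set). d)"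
      using that by (intro sum_mono) (force simp: mem_box inner_diff_left inner_add_left abs_le_iff)
    finally show ?thesis by (simp add: d_def)
  qed
  obtain C where C: "C \<subseteq> S" "finite C" "S \<subseteq> (\<Union>y\<in>C. box (y - d *\<^sub>R One) (y + d *\<^sub>R One))"
  proof (rule compactE_image[OF S(1), of S "\<lambda>y. box (y - d *\<^sub>R One) (y + d *\<^sub>R One)"])
    show "S \<subseteq> (\<Union>y\<in>S. box (y - d *\<^sub>R One) (y + d *\<^sub>R One))"
      using d by (force simp: mem_box inner_diff_left inner_add_left)
  qed (auto simp: open_box)
  have "C \<noteq> {}" using C(3) S(2) by auto
  define K where "K = (\<Union>y\<in>C. cbox (y - d *\<^sub>R One) (y + d *\<^sub>R One))"
  have SK: "S \<subseteq> K" using C(3) box_subset_cbox unfolding K_def by blast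
  obtain p where p: "p division_of K"
    unfolding K_def by (rule elementary_unions_intervals[of "(\<lambda>y. cbox (y - d *\<^sub>R One) (y + d *\<^sub>R One)) ` C"]) (use C(2) in auto)
  note pD = division_ofD[OF p]
  define F where "F = interior ` p - {{}}"
  have UF: "\<Union>F = (\<Union>k\<in>p. interior k)" by (auto simp: F_def)
  have "negligible (K - \<Union>F)"
  proof (rule negligible_subset)
    show "negligible (\<Union>k\<in>p. k - interior k)"
    proof (intro negligible_Union finite_imageI pD(1), elim imageE)
      fix N k assume "k \<in> p" "N = k - interior k"
      then show "negligible N" using pD(4)[of k] by (auto simp: interior_cbox negligible_frontier_interval)
    qed
    show "K - \<Union>F \<subseteq> (\<Union>k\<in>p. k - interior k)" using pD(6) by (auto simp: UF)
  qed
  have oF: "open (\<Union>F)" unfolding UF by (auto intro!: open_UN)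
  have cK: "compact K" unfolding K_def using C(2) by (intro compact_UN) auto
  have "measure lborel K = measure lborel (\<Union>F)"
  proof (rule measure_eq_AE)
    have "K - \<Union>F \<in> sets borel" by (intro sets.Diff borel_compact borel_open cK oF)
    then have "K - \<Union>F \<in> null_sets lborel"
      using \<open>negligible (K - \<Union>F)\<close> by (simp add: negligible_iff_null_sets null_sets_completion_iff)
    then have "AE x in lborel. x \<notin> K - \<Union>F" by (rule AE_not_in)
    moreover have "\<Union>F \<subseteq> K" using pD(6) interior_subset unfolding UF by blast
    ultimately show "AE x in lborel. (x \<in> K) = (x \<in> \<Union>F)" by (auto elim!: eventually_mono)
  qed (use cK oF in \<open>auto intro: borel_compact\<close>)
  moreover have SleK: "measure lborel S \<le> measure lborel K"
    using SK S(1) cK emeasure_lborel_bounded[OF compact_imp_bounded[OF cK]]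
    by (intro measure_mono_fmeasurable) (auto simp: fmeasurable_def borel_compact)
  moreover have "box_family F"
    unfolding box_family_def
  proof (intro conjI ballI)
    show "finite F" using pD(1) by (simp add: F_def)
    obtain y where y: "y \<in> C" using \<open>C \<noteq> {}\<close> by blast
    have "0 < measure lborel (cbox (y - d *\<^sub>R One) (y + d *\<^sub>R One))"
      using d by (simp add: content_pos_lt inner_diff_left inner_add_left)
    also have "\<dots> \<le> measure lborel K"
      using y cK emeasure_lborel_bounded[OF compact_imp_bounded[OF cK]]
      by (intro measure_mono_fmeasurable) (auto simp: fmeasurable_def borel_compact K_def)
    finally show "F \<noteq> {}" using \<open>measure lborel K = measure lborel (\<Union>F)\<close> by auto
    show "pairwise disjnt F"
      using pD(5) unfolding F_def pairwise_def disjnt_def by blast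
    fix X assume X: "X \<in> F"
    then show "X \<noteq> {}" by (simp add: F_def)
    show "\<exists>a b. X = box a b" using X pD(4) unfolding F_def by (metis DiffD1 imageE interior_cbox)
  qed
  moreover have "\<exists>y\<in>S. dist x y \<le> e" if "x \<in> \<Union>F" for x
  proof -
    have "x \<in> K" using that interior_subset pD(6) unfolding UF by blast
    then show ?thesis using near C(1) unfolding K_def by blast
  qed
  ultimately show thesis using that by metis
qed

text \<open>Box families approximate \<open>S\<close> and \<open>T\<close> from outside within
  \<open>e / 2\<close>, and their sum lies within \<open>e\<close> of the compact set
  \<open>minkowski_sum S T\<close>, where volume is upper semicontinuous.\<close>

theorem brunn_minkowski:
  fixes S T :: "'a::euclidean_space set"
  assumes S: "compact S" "S \<noteq> {}" and T: "compact T" "T \<noteq> {}"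
  shows "root DIM('a) (measure lborel S) + root DIM('a) (measure lborel T)
     \<le> root DIM('a) (measure lborel (minkowski_sum S T))"
proof -
  let ?r = "root DIM('a)" and ?m = "measure lborel"
  let ?c = "(?r (?m S) + ?r (?m T)) ^ DIM('a)"
  have cST: "compact (minkowski_sum S T)" using S T by (intro compact_minkowski_sum)
  have c0: "0 \<le> ?r (?m S) + ?r (?m T)" by (simp add: real_root_ge_zero measure_nonneg)
  have "ennreal ?c \<le> emeasure lborel (minkowski_sum S T)"
  proof (rule emeasure_compact_upper_semicontinuous[OF _ cST])
    fix e :: real assume e: "0 < e"
    obtain F where F: "box_family F" "?m S \<le> ?m (\<Union>F)" "\<And>x. x \<in> \<Union>F \<Longrightarrow> \<exists>y\<in>S. dist x y \<le> e / 2"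
      using compact_box_family_approx[OF S, of "e/2"] e by auto
    obtain G where G: "box_family G" "?m T \<le> ?m (\<Union>G)" "\<And>x. x \<in> \<Union>G \<Longrightarrow> \<exists>y\<in>T. dist x y \<le> e / 2"
      using compact_box_family_approx[OF T, of "e/2"] e by auto
    let ?A = "minkowski_sum (\<Union>F) (\<Union>G)"
    note pF = box_family_props[OF F(1)] and pG = box_family_props[OF G(1)]
    have A: "open ?A" "bounded ?A" using pF pG by (auto intro: open_minkowski_sum bounded_minkowski_sum)
    have "?r (?m S) + ?r (?m T) \<le> ?r (?m (\<Union>F)) + ?r (?m (\<Union>G))"
      using F(2) G(2) by (intro add_mono real_root_le_mono) auto
    also have "\<dots> \<le> ?r (?m ?A)" by (rule brunn_minkowski_boxes[OF F(1) G(1)])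
    finally have "?c \<le> ?r (?m ?A) ^ DIM('a)" using c0 by (intro power_mono)
    also have "\<dots> = ?m ?A" by (intro real_root_pow_pos2) (auto simp: measure_nonneg)
    finally have "ennreal ?c \<le> emeasure lborel ?A" by (simp add: emeasure_lborel_eq_measure[OF A(2)] ennreal_leI)
    moreover have "\<forall>x\<in>?A. \<exists>y\<in>minkowski_sum S T. dist x y \<le> e"
    proof
      fix z assume "z \<in> ?A"
      then obtain x y where xy: "x \<in> \<Union>F" "y \<in> \<Union>G" "z = x + y" unfolding minkowski_sum_def by blast
      obtain s t where st: "s \<in> S" "dist x s \<le> e / 2" "t \<in> T" "dist y t \<le> e / 2" using F(3)[OF xy(1)] G(3)[OF xy(2)] by blast
      have "dist z (s + t) \<le> e" unfolding xy(3) using dist_triangle_add[of x y s t] st by linarith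
      then show "\<exists>y\<in>minkowski_sum S T. dist z y \<le> e" using st unfolding minkowski_sum_def by blast
    qed
    ultimately show "\<exists>A\<in>sets borel. ennreal ?c \<le> emeasure lborel A \<and> (\<forall>x\<in>A. \<exists>y\<in>minkowski_sum S T. dist x y \<le> e)"
      using A(1) by (intro bexI[of _ ?A] conjI) (auto intro: borel_open)
  qed (auto intro: emeasure_lborel_bounded)
  then have "?c \<le> ?m (minkowski_sum S T)"
    by (simp add: emeasure_lborel_eq_measure[OF compact_imp_bounded[OF cST]] measure_nonneg)
  then have "?r ?c \<le> ?r (?m (minkowski_sum S T))" by (intro real_root_le_mono) auto
  then show ?thesis using c0 by (simp add: real_root_power_cancel)
qed

section \<open>Displacement along monotone sets\<close>

text \<open>Tychonoff's theorem. Pinning the coordinates outside \<open>Y\<close> to 0 allows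
  weights on \<open>Y\<close> to be functions on the whole type, with its product topology.\<close>

lemma compact_finite_coordinate_box:
  "compact {c :: 'a \<Rightarrow> real. (\<forall>y\<in>Y. c y \<in> {0..M}) \<and> (\<forall>y. y \<notin> Y \<longrightarrow> c y = 0)}"
proof -
  have "compactin (product_topology (\<lambda>i. euclidean) UNIV) (PiE UNIV (\<lambda>y::'a. if y \<in> Y then {0..M} else {0::real}))"
    by (subst compactin_PiE) (auto simp: compactin_euclidean_iff)
  moreover have "PiE UNIV (\<lambda>y. if y \<in> Y then {0..M} else {0}) = {c. (\<forall>y\<in>Y. c y \<in> {0..M}) \<and> (\<forall>y. y \<notin> Y \<longrightarrow> c y = 0)}"
    by (auto simp: PiE_def Pi_def split: if_splits)
  ultimately show ?thesis by (simp add: euclidean_product_topology compactin_euclidean_iff)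
qed

text \<open>The weights \<open>c\<close> minimise the dual functional
  \<open>\<integral>\<^sub>K max\<^sub>y (x \<bullet> y - c y) dx + \<Sum>\<^sub>y m y c y\<close>; raising a single weight by \<open>s > 0\<close> cannot decrease it.\<close>

lemma semidiscrete_transport:
  fixes K Y :: "'a::euclidean_space set" and m :: "'a \<Rightarrow> real"
  assumes K: "compact K" and Y: "finite Y" "Y \<noteq> {}" and m: "\<And>y. y \<in> Y \<Longrightarrow> 0 < m y"
    and total: "sum m Y = measure lborel K"
  obtains c :: "'a \<Rightarrow> real" where
    "\<And>y. y \<in> Y \<Longrightarrow> measure lborel (K \<inter> {x. \<forall>l\<in>Y. x \<bullet> l - c l \<le> x \<bullet> y - c y}) = m y"
proof -
  define V where "V = measure lborel K"
  define g where "g c x = Max ((\<lambda>y. x \<bullet> y - c y) ` Y)" for c :: "'a \<Rightarrow> real" and x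
  have g_ge: "x \<bullet> y - c y \<le> g c x" if "y \<in> Y" for c x y
    unfolding g_def using that Y by (intro Max_ge) auto
  have g_le: "g c x \<le> b" if "\<And>y. y \<in> Y \<Longrightarrow> x \<bullet> y - c y \<le> b" for c x b
    unfolding g_def using that Y by (subst Max_le_iff) auto
  have g_meas [measurable]: "g c \<in> borel_measurable borel" for c
    unfolding g_def by (rule borel_measurable_Max[OF Y(1)]) auto
  have Kb [measurable]: "K \<in> sets borel" using K by (rule borel_compact)
  have Kfin: "emeasure lborel K < top" by (rule emeasure_lborel_bounded[OF compact_imp_bounded[OF K]])
  have int1: "integrable lborel (\<lambda>x. indicator K x * b :: real)" for b
    using Kfin by (intro integrable_mult_left integrable_real_indicator) auto
  obtain r where r: "\<And>x. x \<in> K \<Longrightarrow> norm x \<le> r" "0 < r"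
    using compact_imp_bounded[OF K] by (auto simp: bounded_pos)
  define L where "L = r * (\<Sum>y\<in>Y. norm y)"
  have L0: "0 \<le> L" using r by (simp add: L_def sum_nonneg)
  have xy: "\<bar>x \<bullet> y\<bar> \<le> L" if "x \<in> K" "y \<in> Y" for x y
  proof -
    have "\<bar>x \<bullet> y\<bar> \<le> norm x * norm y" by (rule Cauchy_Schwarz_ineq2)
    also have "\<dots> \<le> r * (\<Sum>y\<in>Y. norm y)"
      using r that Y by (intro mult_mono member_le_sum) auto
    finally show ?thesis by (simp add: L_def)
  qed
  have int_g: "integrable lborel (\<lambda>x. indicator K x * g c x)" for c
  proof (rule Bochner_Integration.integrable_bound[OF int1[of "L + (\<Sum>y\<in>Y. \<bar>c y\<bar>)"]])
    have "\<bar>g c x\<bar> \<le> L + (\<Sum>y\<in>Y. \<bar>c y\<bar>)" if x: "x \<in> K" for x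
    proof -
      have cy: "\<bar>c y\<bar> \<le> (\<Sum>y\<in>Y. \<bar>c y\<bar>)" if "y \<in> Y" for y using that Y by (intro member_le_sum) auto
      obtain y where y: "y \<in> Y" using Y by blast
      have "g c x \<le> L + (\<Sum>y\<in>Y. \<bar>c y\<bar>)"
      proof (rule g_le)
        fix y assume y: "y \<in> Y"
        show "x \<bullet> y - c y \<le> L + (\<Sum>y\<in>Y. \<bar>c y\<bar>)" using xy[OF x y] cy[OF y] by linarith
      qed
      moreover have "- (L + (\<Sum>y\<in>Y. \<bar>c y\<bar>)) \<le> g c x"
        using xy[OF x y] cy[OF y] g_ge[OF y, of x c] by linarith
      ultimately show ?thesis by linarith
    qed
    then show "AE x in lborel. norm (indicator K x * g c x) \<le> norm (indicator K x * (L + (\<Sum>y\<in>Y. \<bar>c y\<bar>)))"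
      by (intro AE_I2) (auto simp: indicator_def intro: order_trans[OF _ abs_ge_self])
  qed measurable
  define J where "J c = (\<integral>x. indicator K x * g c x \<partial>lborel) + (\<Sum>y\<in>Y. m y * c y)" for c
  have g_lip: "g c x \<le> g c' x + (\<Sum>y\<in>Y. \<bar>c' y - c y\<bar>)" for c c' x
  proof (rule g_le)
    fix y assume y: "y \<in> Y"
    have "\<bar>c' y - c y\<bar> \<le> (\<Sum>y\<in>Y. \<bar>c' y - c y\<bar>)" using y Y by (intro member_le_sum) auto
    then show "x \<bullet> y - c y \<le> g c' x + (\<Sum>y\<in>Y. \<bar>c' y - c y\<bar>)" using g_ge[OF y, of x c'] by linarith
  qed
  have intK: "(\<integral>x. indicator K x * b \<partial>lborel) = V * b" for b :: real
    by (simp add: V_def)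
  have J_lip: "J c \<le> J c' + (2 * V) * (\<Sum>y\<in>Y. \<bar>c' y - c y\<bar>)" for c c'
  proof -
    let ?s = "\<Sum>y\<in>Y. \<bar>c' y - c y\<bar>"
    have "(\<integral>x. indicator K x * g c x \<partial>lborel) \<le> (\<integral>x. indicator K x * g c' x + indicator K x * ?s \<partial>lborel)"
      by (intro integral_mono int_g Bochner_Integration.integrable_add int1)
        (use g_lip[of c _ c'] in \<open>auto simp: indicator_def\<close>)
    also have "\<dots> = (\<integral>x. indicator K x * g c' x \<partial>lborel) + V * ?s"
      by (simp only: Bochner_Integration.integral_add[OF int_g int1] intK)
    finally have 1: "(\<integral>x. indicator K x * g c x \<partial>lborel) \<le> (\<integral>x. indicator K x * g c' x \<partial>lborel) + V * ?s" .
    have "(\<Sum>y\<in>Y. m y * c y) \<le> (\<Sum>y\<in>Y. m y * c' y + V * \<bar>c' y - c y\<bar>)"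
    proof (rule sum_mono)
      fix y assume y: "y \<in> Y"
      have "m y \<le> V" unfolding V_def total[symmetric] using y Y m by (intro member_le_sum) (auto intro: less_imp_le)
      then have "m y * \<bar>c' y - c y\<bar> \<le> V * \<bar>c' y - c y\<bar>" by (intro mult_right_mono) auto
      moreover have "m y * (c y - c' y) \<le> m y * \<bar>c' y - c y\<bar>" using m[OF y] by (intro mult_left_mono) auto
      ultimately show "m y * c y \<le> m y * c' y + V * \<bar>c' y - c y\<bar>" by (simp add: right_diff_distrib)
    qed
    also have "\<dots> = (\<Sum>y\<in>Y. m y * c' y) + V * ?s" by (simp add: sum.distrib sum_distrib_left)
    finally show ?thesis using 1 by (simp add: J_def)
  qed
  have J_cont: "continuous_on S J" for S
    unfolding continuous_on_def
  proof
    fix c assume "c \<in> S"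
    show "(J \<longlongrightarrow> J c) (at c within S)"
    proof (rule Lim_null_comparison[THEN LIM_zero_cancel])
      show "\<forall>\<^sub>F c' in at c within S. norm (J c' - J c) \<le> (2 * V) * (\<Sum>y\<in>Y. \<bar>c' y - c y\<bar>)"
      proof (rule always_eventually, rule allI)
        fix c'
        have "(\<Sum>y\<in>Y. \<bar>c y - c' y\<bar>) = (\<Sum>y\<in>Y. \<bar>c' y - c y\<bar>)" by (simp add: abs_minus_commute)
        then show "norm (J c' - J c) \<le> (2 * V) * (\<Sum>y\<in>Y. \<bar>c' y - c y\<bar>)"
          using J_lip[of c c'] J_lip[of c' c] by (simp add: abs_le_iff)
      qed
      have "((\<lambda>c'. c' y) \<longlongrightarrow> c y) (at c within S)" for y
        using continuous_on_product_coordinates[of y] continuous_on_subset[of UNIV _ S] \<open>c \<in> S\<close>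
        by (auto simp: continuous_on_def)
      then have "((\<lambda>c'. (2 * V) * (\<Sum>y\<in>Y. \<bar>c' y - c y\<bar>)) \<longlongrightarrow> (2 * V) * (\<Sum>y\<in>Y. \<bar>c y - c y\<bar>)) (at c within S)"
        by (intro tendsto_intros)
      then show "((\<lambda>c'. (2 * V) * (\<Sum>y\<in>Y. \<bar>c' y - c y\<bar>)) \<longlongrightarrow> 0) (at c within S)" by simp
    qed
  qed
  define mu where "mu = Min (m ` Y)"
  have mu: "0 < mu" "\<And>y. y \<in> Y \<Longrightarrow> mu \<le> m y" using Y m by (auto simp: mu_def)
  \<comment> \<open>If the least weight is 0 and some weight exceeds \<open>M\<close>, the linear
    part of the functional \<open>J\<close> is at least \<open>2 * L * V\<close> and the integral at
    least \<open>- L * V\<close>, so \<open>J\<close> is no smaller than at the zero weights, where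
    it is at most \<open>L * V\<close>. The compact set \<open>P\<close> therefore contains a global
    minimiser.\<close>
  define M where "M = 2 * L * V / mu"
  have M0: "0 \<le> M" using L0 mu by (simp add: M_def V_def)
  define P where "P = {c :: 'a \<Rightarrow> real. (\<forall>y\<in>Y. c y \<in> {0..M}) \<and> (\<forall>y. y \<notin> Y \<longrightarrow> c y = 0)}"
  have "compact P" unfolding P_def by (rule compact_finite_coordinate_box)
  moreover have P0: "(\<lambda>_. 0) \<in> P" using M0 by (simp add: P_def)
  ultimately obtain c where c: "c \<in> P" "\<And>c'. c' \<in> P \<Longrightarrow> J c \<le> J c'"
    using continuous_attains_inf[of P J] J_cont by blast
  have J0: "J (\<lambda>_. 0) \<le> L * V"
  proof -
    have "(\<integral>x. indicator K x * g (\<lambda>_. 0) x \<partial>lborel) \<le> (\<integral>x. indicator K x * L \<partial>lborel)"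
    proof (intro integral_mono int_g int1)
      fix x
      have "g (\<lambda>_. 0) x \<le> L" if "x \<in> K" by (rule g_le) (use xy[OF that] in \<open>auto simp: abs_le_iff\<close>)
      then show "indicator K x * g (\<lambda>_. 0) x \<le> indicator K x * L" by (auto simp: indicator_def)
    qed
    also have "\<dots> = L * V" by (subst intK) (rule mult.commute)
    finally show ?thesis by (simp add: J_def)
  qed
  \<comment> \<open>Adding a constant to all weights leaves \<open>J\<close> unchanged because the
    masses \<open>m\<close> add up to the volume of \<open>K\<close>. This permits the normalisation
    to least weight 0.\<close>
  have Jshift: "J (\<lambda>y. c' y + a) = J c'" for c' a
  proof -
    have "g (\<lambda>y. c' y + a) x = g c' x - a" for x
    proof (rule antisym)
      show "g (\<lambda>y. c' y + a) x \<le> g c' x - a"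
      proof (rule g_le)
        fix y assume "y \<in> Y"
        show "x \<bullet> y - (c' y + a) \<le> g c' x - a" using g_ge[OF \<open>y \<in> Y\<close>, of x c'] by linarith
      qed
      have "g c' x \<le> g (\<lambda>y. c' y + a) x + a"
      proof (rule g_le)
        fix y assume "y \<in> Y"
        show "x \<bullet> y - c' y \<le> g (\<lambda>y. c' y + a) x + a" using g_ge[OF \<open>y \<in> Y\<close>, of x "\<lambda>y. c' y + a"] by linarith
      qed
      then show "g c' x - a \<le> g (\<lambda>y. c' y + a) x" by linarith
    qed
    then have "(\<integral>x. indicator K x * g (\<lambda>y. c' y + a) x \<partial>lborel) = (\<integral>x. indicator K x * g c' x - indicator K x * a \<partial>lborel)"
      by (simp add: right_diff_distrib)
    also have "\<dots> = (\<integral>x. indicator K x * g c' x \<partial>lborel) - V * a"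
      by (simp only: Bochner_Integration.integral_diff[OF int_g int1] intK)
    finally show ?thesis
      unfolding J_def using total by (simp add: distrib_left sum.distrib sum_distrib_right[symmetric] V_def)
  qed
  have min: "J c \<le> J c'" for c'
  proof -
    define a where "a = Min (c' ` Y)"
    have "a \<in> c' ` Y" unfolding a_def using Y by (intro Min_in) auto
    then obtain y0 where y0: "y0 \<in> Y" "c' y0 = a" by (metis imageE)
    have a: "a \<le> c' y" if "y \<in> Y" for y using that Y by (auto simp: a_def)
    define d where "d y = (if y \<in> Y then c' y + (- a) else 0)" for y
    have Jd: "J d = J c'"
    proof -
      have "g d x = g (\<lambda>y. c' y + (- a)) x" for x unfolding g_def by (intro arg_cong[where f=Max] image_cong) (auto simp: d_def)
      moreover have "(\<Sum>y\<in>Y. m y * d y) = (\<Sum>y\<in>Y. m y * (c' y + (- a)))" by (intro sum.cong) (auto simp: d_def)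
      ultimately have "J d = J (\<lambda>y. c' y + (- a))" unfolding J_def by simp
      then show ?thesis by (simp only: Jshift)
    qed
    have d0: "0 \<le> d y" for y using a by (simp add: d_def)
    show ?thesis
    proof (cases "\<forall>y\<in>Y. d y \<le> M")
      case True
      moreover have "d y = 0" if "y \<notin> Y" for y using that by (simp add: d_def)
      ultimately have "d \<in> P" using d0 unfolding P_def by simp
      then show ?thesis using c(2) Jd by metis
    next
      case False
      then obtain y1 where y1: "y1 \<in> Y" "M < d y1" by force
      have "V * (- L) \<le> (\<integral>x. indicator K x * g d x \<partial>lborel)"
        unfolding intK[symmetric]
      proof (intro integral_mono int_g int1)
        fix x
        have "- L \<le> g d x" if "x \<in> K"
          using g_ge[OF y0(1), of x d] xy[OF that y0(1)] y0 by (auto simp: d_def)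
        then show "indicator K x * (- L) \<le> indicator K x * g d x" by (auto simp: indicator_def)
      qed
      moreover have "mu * M \<le> (\<Sum>y\<in>Y. m y * d y)"
      proof -
        have "mu * M \<le> m y1 * d y1" using y1 mu M0 by (intro mult_mono) (auto intro: less_imp_le order_trans)
        also have "\<dots> \<le> (\<Sum>y\<in>Y. m y * d y)" using y1 Y m d0 by (intro member_le_sum) (auto intro: mult_nonneg_nonneg less_imp_le)
        finally show ?thesis .
      qed
      moreover have "mu * M = 2 * (L * V)" using mu by (simp add: M_def)
      moreover have "V * (- L) = - (L * V)" by simp
      ultimately have "L * V \<le> J d" unfolding J_def by linarith
      then show ?thesis using J0 c(2)[OF P0] Jd by linarith
    qed
  qed
  define C where "C y = {x. \<forall>l\<in>Y. x \<bullet> l - c l \<le> x \<bullet> y - c y}" for y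
  \<comment> \<open>Points at which \<open>y\<close> beats every other label by a margin of at least
    \<open>s\<close>. Raising \<open>c y\<close> by \<open>s\<close> lowers the maximum there by
    \<open>s\<close>, so minimality of \<open>J\<close> compares the volume of \<open>W s y\<close>
    in \<open>K\<close> with \<open>m y\<close>.\<close>
  define W where "W s y = {x. \<forall>l\<in>Y - {y}. x \<bullet> l - c l \<le> x \<bullet> y - c y - s}" for s y
  have clC: "closed (C y)" and clW: "closed (W s y)" for s y
    unfolding C_def W_def Ball_def
    by (intro closed_Collect_all closed_Collect_imp closed_Collect_le continuous_intros open_Collect_const)+
  have mW: "measure lborel (K \<inter> W s y) \<le> m y" if y: "y \<in> Y" and s: "0 < s" for s y
  proof -
    define c' where "c' = c(y := c y + s)"
    have le: "g c' x \<le> g c x - s * indicator (W s y) x" for x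
    proof (rule g_le)
      fix l assume l: "l \<in> Y"
      show "x \<bullet> l - c' l \<le> g c x - s * indicator (W s y) x"
      proof (cases "x \<in> W s y \<and> l \<noteq> y")
        case True
        then have "x \<bullet> l - c l \<le> x \<bullet> y - c y - s" using l by (simp add: W_def)
        then show ?thesis using True g_ge[OF y, of x c] by (simp add: c'_def)
      next
        case False
        then show ?thesis using g_ge[OF l, of x c] s by (auto simp: c'_def indicator_def)
      qed
    qed
    have int2: "integrable lborel (\<lambda>x. indicator (K \<inter> W s y) x * s :: real)"
      using Kfin clW K emeasure_mono[of "K \<inter> W s y" K lborel]
      by (intro integrable_mult_left integrable_real_indicator) (auto intro: order.strict_trans1)
    have "(\<integral>x. indicator K x * g c' x \<partial>lborel) \<le> (\<integral>x. indicator K x * g c x - indicator (K \<inter> W s y) x * s \<partial>lborel)"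
      by (intro integral_mono int_g Bochner_Integration.integrable_diff int2)
        (use le in \<open>auto simp: indicator_def mult.commute split: if_splits\<close>)
    also have "\<dots> = (\<integral>x. indicator K x * g c x \<partial>lborel) - measure lborel (K \<inter> W s y) * s"
      by (subst Bochner_Integration.integral_diff[OF int_g int2]) simp
    finally have "(\<integral>x. indicator K x * g c' x \<partial>lborel) \<le> (\<integral>x. indicator K x * g c x \<partial>lborel) - measure lborel (K \<inter> W s y) * s" .
    moreover have "(\<Sum>l\<in>Y. m l * c' l) = (\<Sum>l\<in>Y. m l * c l) + m y * s"
    proof -
      have "(\<Sum>l\<in>Y. m l * c' l) = (\<Sum>l\<in>Y. m l * c l + (if l = y then m y * s else 0))"
        by (intro sum.cong) (auto simp: c'_def distrib_left)
      then show ?thesis using y Y by (simp add: sum.distrib)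
    qed
    ultimately have "measure lborel (K \<inter> W s y) * s \<le> m y * s" using min[of c'] by (simp add: J_def)
    then show ?thesis using s by simp
  qed
  have mC: "measure lborel (K \<inter> C y) \<le> m y" if y: "y \<in> Y" for y
  proof -
    define U where "U k = K \<inter> W (1 / real (Suc k)) y" for k
    have "incseq U"
    proof (rule incseq_SucI)
      fix k
      have "1 / real (Suc (Suc k)) \<le> 1 / real (Suc k)" by (simp add: field_simps)
      then have "x \<bullet> y - c y - 1 / real (Suc k) \<le> x \<bullet> y - c y - 1 / real (Suc (Suc k))" for x by linarith
      then show "U k \<subseteq> U (Suc k)" unfolding U_def W_def by (blast intro: order_trans)
    qed
    moreover have "U k \<in> sets lborel" for k using clW K by (auto simp: U_def intro!: borel_closed closed_Int compact_imp_closed)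
    moreover have "emeasure lborel (\<Union>k. U k) \<noteq> \<infinity>"
      using emeasure_mono[of "\<Union>k. U k" K lborel] Kfin by (auto simp: U_def top_unique)
    ultimately have lim: "(\<lambda>k. measure lborel (U k)) \<longlonglongrightarrow> measure lborel (\<Union>k. U k)"
      by (intro Lim_measure_incseq) auto
    have "measure lborel (\<Union>k. U k) \<le> m y"
      by (rule LIMSEQ_le_const2[OF lim]) (use mW[OF y] in \<open>auto simp: U_def\<close>)
    \<comment> \<open>A point of the cell without positive margin is tied with another label, and
      ties lie in finitely many hyperplanes.\<close>
    moreover have "measure lborel (K \<inter> C y) = measure lborel (\<Union>k. U k)"
    proof (rule measure_eq_AE)
      have "negligible (\<Union>l\<in>Y - {y}. {x. (l - y) \<bullet> x = c l - c y})"
        using Y by (intro negligible_Union finite_imageI) (auto intro!: negligible_hyperplane)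
      moreover have "closed (\<Union>l\<in>Y - {y}. {x. (l - y) \<bullet> x = c l - c y})"
        using Y by (intro closed_UN) (auto intro: closed_hyperplane)
      ultimately have "(\<Union>l\<in>Y - {y}. {x. (l - y) \<bullet> x = c l - c y}) \<in> null_sets lborel"
        by (auto simp: negligible_iff_null_sets null_sets_completion_iff)
      then have "AE x in lborel. x \<notin> (\<Union>l\<in>Y - {y}. {x. (l - y) \<bullet> x = c l - c y})" by (rule AE_not_in)
      then show "AE x in lborel. (x \<in> K \<inter> C y) = (x \<in> (\<Union>k. U k))"
      proof eventually_elim
        case (elim x)
        have "x \<in> (\<Union>k. U k)" if x: "x \<in> K" "x \<in> C y"
        proof -
          define e where "e = Min (insert 1 ((\<lambda>l. x \<bullet> y - c y - (x \<bullet> l - c l)) ` (Y - {y})))"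
          have "0 < x \<bullet> y - c y - (x \<bullet> l - c l)" if "l \<in> Y - {y}" for l
          proof -
            have "x \<bullet> l - c l \<le> x \<bullet> y - c y" using x(2) that by (auto simp: C_def)
            moreover have "(l - y) \<bullet> x \<noteq> c l - c y" using elim that by blast
            moreover have "(l - y) \<bullet> x = x \<bullet> l - x \<bullet> y" by (metis inner_commute inner_diff_left)
            ultimately show ?thesis by linarith
          qed
          then have "0 < e" using Y by (simp add: e_def)
          then obtain k where k: "inverse (real (Suc k)) < e" using reals_Archimedean by blast
          have "e \<le> x \<bullet> y - c y - (x \<bullet> l - c l)" if "l \<in> Y - {y}" for l
            using that Y by (auto simp: e_def intro!: Min_le)
          then have "x \<bullet> l - c l \<le> x \<bullet> y - c y - 1 / real (Suc k)" if "l \<in> Y - {y}" for l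
            using k that unfolding divide_inverse by fastforce
          then have "x \<in> U k" using x by (simp add: U_def W_def)
          then show ?thesis by blast
        qed
        moreover have "x \<in> K \<inter> C y" if x: "x \<in> U k" for k
        proof -
          have "x \<bullet> l - c l \<le> x \<bullet> y - c y" if "l \<in> Y" for l
          proof (cases "l = y")
            case False
            then have "x \<bullet> l - c l \<le> x \<bullet> y - c y - 1 / real (Suc k)" using x that by (auto simp: U_def W_def)
            moreover have "0 < 1 / real (Suc k)" by simp
            ultimately show ?thesis by linarith
          qed simp
          then show ?thesis using x by (auto simp: U_def C_def)
        qed
        ultimately show ?case by blast
      qed
    qed (use clC clW K in \<open>auto simp: U_def intro!: borel_closed closed_Int compact_imp_closed\<close>)
    ultimately show ?thesis by simp
  qed
  have "K \<subseteq> (\<Union>y\<in>Y. K \<inter> C y)"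
  proof
    fix x assume "x \<in> K"
    have "g c x \<in> (\<lambda>y. x \<bullet> y - c y) ` Y" unfolding g_def using Y by (intro Max_in) auto
    then obtain y where "y \<in> Y" "g c x = x \<bullet> y - c y" by (elim imageE)
    then show "x \<in> (\<Union>y\<in>Y. K \<inter> C y)" using \<open>x \<in> K\<close> g_ge[of _ x c] by (auto simp: C_def)
  qed
  then have "V \<le> measure lborel (\<Union>y\<in>Y. K \<inter> C y)"
    unfolding V_def using K clC Y
    by (intro measure_mono_fmeasurable) (auto simp: fmeasurable_def intro!: borel_compact compact_UN compact_Int_closed emeasure_lborel_bounded compact_imp_bounded)
  also have "\<dots> \<le> (\<Sum>y\<in>Y. measure lborel (K \<inter> C y))"
    using K clC Y
    by (intro measure_UNION_le) (auto intro!: borel_compact compact_Int_closed)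
  finally have ge: "sum m Y \<le> (\<Sum>y\<in>Y. measure lborel (K \<inter> C y))" by (simp add: V_def total)
  \<comment> \<open>The cells cover \<open>K\<close>, and their upper bounds \<open>m y\<close> add
    up to its volume, so no bound can be strict.\<close>
  have "measure lborel (K \<inter> C y) = m y" if y: "y \<in> Y" for y
  proof (rule antisym[OF mC[OF y]], rule ccontr)
    assume "\<not> m y \<le> measure lborel (K \<inter> C y)"
    then have "\<exists>y\<in>Y. measure lborel (K \<inter> C y) < m y" using y by (intro bexI[of _ y]) auto
    then have "(\<Sum>y\<in>Y. measure lborel (K \<inter> C y)) < sum m Y"
      using Y mC by (intro sum_strict_mono_ex1) auto
    then show False using ge by simp
  qed
  then show thesis using that[of c] by (simp add: C_def)
qed

section \<open>Displacement along a discretised gradient map, and its limit\<close>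

lemma measure_scaleR_image: "measure lborel ((*\<^sub>R) t ` S) = \<bar>t\<bar> ^ DIM('a) * measure lborel S"
  if "compact (S :: 'a::euclidean_space set)"
proof -
  have "measure lebesgue ((\<lambda>x. t *\<^sub>R x + 0) ` S) = \<bar>t\<bar> ^ DIM('a) * measure lebesgue S"
    by (rule measure_lebesgue_affine)
  moreover have "S \<in> sets lborel" "(*\<^sub>R) t ` S \<in> sets lborel"
    using that compact_scaling[OF that, of t] by (auto intro: borel_compact)
  ultimately show ?thesis by simp
qed

text \<open>A point \<open>x\<close> may be displaced by \<open>t *\<^sub>R z\<close> when
  \<open>x\<close> and \<open>z\<close> lie in cells with the same label \<open>y\<close>. The
  condition on \<open>x\<close> says that \<open>y\<close> is a subgradient at \<open>x\<close> of
  the convex function with slopes in \<open>Z\<close> and weights \<open>c\<close>; the condition on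
  \<open>z\<close> is a discrete form of \<open>z\<close> being the gradient of \<psi> at
  \<open>y\<close>.\<close>

definition displaced :: "'a::euclidean_space set \<Rightarrow> 'a set \<Rightarrow> 'a set \<Rightarrow> 'a set \<Rightarrow> ('a \<Rightarrow> real) \<Rightarrow> ('a \<Rightarrow> real) \<Rightarrow> real \<Rightarrow> 'a set" where
  "displaced K D Z Y c \<psi> t = {x + t *\<^sub>R z | x z. x \<in> K \<and> z \<in> D \<and> (\<exists>y\<in>Z. (\<forall>l\<in>Z. x \<bullet> l - c l \<le> x \<bullet> y - c y) \<and>
     (\<forall>l\<in>Y. z \<bullet> l - \<psi> l \<le> z \<bullet> y - \<psi> y))}"

text \<open>The weights are chosen so that cells of \<open>K\<close> and \<open>D\<close> with the
  same label have volumes in the fixed ratio \<open>q\<close>. Brunn-Minkowski then gives the same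
  factor \<open>(root DIM('a) q + t) ^ DIM('a)\<close> on every pair of cells, and as the Minkowski
  sums of different pairs overlap in null sets only, the estimates add up to the one for
  \<open>K\<close> and \<open>D\<close> themselves.\<close>

lemma discrete_displacement_volume:
  fixes K D Y :: "'a::euclidean_space set" and \<psi> :: "'a \<Rightarrow> real"
  assumes K: "compact K" "0 < measure lborel K" and D: "compact D" "0 < measure lborel D"
    and Y: "finite Y" "Y \<noteq> {}" and t: "0 < t"
  obtains Z c where "Z \<subseteq> Y" "Z \<noteq> {}"
    "compact (displaced K D Z Y c \<psi> t)"
    "(root DIM('a) (measure lborel K) + t * root DIM('a) (measure lborel D)) ^ DIM('a) \<le> measure lborel (displaced K D Z Y c \<psi> t)"
proof -
  let ?m = "measure lborel" and ?r = "root DIM('a)"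
  have n: "0 < DIM('a)" by simp
  define DD where "DD y = D \<inter> {z. \<forall>l\<in>Y. z \<bullet> l - \<psi> l \<le> z \<bullet> y - \<psi> y}" for y
  have cD: "compact (DD y)" for y
  proof -
    have "closed {z. \<forall>l\<in>Y. z \<bullet> l - \<psi> l \<le> z \<bullet> y - \<psi> y}"
      unfolding Ball_def
      by (intro closed_Collect_all closed_Collect_imp closed_Collect_le continuous_intros open_Collect_const)
    then show ?thesis unfolding DD_def by (intro compact_Int_closed D)
  qed
  have neg_hyper: "negligible {z. z \<bullet> (y - l) = b}" if "y \<noteq> l" for y l b
    using negligible_hyperplane[of "y - l" b] that by (simp add: inner_commute)
  have sumD: "?m D = (\<Sum>y\<in>Y. ?m (DD y))"
  proof -
    have "D = (\<Union>y\<in>Y. DD y)"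
    proof
      show "D \<subseteq> (\<Union>y\<in>Y. DD y)"
      proof
        fix z assume z: "z \<in> D"
        have "Max ((\<lambda>y. z \<bullet> y - \<psi> y) ` Y) \<in> (\<lambda>y. z \<bullet> y - \<psi> y) ` Y" using Y by (intro Max_in) auto
        then obtain y where "y \<in> Y" "Max ((\<lambda>y. z \<bullet> y - \<psi> y) ` Y) = z \<bullet> y - \<psi> y" by (elim imageE)
        then have "z \<in> DD y" using z Max_ge[of "(\<lambda>y. z \<bullet> y - \<psi> y) ` Y"] Y by (auto simp: DD_def)
        then show "z \<in> (\<Union>y\<in>Y. DD y)" using \<open>y \<in> Y\<close> by blast
      qed
    qed (auto simp: DD_def)
    moreover have "measure lebesgue (\<Union>y\<in>Y. DD y) = (\<Sum>y\<in>Y. measure lebesgue (DD y))"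
    proof (rule measure_negligible_finite_Union_image[OF Y(1)])
      show "DD y \<in> lmeasurable" for y using cD by (rule lmeasurable_compact)
      show "pairwise (\<lambda>x y. negligible (DD x \<inter> DD y)) Y"
      proof (rule pairwiseI)
        fix y l assume "y \<in> Y" "l \<in> Y" "y \<noteq> l"
        have "DD y \<inter> DD l \<subseteq> {z. z \<bullet> (y - l) = \<psi> y - \<psi> l}"
          using \<open>y \<in> Y\<close> \<open>l \<in> Y\<close> by (force simp: DD_def inner_diff_right)
        then show "negligible (DD y \<inter> DD l)" using neg_hyper[OF \<open>y \<noteq> l\<close>] negligible_subset by blast
      qed
    qed
    moreover have "DD y \<in> sets lborel" for y using cD[of y] by (auto intro: borel_compact)
    moreover have "D \<in> sets lborel" using D by (auto intro: borel_compact)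
    ultimately show ?thesis by simp
  qed
  \<comment> \<open>\<open>semidiscrete_transport\<close> asks for positive masses, so labels whose
    cell in \<open>D\<close> is a null set are dropped.\<close>
  define Z where "Z = {y\<in>Y. 0 < ?m (DD y)}"
  have Z: "finite Z" "Z \<subseteq> Y" using Y by (auto simp: Z_def)
  have sumZ: "?m D = (\<Sum>y\<in>Z. ?m (DD y))"
    unfolding sumD using Y by (intro sum.mono_neutral_right) (auto simp: Z_def order_less_le)
  then have "Z \<noteq> {}" using D(2) by auto
  define q where "q = ?m K / ?m D"
  have q: "0 < q" using K D by (simp add: q_def)
  have "\<exists>c. \<forall>y\<in>Z. ?m (K \<inter> {x. \<forall>l\<in>Z. x \<bullet> l - c l \<le> x \<bullet> y - c y}) = q * ?m (DD y)"
  proof -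
    have "(\<Sum>y\<in>Z. q * ?m (DD y)) = ?m K"
      using D unfolding sum_distrib_left[symmetric] sumZ[symmetric] by (simp add: q_def)
    then show ?thesis
      using semidiscrete_transport[OF K(1) Z(1) \<open>Z \<noteq> {}\<close>, of "\<lambda>y. q * ?m (DD y)"] q by (force simp: Z_def)
  qed
  then obtain c where c: "\<And>y. y \<in> Z \<Longrightarrow> ?m (K \<inter> {x. \<forall>l\<in>Z. x \<bullet> l - c l \<le> x \<bullet> y - c y}) = q * ?m (DD y)"
    by blast
  define CC where "CC y = K \<inter> {x. \<forall>l\<in>Z. x \<bullet> l - c l \<le> x \<bullet> y - c y}" for y
  have cC: "compact (CC y)" for y
  proof -
    have "closed {x. \<forall>l\<in>Z. x \<bullet> l - c l \<le> x \<bullet> y - c y}"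
      unfolding Ball_def
      by (intro closed_Collect_all closed_Collect_imp closed_Collect_le continuous_intros open_Collect_const)
    then show ?thesis unfolding CC_def by (intro compact_Int_closed K)
  qed
  define Q where "Q y = minkowski_sum (CC y) ((*\<^sub>R) t ` DD y)" for y
  have cQ: "compact (Q y)" for y unfolding Q_def by (intro compact_minkowski_sum cC compact_scaling cD)
  have G: "displaced K D Z Y c \<psi> t = (\<Union>y\<in>Z. Q y)"
    unfolding displaced_def Q_def minkowski_sum_def CC_def DD_def by blast
  have "?m (\<Union>y\<in>Z. Q y) = (\<Sum>y\<in>Z. ?m (Q y))"
  proof -
    have "measure lebesgue (\<Union>y\<in>Z. Q y) = (\<Sum>y\<in>Z. measure lebesgue (Q y))"
    proof (rule measure_negligible_finite_Union_image[OF Z(1)])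
      show "Q y \<in> lmeasurable" for y using cQ by (rule lmeasurable_compact)
      show "pairwise (\<lambda>x y. negligible (Q x \<inter> Q y)) Z"
      proof (rule pairwiseI)
        fix y l assume yl: "y \<in> Z" "l \<in> Z" "y \<noteq> l"
        \<comment> \<open>The cells of \<open>y\<close> and those of \<open>l\<close> are separated
          by hyperplanes orthogonal to the same vector \<open>y - l\<close>, in \<open>K\<close> as
          well as in \<open>D\<close>, and with the same orientation; hence so are the sums.\<close>
        have "Q y \<inter> Q l \<subseteq> {u. u \<bullet> (y - l) = (c y - c l) + t * (\<psi> y - \<psi> l)}"
        proof
          fix u assume "u \<in> Q y \<inter> Q l"
          then obtain x z x' z' where u: "u = x + t *\<^sub>R z" "u = x' + t *\<^sub>R z'"
            and x: "x \<in> CC y" "z \<in> DD y" and x': "x' \<in> CC l" "z' \<in> DD l"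
            unfolding Q_def minkowski_sum_def by blast
          have 1: "c y - c l \<le> x \<bullet> (y - l)" "x' \<bullet> (y - l) \<le> c y - c l"
            using x x' yl by (auto simp: CC_def inner_diff_right algebra_simps)
          have "\<psi> y - \<psi> l \<le> z \<bullet> (y - l)" "z' \<bullet> (y - l) \<le> \<psi> y - \<psi> l"
            using x x' yl Z by (auto simp: DD_def inner_diff_right algebra_simps)
          then have 2: "t * (\<psi> y - \<psi> l) \<le> t * (z \<bullet> (y - l))" "t * (z' \<bullet> (y - l)) \<le> t * (\<psi> y - \<psi> l)"
            using t by (auto intro: mult_left_mono)
          have "u \<bullet> (y - l) = x \<bullet> (y - l) + t * (z \<bullet> (y - l))" "u \<bullet> (y - l) = x' \<bullet> (y - l) + t * (z' \<bullet> (y - l))"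
            using u by (metis inner_add_left inner_scaleR_left)+
          then show "u \<in> {u. u \<bullet> (y - l) = (c y - c l) + t * (\<psi> y - \<psi> l)}" using 1 2 by simp
        qed
        then show "negligible (Q y \<inter> Q l)" using neg_hyper[OF yl(3)] negligible_subset by blast
      qed
    qed
    moreover have "Q y \<in> sets lborel" for y using cQ[of y] by (auto intro: borel_compact)
    moreover have "(\<Union>y\<in>Z. Q y) \<in> sets lborel" using Z(1) cQ by (auto intro!: borel_compact compact_UN)
    ultimately show ?thesis by simp
  qed
  also have "(\<Sum>y\<in>Z. ?m (Q y)) \<ge> (\<Sum>y\<in>Z. ?m (DD y) * (?r q + t) ^ DIM('a))"
  proof (rule sum_mono)
    fix y assume y: "y \<in> Z"
    have md: "0 < ?m (DD y)" using y by (simp add: Z_def)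
    have mc: "?m (CC y) = q * ?m (DD y)" using c[OF y] by (simp add: CC_def)
    have ne: "CC y \<noteq> {}" "DD y \<noteq> {}" using md mc q by auto
    have mt: "?m ((*\<^sub>R) t ` DD y) = t ^ DIM('a) * ?m (DD y)" using measure_scaleR_image[OF cD, of t y] t by simp
    have "?r (?m (DD y)) * (?r q + t) = ?r (?m (CC y)) + ?r (?m ((*\<^sub>R) t ` DD y))"
      using t by (simp add: mc mt real_root_mult real_root_power_cancel algebra_simps)
    also have "\<dots> \<le> ?r (?m (Q y))"
      unfolding Q_def using ne by (intro brunn_minkowski cC compact_scaling cD) auto
    finally have "(?r (?m (DD y)) * (?r q + t)) ^ DIM('a) \<le> ?r (?m (Q y)) ^ DIM('a)"
      using q t md by (intro power_mono) (auto intro!: mult_nonneg_nonneg add_nonneg_nonneg real_root_ge_zero)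
    then show "?m (DD y) * (?r q + t) ^ DIM('a) \<le> ?m (Q y)"
      using md n by (simp add: power_mult_distrib real_root_pow_pos2 measure_nonneg)
  qed
  also have "(\<Sum>y\<in>Z. ?m (DD y) * (?r q + t) ^ DIM('a)) = ?m D * (?r q + t) ^ DIM('a)"
    by (simp add: sum_distrib_right sumZ)
  also have "\<dots> = (?r (?m D) * (?r q + t)) ^ DIM('a)"
    using D by (simp add: power_mult_distrib real_root_pow_pos2)
  also have "?r (?m D) * (?r q + t) = ?r (?m K) + t * ?r (?m D)"
    using D K by (simp add: q_def real_root_divide distrib_left)
  finally have "(?r (?m K) + t * ?r (?m D)) ^ DIM('a) \<le> ?m (displaced K D Z Y c \<psi> t)" unfolding G .
  moreover have "compact (displaced K D Z Y c \<psi> t)" unfolding G using Z(1) cQ by (intro compact_UN) auto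
  ultimately show thesis using that[of Z c] Z(2) \<open>Z \<noteq> {}\<close> by blast
qed

text \<open>The limit of \<open>discrete_displacement_volume\<close> for label sets that become
  dense in the ball \<open>N\<close>. The convex functions that define the cells of \<open>K\<close>
  converge uniformly along a subsequence to some \<open>w\<close>, and \<open>\<Gamma>\<close>
  consists of the points of \<open>K\<close> paired with the subgradients of \<open>w\<close> in
  \<open>N\<close>, relative to \<open>K\<close>; subgradients are monotone. The volume survives the
  limit by upper semicontinuity.\<close>

lemma monotone_displacement:
  fixes K :: "'a::euclidean_space set" and \<psi> :: "'a \<Rightarrow> real" and g :: "'a \<Rightarrow> 'a"
  assumes K: "compact K" "0 < measure lborel K" and R: "0 < R'" "R' < R"
    and der: "\<And>y. (\<psi> has_derivative (\<lambda>h. g y \<bullet> h)) (at y)"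
    and coercive: "\<And>y. R * norm y \<le> \<psi> y" and g: "continuous_on UNIV g" and t: "0 < t"
  obtains \<Gamma> :: "('a \<times> 'a) set" where "compact \<Gamma>" "fst ` \<Gamma> \<subseteq> K"
    "\<And>x y x' y'. (x, y) \<in> \<Gamma> \<Longrightarrow> (x', y') \<in> \<Gamma> \<Longrightarrow> 0 \<le> (x - x') \<bullet> (y - y')"
    "(root DIM('a) (measure lborel K) + t * root DIM('a) (measure lborel (cball (0::'a) R'))) ^ DIM('a)
      \<le> measure lborel ((\<lambda>(x, y). x + t *\<^sub>R g y) ` \<Gamma>)"
proof -
  define D where "D = cball (0::'a) R'"
  have D: "compact D" "0 < measure lborel D" using content_cball_pos[OF R(1), of "0::'a"] by (auto simp: D_def)
  define V where "V = (root DIM('a) (measure lborel K) + t * root DIM('a) (measure lborel D)) ^ DIM('a)"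
  have V0: "0 \<le> V" unfolding V_def using t by (intro zero_le_power add_nonneg_nonneg mult_nonneg_nonneg real_root_ge_zero) auto
  have \<psi>0: "0 \<le> \<psi> 0" using coercive[of 0] by simp
  \<comment> \<open>If \<open>z \<bullet> l - \<psi> l\<close> is largest at \<open>l = y\<close>
    for some \<open>z\<close> in \<open>D\<close>, comparison with \<open>l = 0\<close> and
    coercivity give \<open>norm y \<le> L\<close>. The larger radius \<open>L + 1\<close> of
    \<open>N\<close> makes such a maximum interior, so that the derivative vanishes there and
    \<open>z = g y\<close>.\<close>
  define L where "L = \<psi> 0 / (R - R')"
  have L0: "0 \<le> L" using \<psi>0 R by (simp add: L_def)
  define L1 where "L1 = L + 1"
  define N where "N = cball (0::'a) L1"
  have \<psi>_cont: "isCont \<psi> y" for y using has_derivative_continuous[OF der] .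
  have "K \<noteq> {}" using K(2) by auto
  then obtain x0 where x0: "x0 \<in> K" by blast
  define P where "P m Y Z c \<longleftrightarrow> finite Y \<and> Y \<subseteq> N \<and> (\<forall>y\<in>N. \<exists>l\<in>Y. dist y l < 1 / real (Suc m)) \<and> Z \<subseteq> Y \<and> Z \<noteq> {} \<and>
    compact (displaced K D Z Y c \<psi> t) \<and> V \<le> measure lborel (displaced K D Z Y c \<psi> t)" for m Y Z c
  have "\<exists>Y Z c. P m Y Z c" for m
  proof -
    have cN: "compact N" by (simp add: N_def)
    obtain Y where Y: "Y \<subseteq> N" "finite Y" "N \<subseteq> (\<Union>y\<in>Y. ball y (1 / real (Suc m)))"
    proof (rule compactE_image[OF cN, of N "\<lambda>y. ball y (1 / real (Suc m))"])
      show "N \<subseteq> (\<Union>y\<in>N. ball y (1 / real (Suc m)))" by force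
    qed auto
    have "0 \<in> N" using L0 by (simp add: N_def L1_def)
    then have "Y \<noteq> {}" using Y(3) by auto
    obtain Z c where "Z \<subseteq> Y" "Z \<noteq> {}" "compact (displaced K D Z Y c \<psi> t)" "V \<le> measure lborel (displaced K D Z Y c \<psi> t)"
      unfolding V_def by (rule discrete_displacement_volume[OF K D Y(2) \<open>Y \<noteq> {}\<close> t])
    moreover have "\<exists>l\<in>Y. dist y l < 1 / real (Suc m)" if "y \<in> N" for y
      using subsetD[OF Y(3) that] by (auto simp: dist_commute)
    ultimately have "P m Y Z c" using Y(1,2) by (simp add: P_def)
    then show ?thesis by blast
  qed
  then obtain Y Z c where P: "\<And>m. P m (Y m) (Z m) (c m)" by metis
  have finZ: "finite (Z m)" "Z m \<noteq> {}" "Z m \<subseteq> N" "Z m \<subseteq> Y m" for m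
    using P[of m] finite_subset by (auto simp: P_def)
  define F where "F m x = Max ((\<lambda>y. x \<bullet> y - c m y) ` Z m)" for m x
  \<comment> \<open>Subtracting the value at \<open>x0\<close> removes the arbitrary additive
    constant in the weights and gives the uniform bound for Arzela-Ascoli. Equicontinuity comes from
    the bound \<open>L1\<close> on the labels.\<close>
  define f where "f m x = F m x - F m x0" for m x
  have F_ge: "x \<bullet> y - c m y \<le> F m x" if "y \<in> Z m" for m x y
    unfolding F_def using that finZ[of m] by (intro Max_ge) auto
  have F_lip: "F m x \<le> F m x' + L1 * norm (x - x')" for m x x'
  proof -
    have "F m x \<in> (\<lambda>y. x \<bullet> y - c m y) ` Z m" unfolding F_def using finZ[of m] by (intro Max_in) auto
    then obtain y where y: "y \<in> Z m" "F m x = x \<bullet> y - c m y" by (elim imageE)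
    have "norm y \<le> L1" using y finZ(3)[of m] by (auto simp: N_def)
    have "(x - x') \<bullet> y \<le> norm (x - x') * norm y" by (rule norm_cauchy_schwarz)
    also have "\<dots> \<le> norm (x - x') * L1" using \<open>norm y \<le> L1\<close> by (intro mult_left_mono) auto
    finally have "x \<bullet> y \<le> x' \<bullet> y + L1 * norm (x - x')" by (simp add: inner_diff_left mult.commute)
    then show ?thesis using F_ge[OF y(1), of x'] y(2) by linarith
  qed
  have f_lip: "\<bar>f m x - f m x'\<bar> \<le> L1 * norm (x - x')" for m x x'
    using F_lip[of m x x'] F_lip[of m x' x] by (simp add: f_def norm_minus_commute abs_le_iff)
  obtain r where r: "\<And>x. x \<in> K \<Longrightarrow> norm x \<le> r" using compact_imp_bounded[OF K(1)] by (auto simp: bounded_iff)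
  have L1pos: "0 < L1" using L0 by (simp add: L1_def)
  obtain w k where w: "continuous_on K w" and k: "strict_mono (k :: nat \<Rightarrow> nat)"
    and unif: "\<And>e. 0 < e \<Longrightarrow> \<exists>N. \<forall>n x. n \<ge> N \<and> x \<in> K \<longrightarrow> norm (f (k n) x - w x) < e"
  proof (rule Arzela_Ascoli[OF K(1), of f "L1 * (r + r)"])
    show "norm (f n x) \<le> L1 * (r + r)" if "x \<in> K" for n x
    proof -
      have "norm (f n x) = \<bar>f n x - f n x0\<bar>" by (simp add: f_def)
      also have "\<dots> \<le> L1 * norm (x - x0)" by (rule f_lip)
      also have "\<dots> \<le> L1 * (r + r)"
        using L1pos norm_triangle_ineq4[of x x0] r[OF that] r[OF x0] by (intro mult_left_mono) auto
      finally show ?thesis .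
    qed
    show "\<exists>d>0. \<forall>n y. y \<in> K \<and> norm (x - y) < d \<longrightarrow> norm (f n x - f n y) < e" if "x \<in> K" "0 < e" for x e
    proof (intro exI[of _ "e / L1"] conjI allI impI)
      show "0 < e / L1" using that L1pos by simp
      fix n y assume "y \<in> K \<and> norm (x - y) < e / L1"
      then have "L1 * norm (x - y) < e" using L1pos by (simp add: field_simps)
      then show "norm (f n x - f n y) < e" using f_lip[of n x y] by simp
    qed
  qed blast
  have f_lim: "(\<lambda>n. f (k n) x) \<longlonglongrightarrow> w x" if "x \<in> K" for x
    unfolding LIMSEQ_iff using unif that by blast
  define \<Gamma> where "\<Gamma> = {(x, y). x \<in> K \<and> y \<in> N \<and> (\<forall>x'\<in>K. w x + y \<bullet> (x' - x) \<le> w x')}"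
  have "closed \<Gamma>"
  proof -
    have cKN: "closed (K \<times> N)" using K by (intro closed_Times compact_imp_closed) (auto simp: N_def)
    have "closed ((K \<times> N) \<inter> (\<lambda>p. w (fst p) + snd p \<bullet> (x' - fst p) - w x') -` {..0})" for x'
      by (intro continuous_closed_preimage cKN continuous_intros continuous_on_compose2[OF w]) auto
    then have "closed (\<Inter>x'\<in>K. (K \<times> N) \<inter> (\<lambda>p. w (fst p) + snd p \<bullet> (x' - fst p) - w x') -` {..0})"
      by (intro closed_INT) auto
    moreover have "\<Gamma> = (\<Inter>x'\<in>K. (K \<times> N) \<inter> (\<lambda>p. w (fst p) + snd p \<bullet> (x' - fst p) - w x') -` {..0})"
      using x0 by (auto simp: \<Gamma>_def)
    ultimately show ?thesis by simp
  qed
  moreover have "compact (K \<times> N)" using K by (intro compact_Times) (auto simp: N_def)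
  moreover have "\<Gamma> \<subseteq> K \<times> N" by (auto simp: \<Gamma>_def)
  ultimately have c\<Gamma>: "compact \<Gamma>" by (metis compact_Int_closed inf.absorb_iff2)
  define G where "G = (\<lambda>(x, y). x + t *\<^sub>R g y) ` \<Gamma>"
  have cG: "compact G"
    unfolding G_def case_prod_beta
    by (intro compact_continuous_image c\<Gamma> continuous_intros continuous_on_compose2[OF g]) auto
  have "ennreal V \<le> emeasure lborel G"
  proof (rule emeasure_compact_upper_semicontinuous[OF _ cG])
    fix e :: real assume e: "0 < e"
    let ?T = "\<lambda>m. displaced K D (Z (k m)) (Y (k m)) (c (k m)) \<psi> t"
    \<comment> \<open>Otherwise some points of the displaced sets stay away from \<open>G\<close>. A
      limit \<open>(x, z, y)\<close> of the points, displacements and labels involved satisfies both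
      maximality conditions, so \<open>z = g y\<close> and \<open>(x, y)\<close> belongs to
      \<open>\<Gamma>\<close>, and the limit of the displaced points lies in \<open>G\<close> after
      all.\<close>
    have "\<exists>m. \<forall>u\<in>?T m. \<exists>p\<in>G. dist u p \<le> e"
    proof (rule ccontr)
      assume "\<not> ?thesis"
      then have "\<forall>m. \<exists>u\<in>?T m. \<forall>p\<in>G. e < dist u p" by (simp add: not_le)
      then have "\<forall>m. \<exists>x z y. (\<forall>p\<in>G. e < dist (x + t *\<^sub>R z) p) \<and> x \<in> K \<and> z \<in> D \<and> y \<in> Z (k m) \<and>
          (\<forall>l\<in>Z (k m). x \<bullet> l - c (k m) l \<le> x \<bullet> y - c (k m) y) \<and>
          (\<forall>l\<in>Y (k m). z \<bullet> l - \<psi> l \<le> z \<bullet> y - \<psi> y)"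
        unfolding displaced_def by blast
      then obtain xs zs ys where far: "\<And>m p. p \<in> G \<Longrightarrow> e < dist (xs m + t *\<^sub>R zs m) p"
        and xs: "\<And>m. xs m \<in> K" and zs: "\<And>m. zs m \<in> D" and ys: "\<And>m. ys m \<in> Z (k m)"
        and max1: "\<And>m l. l \<in> Z (k m) \<Longrightarrow> xs m \<bullet> l - c (k m) l \<le> xs m \<bullet> ys m - c (k m) (ys m)"
        and max2: "\<And>m l. l \<in> Y (k m) \<Longrightarrow> zs m \<bullet> l - \<psi> l \<le> zs m \<bullet> ys m - \<psi> (ys m)"
        by metis
      have "compact (K \<times> D \<times> N)" using K D by (intro compact_Times) (auto simp: N_def)
      moreover have "\<forall>m. (xs m, zs m, ys m) \<in> K \<times> D \<times> N" using xs zs ys finZ(3) by blast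
      ultimately have "\<exists>q\<in>K \<times> D \<times> N. \<exists>s::nat \<Rightarrow> nat. strict_mono s \<and> ((\<lambda>m. (xs m, zs m, ys m)) \<circ> s) \<longlonglongrightarrow> q"
        unfolding compact_def by (elim allE[of _ "\<lambda>m. (xs m, zs m, ys m)"]) simp
      then obtain q s where q: "q \<in> K \<times> D \<times> N" and s: "strict_mono (s :: nat \<Rightarrow> nat)"
        and lim: "((\<lambda>m. (xs m, zs m, ys m)) \<circ> s) \<longlonglongrightarrow> q"
        by blast
      obtain x z y where q_eq: "q = (x, z, y)" by (cases q) auto
      have xzy: "x \<in> K" "z \<in> D" "y \<in> N" using q q_eq by auto
      have lx: "(\<lambda>m. xs (s m)) \<longlonglongrightarrow> x" and lz: "(\<lambda>m. zs (s m)) \<longlonglongrightarrow> z" and ly: "(\<lambda>m. ys (s m)) \<longlonglongrightarrow> y"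
        using tendsto_fst[OF lim] tendsto_fst[OF tendsto_snd[OF lim]] tendsto_snd[OF tendsto_snd[OF lim]]
        by (simp_all add: q_eq o_def)
      have wle: "w x + y \<bullet> (x' - x) \<le> w x'" if x': "x' \<in> K" for x'
      proof (rule LIMSEQ_le)
        let ?i = "\<lambda>m. k (s m)"
        have l1: "(\<lambda>m. f (?i m) p) \<longlonglongrightarrow> w p" if "p \<in> K" for p
          using LIMSEQ_subseq_LIMSEQ[OF f_lim[OF that] s] by (simp add: o_def)
        have "(\<lambda>m. f (?i m) (xs (s m)) - f (?i m) x) \<longlonglongrightarrow> 0"
        proof (rule Lim_null_comparison[OF always_eventually])
          show "\<forall>m. norm (f (?i m) (xs (s m)) - f (?i m) x) \<le> L1 * norm (xs (s m) - x)" using f_lip by simp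
          have "(\<lambda>m. L1 * norm (xs (s m) - x)) \<longlonglongrightarrow> L1 * norm (x - x)" by (intro tendsto_intros lx)
          then show "(\<lambda>m. L1 * norm (xs (s m) - x)) \<longlonglongrightarrow> 0" by simp
        qed
        from tendsto_add[OF this l1[OF xzy(1)]] have l2: "(\<lambda>m. f (?i m) (xs (s m))) \<longlonglongrightarrow> w x" by simp
        show "(\<lambda>m. f (?i m) (xs (s m)) + ys (s m) \<bullet> (x' - xs (s m))) \<longlonglongrightarrow> w x + y \<bullet> (x' - x)"
          by (intro tendsto_intros l2 lx ly)
        show "(\<lambda>m. f (?i m) x') \<longlonglongrightarrow> w x'" by (rule l1[OF x'])
        have "f (?i m) (xs (s m)) + ys (s m) \<bullet> (x' - xs (s m)) \<le> f (?i m) x'" for m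
        proof -
          have "F (?i m) (xs (s m)) \<le> xs (s m) \<bullet> ys (s m) - c (?i m) (ys (s m))"
            unfolding F_def using finZ[of "?i m"] max1[of _ "s m"] by (subst Max_le_iff) auto
          then show ?thesis using F_ge[OF ys[of "s m"], of x'] by (simp add: f_def inner_diff_right inner_commute)
        qed
        then show "\<exists>M. \<forall>m\<ge>M. f (?i m) (xs (s m)) + ys (s m) \<bullet> (x' - xs (s m)) \<le> f (?i m) x'" by blast
      qed
      have zmax: "z \<bullet> l - \<psi> l \<le> z \<bullet> y - \<psi> y" if l: "l \<in> N" for l
      proof -
        have "\<exists>l'. l' \<in> Y (k (s m)) \<and> dist l l' < 1 / real (Suc (k (s m)))" for m
          using P[of "k (s m)"] l unfolding P_def by blast
        then obtain ls where ls: "\<And>m. ls m \<in> Y (k (s m))" "\<And>m. dist l (ls m) < 1 / real (Suc (k (s m)))" by metis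
        have ll: "ls \<longlonglongrightarrow> l"
        proof (rule LIM_zero_cancel[OF Lim_null_comparison[OF always_eventually]])
          show "\<forall>m. norm (ls m - l) \<le> inverse (real (Suc m))"
          proof
            fix m
            have "m \<le> k (s m)" using seq_suble[OF k, of "s m"] seq_suble[OF s, of m] by linarith
            then have "1 / real (Suc (k (s m))) \<le> inverse (real (Suc m))" by (simp add: field_simps)
            then show "norm (ls m - l) \<le> inverse (real (Suc m))"
              using ls(2)[of m] by (simp add: dist_norm norm_minus_commute)
          qed
        qed (rule LIMSEQ_inverse_real_of_nat)
        show ?thesis
        proof (rule LIMSEQ_le)
          show "(\<lambda>m. zs (s m) \<bullet> ls m - \<psi> (ls m)) \<longlonglongrightarrow> z \<bullet> l - \<psi> l"
            by (intro tendsto_intros lz ll isCont_tendsto_compose[OF \<psi>_cont])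
          show "(\<lambda>m. zs (s m) \<bullet> ys (s m) - \<psi> (ys (s m))) \<longlonglongrightarrow> z \<bullet> y - \<psi> y"
            by (intro tendsto_intros lz ly isCont_tendsto_compose[OF \<psi>_cont])
          show "\<exists>M. \<forall>m\<ge>M. zs (s m) \<bullet> ls m - \<psi> (ls m) \<le> zs (s m) \<bullet> ys (s m) - \<psi> (ys (s m))"
            using max2 ls(1) by blast
        qed
      qed
      have "norm y \<le> L"
      proof -
        have "0 \<in> N" using L1pos by (simp add: N_def)
        from zmax[OF this] have "\<psi> y \<le> z \<bullet> y + \<psi> 0" by simp
        moreover have "z \<bullet> y \<le> R' * norm y"
          using norm_cauchy_schwarz[of z y] xzy(2) mult_right_mono[of "norm z" R' "norm y"] by (simp add: D_def)
        ultimately have "(R - R') * norm y \<le> \<psi> 0" using coercive[of y] by (simp add: left_diff_distrib)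
        then show ?thesis using R by (simp add: L_def field_simps)
      qed
      then have yball: "y \<in> ball 0 L1" by (simp add: L1_def)
      have "(\<lambda>h. z \<bullet> h - g y \<bullet> h) = (\<lambda>h. 0)"
      proof (rule differential_zero_maxmin[OF yball open_ball])
        show "((\<lambda>l. z \<bullet> l - \<psi> l) has_derivative (\<lambda>h. z \<bullet> h - g y \<bullet> h)) (at y)"
          by (intro derivative_intros der)
        show "(\<forall>l\<in>ball 0 L1. z \<bullet> l - \<psi> l \<le> z \<bullet> y - \<psi> y) \<or> (\<forall>l\<in>ball 0 L1. z \<bullet> y - \<psi> y \<le> z \<bullet> l - \<psi> l)"
          using zmax by (auto simp: N_def)
      qed
      then have "(z - g y) \<bullet> (z - g y) = 0" by (metis inner_diff_left)
      then have "z = g y" by simp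
      then have "x + t *\<^sub>R z \<in> G" using xzy wle unfolding G_def \<Gamma>_def by force
      then have *: "e < dist (xs (s m) + t *\<^sub>R zs (s m)) (x + t *\<^sub>R z)" for m using far by blast
      have "(\<lambda>m. dist (xs (s m) + t *\<^sub>R zs (s m)) (x + t *\<^sub>R z)) \<longlonglongrightarrow> dist (x + t *\<^sub>R z) (x + t *\<^sub>R z)"
        by (intro tendsto_intros lx lz)
      then have "e \<le> dist (x + t *\<^sub>R z) (x + t *\<^sub>R z)"
        by (rule LIMSEQ_le_const) (use * in \<open>auto intro: less_imp_le\<close>)
      then show False using e by simp
    qed
    then obtain m where m: "\<forall>u\<in>?T m. \<exists>p\<in>G. dist u p \<le> e" by blast
    have T: "compact (?T m)" "V \<le> measure lborel (?T m)" using P[of "k m"] by (auto simp: P_def)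
    show "\<exists>T\<in>sets borel. ennreal V \<le> emeasure lborel T \<and> (\<forall>x\<in>T. \<exists>y\<in>G. dist x y \<le> e)"
      using m T emeasure_lborel_eq_measure[OF compact_imp_bounded[OF T(1)]]
      by (intro bexI[of _ "?T m"] conjI) (auto intro: borel_compact ennreal_leI)
  qed (auto intro: emeasure_lborel_bounded)
  then have VG: "V \<le> measure lborel G"
    by (simp add: emeasure_lborel_eq_measure[OF compact_imp_bounded[OF cG]])
  show thesis
  proof (rule that[OF c\<Gamma>])
    show "fst ` \<Gamma> \<subseteq> K" by (auto simp: \<Gamma>_def)
    show "0 \<le> (x - x') \<bullet> (y - y')" if "(x, y) \<in> \<Gamma>" "(x', y') \<in> \<Gamma>" for x y x' y'
    proof -
      have "w x + y \<bullet> (x' - x) \<le> w x'" "w x' + y' \<bullet> (x - x') \<le> w x" using that by (auto simp: \<Gamma>_def)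
      then show ?thesis by (simp add: inner_diff_left inner_diff_right inner_commute)
    qed
    show "(root DIM('a) (measure lborel K) + t * root DIM('a) (measure lborel (cball (0::'a) R'))) ^ DIM('a)
      \<le> measure lborel ((\<lambda>(x, y). x + t *\<^sub>R g y) ` \<Gamma>)"
      using VG by (simp add: V_def D_def G_def)
  qed
qed

section \<open>Shadows under displacement\<close>

text \<open>On a grid of width \<open>d\<close>, the shifts of points from cell \<open>i\<close>
  fill a range from \<open>lo i\<close> to \<open>hi i\<close>, and the image of that cell is
  contained in an interval of length \<open>d + (hi i - lo i)\<close>. Monotonicity makes these
  ranges non-overlapping parts of \<open>[-c, c]\<close>, so the extra lengths add up to at most
  \<open>2 * c\<close> no matter how many cells meet \<open>S\<close>. Several shifts of the same
  point are allowed, because the relation comes from subgradients.\<close>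

lemma emeasure_monotone_shift:
  fixes S :: "real set" and \<Gamma> :: "(real \<times> real) set"
  assumes S: "compact S" and sub: "\<And>s b. (s, b) \<in> \<Gamma> \<Longrightarrow> s \<in> S \<and> \<bar>b\<bar> \<le> c"
    and mono: "\<And>s b s' b'. (s, b) \<in> \<Gamma> \<Longrightarrow> (s', b') \<in> \<Gamma> \<Longrightarrow> s < s' \<Longrightarrow> b \<le> b'"
  shows "emeasure lborel ((\<lambda>(s, b). s + b) ` \<Gamma>) \<le> emeasure lborel S + ennreal (2 * c)"
proof (cases "\<Gamma> = {}")
  case False
  then obtain s0 b0 where "(s0, b0) \<in> \<Gamma>" by auto
  then have c0: "0 \<le> c" using sub abs_ge_zero order_trans by blast
  define U where "U = (\<lambda>(s, b). s + b) ` \<Gamma>"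
  \<comment> \<open>In this form the estimate can be proved up to the grid width \<open>d\<close>:
    the union \<open>T\<close> of the occupied cells stays within \<open>d\<close> of
    \<open>S\<close>, and \<open>emeasure_compact_upper_semicontinuous\<close> removes the
    error.\<close>
  have "emeasure lborel U - ennreal (2 * c) \<le> emeasure lborel S"
  proof (rule emeasure_compact_upper_semicontinuous[OF _ S])
    fix d :: real assume d: "0 < d"
    define fl where "fl s = \<lfloor>s / d\<rfloor>" for s
    define I where "I = fl ` fst ` \<Gamma>"
    have fl: "of_int (fl s) * d \<le> s" "s < of_int (fl s) * d + d" for s
    proof -
      have "of_int (fl s) \<le> s / d" "s / d < of_int (fl s) + 1" unfolding fl_def by linarith+
      then show "of_int (fl s) * d \<le> s" "s < of_int (fl s) * d + d"
        using d by (simp_all add: field_simps)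
    qed
    have "finite I"
    proof -
      obtain r where r: "\<And>s. s \<in> S \<Longrightarrow> \<bar>s\<bar> \<le> r" using compact_imp_bounded[OF S] by (auto simp: bounded_iff)
      have "I \<subseteq> {\<lfloor>- r / d\<rfloor>..\<lfloor>r / d\<rfloor>}"
      proof
        fix i assume "i \<in> I"
        then obtain s b where s: "(s, b) \<in> \<Gamma>" "i = fl s" by (auto simp: I_def)
        then have "- r \<le> s" "s \<le> r" using sub r[of s] by (auto simp: abs_le_iff)
        then have "- r / d \<le> s / d" "s / d \<le> r / d" using d by (intro divide_right_mono; simp)+
        then show "i \<in> {\<lfloor>- r / d\<rfloor>..\<lfloor>r / d\<rfloor>}"
          unfolding s fl_def by (simp only: atLeastAtMost_iff floor_mono)
      qed
      then show ?thesis by (rule finite_subset) simp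
    qed
    define B where "B i = {b. \<exists>s. (s, b) \<in> \<Gamma> \<and> fl s = i}" for i
    have Bne: "B i \<noteq> {}" if "i \<in> I" for i
    proof -
      obtain s b where "(s, b) \<in> \<Gamma>" "fl s = i" using \<open>i \<in> I\<close> by (auto simp: I_def)
      then have "b \<in> B i" unfolding B_def by blast
      then show ?thesis by blast
    qed
    have Bc: "\<bar>b\<bar> \<le> c" if "b \<in> B i" for i b using that sub by (auto simp: B_def)
    have bdd: "bdd_below (B i)" "bdd_above (B i)" for i
      using Bc unfolding bdd_below_def bdd_above_def by (meson abs_le_D1 abs_le_D2 minus_le_iff)+
    define lo hi where "lo i = Inf (B i)" and "hi i = Sup (B i)" for i
    have lohi: "lo i \<le> b \<and> b \<le> hi i" if "b \<in> B i" for i b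
      unfolding lo_def hi_def using that bdd by (auto intro: cInf_lower cSup_upper)
    have le: "lo i \<le> hi i" if "i \<in> I" for i
    proof -
      obtain b where "b \<in> B i" using Bne[OF \<open>i \<in> I\<close>] by blast
      then show ?thesis using lohi by fastforce
    qed
    have ord: "hi i \<le> lo j" if "i \<in> I" "j \<in> I" "i < j" for i j
    proof -
      have "b \<le> b'" if b: "b \<in> B i" "b' \<in> B j" for b b'
      proof -
        obtain s s' where s: "(s, b) \<in> \<Gamma>" "fl s = i" "(s', b') \<in> \<Gamma>" "fl s' = j" using b by (auto simp: B_def)
        have "s < s'"
        proof (rule ccontr)
          assume "\<not> s < s'"
          then have "fl s' \<le> fl s" unfolding fl_def using d by (intro floor_mono divide_right_mono) auto
          then show False using s \<open>i < j\<close> by simp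
        qed
        then show ?thesis using mono s by blast
      qed
      then show ?thesis unfolding lo_def hi_def using Bne that by (intro cSup_least cInf_greatest) auto
    qed
    have range: "- c \<le> lo i" "hi i \<le> c" if "i \<in> I" for i
      unfolding lo_def hi_def using Bne[OF that] Bc by (auto intro!: cInf_greatest cSup_least simp: abs_le_iff minus_le_iff)
    have sum_hl: "(\<Sum>i\<in>I. ennreal (hi i - lo i)) \<le> ennreal (2 * c)"
    proof -
      have "(\<Sum>i\<in>I. ennreal (hi i - lo i)) = (\<Sum>i\<in>I. emeasure lborel {lo i<..<hi i})"
        using le by (intro sum.cong) auto
      also have "\<dots> = emeasure lborel (\<Union>i\<in>I. {lo i<..<hi i})"
      proof (rule sum_emeasure)
        show "disjoint_family_on (\<lambda>i. {lo i<..<hi i}) I"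
          unfolding disjoint_family_on_def
        proof (intro ballI impI)
          fix i j assume ij: "i \<in> I" "j \<in> I" "i \<noteq> j"
          then consider "hi i \<le> lo j" | "hi j \<le> lo i" using ord[of i j] ord[of j i] by linarith
          then show "{lo i<..<hi i} \<inter> {lo j<..<hi j} = {}" by cases auto
        qed
      qed (use \<open>finite I\<close> in auto)
      also have "\<dots> \<le> emeasure lborel {- c..c}"
        using range by (intro emeasure_mono) force+
      finally show ?thesis using c0 by simp
    qed
    define T where "T = (\<Union>i\<in>I. {of_int i * d..<of_int i * d + d})"
    have T: "(\<Sum>i\<in>I. ennreal d) = emeasure lborel T"
    proof -
      have "(\<Sum>i\<in>I. ennreal d) = (\<Sum>i\<in>I. emeasure lborel {of_int i * d..<of_int i * d + d})"
        using d by simp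
      also have "\<dots> = emeasure lborel T"
        unfolding T_def
      proof (rule sum_emeasure)
        show "disjoint_family_on (\<lambda>i. {of_int i * d..<of_int i * d + d}) I"
          unfolding disjoint_family_on_def
        proof (intro ballI impI)
          fix i j :: int assume "i \<noteq> j"
          have lt: "of_int i * d + d \<le> of_int j * d" if "i < j" for i j :: int
          proof -
            have "(of_int i + 1) * d \<le> of_int j * d" using that d by (intro mult_right_mono) auto
            then show ?thesis by (simp add: distrib_right)
          qed
          consider "i < j" | "j < i" using \<open>i \<noteq> j\<close> by linarith
          then show "{of_int i * d..<of_int i * d + d} \<inter> {of_int j * d..<of_int j * d + d} = {}"
            using lt[of i j] lt[of j i] by cases auto
        qed
      qed (use \<open>finite I\<close> in auto)
      finally show ?thesis .
    qed
    have "U \<subseteq> (\<Union>i\<in>I. {of_int i * d + lo i..of_int i * d + d + hi i})"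
    proof
      fix u assume "u \<in> U"
      then obtain s b where s: "(s, b) \<in> \<Gamma>" "u = s + b" by (auto simp: U_def)
      have "b \<in> B (fl s)" using s(1) unfolding B_def by blast
      have "fl s \<in> I" unfolding I_def using imageI[OF imageI[OF s(1), of fst], of fl] by simp
      then show "u \<in> (\<Union>i\<in>I. {of_int i * d + lo i..of_int i * d + d + hi i})"
        using lohi[OF \<open>b \<in> B (fl s)\<close>] fl[of s] s(2) \<open>fl s \<in> I\<close> by (intro UN_I[of "fl s"]) auto
    qed
    then have "emeasure lborel U \<le> emeasure lborel (\<Union>i\<in>I. {of_int i * d + lo i..of_int i * d + d + hi i})"
      using \<open>finite I\<close> by (intro emeasure_mono) auto
    also have "\<dots> \<le> (\<Sum>i\<in>I. emeasure lborel {of_int i * d + lo i..of_int i * d + d + hi i})"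
      using \<open>finite I\<close> by (intro emeasure_subadditive_finite) auto
    also have "\<dots> = (\<Sum>i\<in>I. ennreal d + ennreal (hi i - lo i))"
    proof (rule sum.cong[OF refl])
      fix i assume "i \<in> I"
      then have "of_int i * d + lo i \<le> of_int i * d + d + hi i" using le[of i] d by linarith
      then have "emeasure lborel {of_int i * d + lo i..of_int i * d + d + hi i} = ennreal (d + (hi i - lo i))"
        by (simp add: add_diff_eq)
      then show "emeasure lborel {of_int i * d + lo i..of_int i * d + d + hi i} = ennreal d + ennreal (hi i - lo i)"
        using le[OF \<open>i \<in> I\<close>] d by simp
    qed
    also have "\<dots> \<le> emeasure lborel T + ennreal (2 * c)"
      unfolding sum.distrib T using sum_hl by (rule add_left_mono)
    finally have "emeasure lborel U - ennreal (2 * c) \<le> emeasure lborel T"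
      by (simp add: ennreal_minus_le_iff add.commute)
    moreover have "\<forall>x\<in>T. \<exists>y\<in>S. dist x y \<le> d"
    proof
      fix x assume "x \<in> T"
      then obtain s b where s: "(s, b) \<in> \<Gamma>" "of_int (fl s) * d \<le> x" "x < of_int (fl s) * d + d"
        by (auto simp: T_def I_def)
      then have "dist x s \<le> d" using fl[of s] by (simp add: dist_real_def)
      then show "\<exists>y\<in>S. dist x y \<le> d" using s sub by blast
    qed
    moreover have "T \<in> sets borel" unfolding T_def using \<open>finite I\<close> by auto
    ultimately show "\<exists>T\<in>sets borel. emeasure lborel U - ennreal (2 * c) \<le> emeasure lborel T \<and> (\<forall>x\<in>T. \<exists>y\<in>S. dist x y \<le> d)"
      by blast
  qed (auto intro: emeasure_lborel_bounded)
  then show ?thesis by (simp add: ennreal_minus_le_iff add.commute U_def)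
qed simp

section \<open>Shadows of compact sets, and displacement in finitely many directions\<close>

definition hyperplane_proj :: "'a::real_inner \<Rightarrow> 'a \<Rightarrow> 'a" where
  "hyperplane_proj v x = x - (v \<bullet> x) *\<^sub>R v"

definition shadow :: "real ^ 'n \<Rightarrow> (real ^ 'n) set \<Rightarrow> ennreal" where
  "shadow v X = emeasure (hyperplane_measure v) (hyperplane_proj v ` X)"

lemma continuous_on_hyperplane_proj: "continuous_on S (hyperplane_proj v)"
  unfolding hyperplane_proj_def by (intro continuous_intros)

lemma compact_hyperplane_proj: "compact X \<Longrightarrow> compact (hyperplane_proj v ` X)"
  by (intro compact_continuous_image continuous_on_hyperplane_proj)

lemma inner_hyperplane_proj: "norm v = 1 \<Longrightarrow> v \<bullet> hyperplane_proj v x = 0"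
  by (simp add: hyperplane_proj_def inner_diff_right dot_square_norm)

lemma hyperplane_proj_shift: "norm v = 1 \<Longrightarrow> v \<bullet> s = 0 \<Longrightarrow> hyperplane_proj v (s + t *\<^sub>R v) = s"
  by (simp add: hyperplane_proj_def inner_add_right dot_square_norm)

lemma hyperplane_proj_lipschitz:
  assumes "norm v = 1"
  shows "dist (hyperplane_proj v x) (hyperplane_proj v y) \<le> dist x y"
proof -
  let ?d = "x - y"
  have e: "hyperplane_proj v x - hyperplane_proj v y = ?d - (v \<bullet> ?d) *\<^sub>R v"
    by (simp add: hyperplane_proj_def inner_diff_right algebra_simps)
  have "(norm (?d - (v \<bullet> ?d) *\<^sub>R v))\<^sup>2 = (norm ?d)\<^sup>2 - (v \<bullet> ?d)\<^sup>2"
    unfolding power2_norm_eq_inner inner_diff_left[of ?d "(v \<bullet> ?d) *\<^sub>R v"] inner_diff_right[of _ ?d "(v \<bullet> ?d) *\<^sub>R v"]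
    using assms by (simp add: dot_square_norm power2_eq_square inner_commute[of ?d v])
  also have "\<dots> \<le> (norm ?d)\<^sup>2" by simp
  finally have "norm (?d - (v \<bullet> ?d) *\<^sub>R v) \<le> norm ?d" by (rule power2_le_imp_le) simp
  then show ?thesis unfolding dist_norm e .
qed

lemma shadow_mono:
  assumes "compact Y" "X \<subseteq> Y"
  shows "shadow v X \<le> shadow v Y"
  unfolding shadow_def using compact_hyperplane_proj[OF assms(1)] assms(2)
  by (intro emeasure_mono) (auto intro: borel_compact)

lemma compact_slice:
  assumes X: "compact X" and v: "norm v = 1"
  shows "compact {t. s + t *\<^sub>R v \<in> X}"
proof -
  have "closed ((\<lambda>t. s + t *\<^sub>R v) -` X)"
    using compact_imp_closed[OF X] by (intro closed_vimage continuous_intros)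
  moreover have "bounded {t. s + t *\<^sub>R v \<in> X}"
  proof -
    obtain r where r: "\<And>x. x \<in> X \<Longrightarrow> norm x \<le> r" using compact_imp_bounded[OF X] by (auto simp: bounded_iff)
    have "\<bar>t\<bar> \<le> r + norm s" if "s + t *\<^sub>R v \<in> X" for t
      using r[OF that] norm_triangle_ineq4[of "s + t *\<^sub>R v" s] v by simp
    then show ?thesis by (auto simp: bounded_iff)
  qed
  ultimately show ?thesis by (simp add: compact_eq_bounded_closed vimage_def)
qed

text \<open>Integrates \<open>emeasure_monotone_shift\<close> over the lines parallel to
  \<open>v\<close>. The gain \<open>2 * c\<close> occurs only on lines that meet the set, that is,
  over its projection, which produces the shadow.\<close>

lemma emeasure_monotone_shift_along:
  fixes v :: "real ^ 'n" and \<Gamma> :: "((real ^ 'n) \<times> real) set"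
  assumes v: "norm v = 1" and \<Gamma>: "compact \<Gamma>" and b: "\<And>x b. (x, b) \<in> \<Gamma> \<Longrightarrow> \<bar>b\<bar> \<le> c"
    and mono: "\<And>x b s b'. (x, b) \<in> \<Gamma> \<Longrightarrow> (x + s *\<^sub>R v, b') \<in> \<Gamma> \<Longrightarrow> 0 < s \<Longrightarrow> b \<le> b'"
  shows "emeasure lborel ((\<lambda>(x, b). x + b *\<^sub>R v) ` \<Gamma>) \<le> emeasure lborel (fst ` \<Gamma>) + ennreal (2 * c) * shadow v (fst ` \<Gamma>)"
proof -
  define X where "X = fst ` \<Gamma>"
  define X' where "X' = (\<lambda>(x, b). x + b *\<^sub>R v) ` \<Gamma>"
  have cX: "compact X" unfolding X_def by (intro compact_continuous_image \<Gamma> continuous_intros)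
  have cX': "compact X'" unfolding X'_def case_prod_beta by (intro compact_continuous_image \<Gamma> continuous_intros)
  have cp: "compact (hyperplane_proj v ` X)" by (rule compact_hyperplane_proj[OF cX])
  have bX [measurable]: "X \<in> sets borel" "X' \<in> sets borel" "hyperplane_proj v ` X \<in> sets borel"
    using cX cX' cp by (auto intro: borel_compact)
  have "emeasure lborel X' = (\<integral>\<^sup>+ s. emeasure lborel {t. s + t *\<^sub>R v \<in> X'} \<partial>hyperplane_measure v)"
    by (rule emeasure_lborel_slices[OF v]) measurable
  also have "\<dots> \<le> (\<integral>\<^sup>+ s. emeasure lborel {t. s + t *\<^sub>R v \<in> X} + ennreal (2 * c) * indicator (hyperplane_proj v ` X) s \<partial>hyperplane_measure v)"
  proof (rule nn_integral_mono_AE, use AE_hyperplane_measure[of v] in eventually_elim)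
    fix s assume s: "v \<bullet> s = 0"
    define \<Delta> where "\<Delta> = {(\<tau>, b). (s + \<tau> *\<^sub>R v, b) \<in> \<Gamma>}"
    have U: "{t. s + t *\<^sub>R v \<in> X'} = (\<lambda>(\<tau>, b). \<tau> + b) ` \<Delta>"
    proof (rule set_eqI)
      fix t
      have "(\<exists>x b. (x, b) \<in> \<Gamma> \<and> s + t *\<^sub>R v = x + b *\<^sub>R v) \<longleftrightarrow> (\<exists>\<tau> b. (s + \<tau> *\<^sub>R v, b) \<in> \<Gamma> \<and> t = \<tau> + b)"
      proof
        assume "\<exists>x b. (x, b) \<in> \<Gamma> \<and> s + t *\<^sub>R v = x + b *\<^sub>R v"
        then obtain x b where xb: "(x, b) \<in> \<Gamma>" "s + t *\<^sub>R v = x + b *\<^sub>R v" by blast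
        then have "x = s + (t - b) *\<^sub>R v" by (simp add: scaleR_diff_left algebra_simps)
        then show "\<exists>\<tau> b. (s + \<tau> *\<^sub>R v, b) \<in> \<Gamma> \<and> t = \<tau> + b" using xb(1) by (intro exI[of _ "t - b"] exI[of _ b]) simp
      next
        assume "\<exists>\<tau> b. (s + \<tau> *\<^sub>R v, b) \<in> \<Gamma> \<and> t = \<tau> + b"
        then obtain \<tau> b where "(s + \<tau> *\<^sub>R v, b) \<in> \<Gamma>" "t = \<tau> + b" by blast
        then show "\<exists>x b. (x, b) \<in> \<Gamma> \<and> s + t *\<^sub>R v = x + b *\<^sub>R v"
          by (intro exI[of _ "s + \<tau> *\<^sub>R v"] exI[of _ b]) (simp add: scaleR_add_left add.assoc)
      qed
      then show "t \<in> {t. s + t *\<^sub>R v \<in> X'} \<longleftrightarrow> t \<in> (\<lambda>(\<tau>, b). \<tau> + b) ` \<Delta>"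
        by (force simp: X'_def \<Delta>_def image_iff)
    qed
    show "emeasure lborel {t. s + t *\<^sub>R v \<in> X'} \<le> emeasure lborel {t. s + t *\<^sub>R v \<in> X} + ennreal (2 * c) * indicator (hyperplane_proj v ` X) s"
    proof (cases "\<Delta> = {}")
      case True
      then have "{t. s + t *\<^sub>R v \<in> X'} = {}" by (simp add: U)
      then show ?thesis by (simp only: emeasure_empty zero_le)
    next
      case False
      then obtain \<tau> b where "(s + \<tau> *\<^sub>R v, b) \<in> \<Gamma>" by (auto simp: \<Delta>_def)
      then have "s + \<tau> *\<^sub>R v \<in> X" unfolding X_def by (metis fst_conv image_eqI)
      then have "s \<in> hyperplane_proj v ` X" using hyperplane_proj_shift[OF v s, of \<tau>] by (metis image_eqI)
      moreover have "emeasure lborel ((\<lambda>(\<tau>, b). \<tau> + b) ` \<Delta>) \<le> emeasure lborel {t. s + t *\<^sub>R v \<in> X} + ennreal (2 * c)"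
      proof (rule emeasure_monotone_shift[OF compact_slice[OF cX v]])
        show "\<tau> \<in> {t. s + t *\<^sub>R v \<in> X} \<and> \<bar>b\<bar> \<le> c" if "(\<tau>, b) \<in> \<Delta>" for \<tau> b
          using that b[of "s + \<tau> *\<^sub>R v" b] by (force simp: \<Delta>_def X_def)
        show "b \<le> b'" if "(\<tau>, b) \<in> \<Delta>" "(\<tau>', b') \<in> \<Delta>" "\<tau> < \<tau>'" for \<tau> b \<tau>' b'
          using that mono[of "s + \<tau> *\<^sub>R v" b "\<tau>' - \<tau>" b'] by (simp add: \<Delta>_def algebra_simps scaleR_diff_left)
      qed
      ultimately show ?thesis by (simp add: U)
    qed
  qed
  also have "\<dots> = (\<integral>\<^sup>+ s. emeasure lborel {t. s + t *\<^sub>R v \<in> X} \<partial>hyperplane_measure v) + ennreal (2 * c) * emeasure (hyperplane_measure v) (hyperplane_proj v ` X)"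
    by (subst nn_integral_add) (auto simp: nn_integral_cmult_indicator)
  also have "\<dots> = emeasure lborel X + ennreal (2 * c) * shadow v X"
    using emeasure_lborel_slices[OF v bX(1)] by (simp add: shadow_def)
  finally show ?thesis by (simp add: X_def X'_def)
qed

text \<open>A displacement in several steps involves shadows of intermediate sets, which lie in
  small enlargements of \<open>K\<close>. As the displacement tends to 0, these shadows return to
  that of \<open>K\<close>.\<close>

lemma shadow_enlargement_tendsto:
  fixes K :: "(real ^ 'n) set"
  assumes K: "compact K" and v: "norm v = 1" and C: "0 \<le> C"
  shows "(\<lambda>k. shadow v (minkowski_sum K (cball 0 (C / real (Suc k))))) \<longlonglongrightarrow> shadow v K"
proof -
  let ?K = "\<lambda>k. minkowski_sum K (cball 0 (C / real (Suc k)))"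
  have cK: "compact (?K k)" for k by (intro compact_minkowski_sum K) simp
  have dec: "decseq (\<lambda>k. shadow v (?K k))"
  proof (rule decseq_SucI)
    fix k
    have "C / real (Suc (Suc k)) \<le> C / real (Suc k)" using C by (simp add: frac_le)
    then have "?K (Suc k) \<subseteq> ?K k" by (intro minkowski_sum_mono) auto
    then show "shadow v (?K (Suc k)) \<le> shadow v (?K k)" by (rule shadow_mono[OF cK])
  qed
  then have lim: "(\<lambda>k. shadow v (?K k)) \<longlonglongrightarrow> (INF k. shadow v (?K k))" by (rule LIMSEQ_INF)
  have "(INF k. shadow v (?K k)) = shadow v K"
  proof (rule antisym)
    show "(INF k. shadow v (?K k)) \<le> shadow v K"
      unfolding shadow_def[of v K]
    proof (rule emeasure_compact_upper_semicontinuous[OF _ compact_hyperplane_proj[OF K]])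
      fix e :: real assume e: "0 < e"
      obtain k where "C / e < real k" using reals_Archimedean2 by blast
      then have k: "C / real (Suc k) \<le> e" using e C by (simp add: field_simps)
      show "\<exists>T\<in>sets borel. (INF k. shadow v (?K k)) \<le> emeasure (hyperplane_measure v) T \<and> (\<forall>x\<in>T. \<exists>y\<in>hyperplane_proj v ` K. dist x y \<le> e)"
      proof (intro bexI[of _ "hyperplane_proj v ` ?K k"] conjI ballI)
        show "(INF k. shadow v (?K k)) \<le> emeasure (hyperplane_measure v) (hyperplane_proj v ` ?K k)"
          unfolding shadow_def by (rule INF_lower) simp
        show "hyperplane_proj v ` ?K k \<in> sets borel" using compact_hyperplane_proj[OF cK] by (rule borel_compact)
        fix x assume "x \<in> hyperplane_proj v ` ?K k"
        then obtain y z where yz: "y \<in> K" "norm z \<le> C / real (Suc k)" "x = hyperplane_proj v (y + z)"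
          by (auto simp: minkowski_sum_def)
        then have "dist x (hyperplane_proj v y) \<le> dist (y + z) y" using hyperplane_proj_lipschitz[OF v] by blast
        then have "dist x (hyperplane_proj v y) \<le> e" using yz(2) k by (simp add: dist_norm)
        then show "\<exists>y\<in>hyperplane_proj v ` K. dist x y \<le> e" using yz(1) by blast
      qed
    qed (auto intro: hyperplane_measure_bounded_finite[OF v])
    show "shadow v K \<le> (INF k. shadow v (?K k))"
    proof (rule INF_greatest)
      fix k
      have "K \<subseteq> ?K k"
      proof
        fix x assume "x \<in> K"
        moreover have "0 \<in> cball (0::real ^ 'n) (C / real (Suc k))" using C by simp
        ultimately have "x + 0 \<in> ?K k" unfolding minkowski_sum_def by blast
        then show "x \<in> ?K k" by simp
      qed
      then show "shadow v K \<le> shadow v (?K k)" by (rule shadow_mono[OF cK])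
    qed
  qed
  then show ?thesis using lim by simp
qed

lemma power_add_ge_linear:
  fixes a b :: real
  assumes "0 \<le> a" "0 \<le> b"
  shows "a ^ n + real n * b * a ^ (n - 1) \<le> (a + b) ^ n"
proof (induction n)
  case (Suc n)
  have "a ^ Suc n + real (Suc n) * b * a ^ (Suc n - 1) \<le> (a + b) * (a ^ n + real n * b * a ^ (n - 1))"
  proof (cases n)
    case (Suc k)
    have "0 \<le> b * (real (Suc k) * b * a ^ k)" using assms by simp
    then show ?thesis unfolding Suc by (simp add: algebra_simps)
  qed (use assms in simp)
  also have "\<dots> \<le> (a + b) * (a + b) ^ n" using Suc assms by (intro mult_left_mono) auto
  finally show ?case by simp
qed simp

text \<open>The gradient of \<open>\<psi> y = \<Sum>\<^sub>j c j * sqrt (1 + (v j \<bullet> y)\<^sup>2)\<close> is \<open>\<Sum>\<^sub>j a j (v j \<bullet> y) v j\<close> with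
  each \<open>a j\<close> increasing. A displacement \<open>x \<mapsto> x + t \<nabla>\<psi> y\<close> along a monotone relation \<open>(x, y)\<close> can therefore
  be carried out one direction at a time: after any number of steps the relation is still monotone along
  the lines parallel to the next \<open>v j\<close>, so that on each of these lines that meet the set the measure
  grows by at most \<open>2 t c j\<close>.\<close>

lemma directional_displacement_volume:
  fixes v :: "nat \<Rightarrow> real ^ 'n" and c :: "nat \<Rightarrow> real" and \<Gamma> :: "((real ^ 'n) \<times> (real ^ 'n)) set"
    and a :: "nat \<Rightarrow> real \<Rightarrow> real"
  assumes v: "\<And>j. j < N \<Longrightarrow> norm (v j) = 1" and K: "compact K" and \<Gamma>: "compact \<Gamma>" "fst ` \<Gamma> \<subseteq> K"
    and mono: "\<And>x y x' y'. (x, y) \<in> \<Gamma> \<Longrightarrow> (x', y') \<in> \<Gamma> \<Longrightarrow> 0 \<le> (x - x') \<bullet> (y - y')"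
    and a_cont: "\<And>j. j < N \<Longrightarrow> continuous_on UNIV (a j)" and a_mono: "\<And>j. j < N \<Longrightarrow> mono (a j)"
    and a_bound: "\<And>j s. j < N \<Longrightarrow> \<bar>a j s\<bar> \<le> c j"
  shows "emeasure lborel ((\<lambda>(x, y). x + (\<Sum>j<N. a j (v j \<bullet> y) *\<^sub>R v j)) ` \<Gamma>)
    \<le> emeasure lborel K + (\<Sum>j<N. ennreal (2 * c j) * shadow (v j) (minkowski_sum K (cball 0 (\<Sum>j<N. c j))))"
proof -
  have c0: "0 \<le> c j" if "j < N" for j using a_bound[OF that, of 0] abs_ge_zero order_trans by blast
  define p where "p i q = fst q + (\<Sum>j<i. a j (v j \<bullet> snd q) *\<^sub>R v j)" for i and q :: "(real ^ 'n) \<times> (real ^ 'n)"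
  \<comment> \<open>No partial displacement is longer than the sum of the \<open>c j\<close>, so
    \<open>E\<close> contains every intermediate set and its shadows dominate theirs.\<close>
  define E where "E = minkowski_sum K (cball 0 (\<Sum>j<N. c j))"
  have cE: "compact E" unfolding E_def by (intro compact_minkowski_sum K) simp
  have a_cont': "continuous_on UNIV (\<lambda>q :: (real ^ 'n) \<times> (real ^ 'n). a j (v j \<bullet> snd q))" if "j < N" for j
    by (intro continuous_on_compose2[OF a_cont[OF that]] continuous_intros) auto
  have p_cont: "continuous_on S (p i)" if "i \<le> N" for i S
    unfolding p_def using that
    by (intro continuous_intros continuous_on_subset[OF a_cont']) auto
  have pE: "p i q \<in> E" if "q \<in> \<Gamma>" "i \<le> N" for i q
  proof -
    have "norm (\<Sum>j<i. a j (v j \<bullet> snd q) *\<^sub>R v j) \<le> (\<Sum>j<i. c j)"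
      using v a_bound that(2) by (intro sum_norm_le) auto
    also have "\<dots> \<le> (\<Sum>j<N. c j)" using that(2) c0 by (intro sum_mono2) auto
    finally show ?thesis using that(1) \<Gamma>(2) unfolding E_def minkowski_sum_def p_def by (auto intro!: imageI)
  qed
  have "emeasure lborel (p i ` \<Gamma>) \<le> emeasure lborel K + (\<Sum>j<i. ennreal (2 * c j) * shadow (v j) E)" if "i \<le> N" for i
    using that
  proof (induction i)
    case 0
    have "p 0 ` \<Gamma> \<subseteq> K" using \<Gamma>(2) by (auto simp: p_def)
    then have "emeasure lborel (p 0 ` \<Gamma>) \<le> emeasure lborel K" using K by (intro emeasure_mono) (auto intro: borel_compact)
    then show ?case by simp
  next
    case (Suc i)
    then have i: "i < N" "i \<le> N" by auto
    define \<Delta> where "\<Delta> = (\<lambda>q. (p i q, a i (v i \<bullet> snd q))) ` \<Gamma>"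
    have c\<Delta>: "compact \<Delta>"
      unfolding \<Delta>_def
      by (intro compact_continuous_image \<Gamma>(1) continuous_intros p_cont i continuous_on_subset[OF a_cont'] subset_UNIV)
    have fst\<Delta>: "fst ` \<Delta> = p i ` \<Gamma>" by (simp add: \<Delta>_def image_image)
    have "p (Suc i) ` \<Gamma> = (\<lambda>(x, b). x + b *\<^sub>R v i) ` \<Delta>"
      by (simp add: \<Delta>_def image_image p_def add.assoc)
    also have "emeasure lborel \<dots> \<le> emeasure lborel (fst ` \<Delta>) + ennreal (2 * c i) * shadow (v i) (fst ` \<Delta>)"
    proof (rule emeasure_monotone_shift_along[OF v[OF i(1)] c\<Delta>])
      show "\<bar>b\<bar> \<le> c i" if "(x, b) \<in> \<Delta>" for x b using that a_bound[OF i(1)] by (auto simp: \<Delta>_def)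
      fix x b s b' assume "(x, b) \<in> \<Delta>" "(x + s *\<^sub>R v i, b') \<in> \<Delta>" and s: "0 < s"
      then obtain q q' where q: "q \<in> \<Gamma>" "x = p i q" "b = a i (v i \<bullet> snd q)"
        and q': "q' \<in> \<Gamma>" "x + s *\<^sub>R v i = p i q'" "b' = a i (v i \<bullet> snd q')" by (auto simp: \<Delta>_def)
      let ?d = "snd q' - snd q"
      \<comment> \<open>The inner product of this difference with \<open>?d\<close> is
        \<open>s * (v i \<bullet> ?d)\<close>. On the other side it is a sum of terms that are
        nonnegative by monotonicity of \<open>\<Gamma>\<close> and of each \<open>a j\<close>, so
        \<open>v i \<bullet> snd q\<close> does not decrease along the line.\<close>
      have "s *\<^sub>R v i = p i q' - p i q" unfolding q'(2)[symmetric] q(2)[symmetric] by simp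
      also have "\<dots> = (fst q' - fst q) + (\<Sum>j<i. (a j (v j \<bullet> snd q') - a j (v j \<bullet> snd q)) *\<^sub>R v j)"
        by (simp add: p_def sum_subtractf scaleR_diff_left)
      finally have eq: "s *\<^sub>R v i = (fst q' - fst q) + (\<Sum>j<i. (a j (v j \<bullet> snd q') - a j (v j \<bullet> snd q)) *\<^sub>R v j)" .
      have "s * (v i \<bullet> ?d) = (s *\<^sub>R v i) \<bullet> ?d" by simp
      also have "\<dots> = (fst q' - fst q) \<bullet> ?d + (\<Sum>j<i. (a j (v j \<bullet> snd q') - a j (v j \<bullet> snd q)) * (v j \<bullet> ?d))"
        unfolding eq by (simp only: inner_add_left inner_sum_left inner_scaleR_left)
      finally have "s * (v i \<bullet> ?d) = (fst q' - fst q) \<bullet> ?d + (\<Sum>j<i. (a j (v j \<bullet> snd q') - a j (v j \<bullet> snd q)) * (v j \<bullet> ?d))" .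
      moreover have "0 \<le> (fst q' - fst q) \<bullet> ?d"
        using mono[of "fst q'" "snd q'" "fst q" "snd q"] q(1) q'(1) by simp
      moreover have "0 \<le> (\<Sum>j<i. (a j (v j \<bullet> snd q') - a j (v j \<bullet> snd q)) * (v j \<bullet> ?d))"
      proof (rule sum_nonneg)
        fix j assume "j \<in> {..<i}"
        then have m: "mono (a j)" using a_mono i by auto
        show "0 \<le> (a j (v j \<bullet> snd q') - a j (v j \<bullet> snd q)) * (v j \<bullet> ?d)"
        proof (cases "v j \<bullet> snd q \<le> v j \<bullet> snd q'")
          case True
          then show ?thesis using monoD[OF m True] by (simp add: inner_diff_right)
        next
          case False
          then show ?thesis using monoD[OF m, of "v j \<bullet> snd q'" "v j \<bullet> snd q"]
            by (intro mult_nonpos_nonpos) (auto simp: inner_diff_right)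
        qed
      qed
      ultimately have "0 \<le> s * (v i \<bullet> ?d)" by linarith
      then have "v i \<bullet> snd q \<le> v i \<bullet> snd q'" using s by (simp add: zero_le_mult_iff inner_diff_right)
      then show "b \<le> b'" using monoD[OF a_mono[OF i(1)]] q(3) q'(3) by blast
    qed
    also have "\<dots> \<le> emeasure lborel (p i ` \<Gamma>) + ennreal (2 * c i) * shadow (v i) E"
      unfolding fst\<Delta> using pE i by (intro add_left_mono mult_left_mono shadow_mono[OF cE]) auto
    also have "\<dots> \<le> (emeasure lborel K + (\<Sum>j<i. ennreal (2 * c j) * shadow (v j) E)) + ennreal (2 * c i) * shadow (v i) E"
      using Suc.IH i by (intro add_right_mono) auto
    finally show ?case by (simp add: add.assoc)
  qed
  from this[of N] show ?thesis by (simp add: p_def E_def case_prod_beta)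
qed

text \<open>Comparison of first-order terms in \<open>t\<close>. By
  \<open>monotone_displacement\<close> the displaced volume is at least
  \<open>M ^ n + n t R' A M ^ (n - 1)\<close>; by \<open>directional_displacement_volume\<close> it
  is at most the volume of \<open>K\<close> plus the sum of \<open>2 t c\<^sub>j\<close> times the
  shadows of an enlargement of \<open>K\<close>. The volume \<open>M ^ n\<close> of \<open>K\<close>
  cancels. After division by \<open>t\<close> the enlargement shrinks to \<open>K\<close>, and
  finally \<open>R'\<close> tends to \<open>R\<close>.\<close>

lemma weighted_shadow_inequality:
  fixes K :: "(real ^ 'n) set" and v :: "nat \<Rightarrow> real ^ 'n" and c :: "nat \<Rightarrow> real"
  assumes K: "compact K" "0 < measure lborel K"
    and v: "\<And>j. j < N \<Longrightarrow> norm (v j) = 1" and c: "\<And>j. j < N \<Longrightarrow> 0 \<le> c j"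
    and R: "0 < R" and width: "\<And>e. R * norm e \<le> (\<Sum>j<N. c j * \<bar>v j \<bullet> e\<bar>)"
  shows "ennreal (real CARD('n) * (R * root CARD('n) (measure lborel (cball (0::real ^ 'n) 1))) * root CARD('n) (measure lborel K) ^ (CARD('n) - 1))
     \<le> (\<Sum>j<N. ennreal (2 * c j) * shadow (v j) K)"
proof -
  let ?n = "CARD('n)"
  let ?r = "root ?n" and ?m = "measure lborel"
  define S where "S = (\<Sum>j<N. ennreal (2 * c j) * shadow (v j) K)"
  define A where "A = ?r (?m (cball (0::real ^ 'n) 1))"
  define M where "M = ?r (?m K)"
  have n: "0 < ?n" by simp
  have M0: "0 \<le> M" "0 \<le> A" by (auto simp: M_def A_def real_root_ge_zero)
  have Mn: "M ^ ?n = ?m K" unfolding M_def by (simp add: real_root_pow_pos2)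
  have main: "ennreal (real ?n * (R' * A) * M ^ (?n - 1)) \<le> S" if R': "0 < R'" "R' < R" for R'
  proof -
    \<comment> \<open>Since \<open>sqrt (1 + s\<^sup>2) \<ge> \<bar>s\<bar>\<close>, the hypothesis
      \<open>width\<close> becomes coercivity of \<psi> with the constant \<open>R\<close>. The
      derivative \<open>h\<close> is increasing and bounded by 1, as the one-directional steps
      require.\<close>
    define \<psi> where "\<psi> y = (\<Sum>j<N. c j * sqrt (1 + (v j \<bullet> y)\<^sup>2))" for y
    define h where "h s = s / sqrt (1 + s\<^sup>2)" for s :: real
    define g where "g y = (\<Sum>j<N. (c j * h (v j \<bullet> y)) *\<^sub>R v j)" for y
    have pos: "0 < 1 + s\<^sup>2" for s :: real by (simp add: add_pos_nonneg)
    have h_der: "((\<lambda>s. sqrt (1 + s\<^sup>2)) has_real_derivative h s) (at s)" for s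
      using pos[of s] by (auto intro!: derivative_eq_intros simp: h_def field_simps)
    have h_cont: "continuous_on T h" for T
      unfolding h_def using pos by (intro continuous_intros) (metis less_irrefl real_sqrt_eq_zero_cancel_iff)
    have h_bound: "\<bar>h s\<bar> \<le> 1" for s
    proof -
      have "\<bar>s\<bar> \<le> sqrt (1 + s\<^sup>2)" by (rule real_le_rsqrt) simp
      then show ?thesis using pos[of s] by (simp add: h_def)
    qed
    have h_mono: "mono h"
    proof (rule monoI)
      fix s s' :: real assume "s \<le> s'"
      have "(h has_real_derivative 1 / (sqrt (1 + x\<^sup>2) * (1 + x\<^sup>2))) (at x)" for x
      proof -
        have sq: "sqrt (1 + x\<^sup>2) * sqrt (1 + x\<^sup>2) = 1 + x\<^sup>2" "sqrt (1 + x\<^sup>2) > 0" using pos[of x] by auto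
        show ?thesis unfolding h_def
          by (rule derivative_eq_intros h_der refl | use sq in \<open>simp; fail\<close>)+
            (use sq in \<open>simp add: h_def field_simps power2_eq_square\<close>)
      qed
      then show "h s \<le> h s'"
        using pos by (intro DERIV_nonneg_imp_nondecreasing[OF \<open>s \<le> s'\<close>]) (meson divide_nonneg_nonneg mult_nonneg_nonneg less_imp_le real_sqrt_ge_zero zero_le_one)
    qed
    have der: "(\<psi> has_derivative (\<lambda>d. g y \<bullet> d)) (at y)" for y
    proof -
      have "((\<lambda>y. c j * sqrt (1 + (v j \<bullet> y)\<^sup>2)) has_derivative (\<lambda>d. c j * ((v j \<bullet> d) * h (v j \<bullet> y)))) (at y)" for j
      proof -
        have "((\<lambda>y. v j \<bullet> y) has_derivative (\<lambda>d. v j \<bullet> d)) (at y)" by (intro derivative_intros)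
        from has_derivative_compose[OF this h_der[unfolded has_field_derivative_def]]
        have "((\<lambda>y. sqrt (1 + (v j \<bullet> y)\<^sup>2)) has_derivative (\<lambda>d. h (v j \<bullet> y) * (v j \<bullet> d))) (at y)" by simp
        from has_derivative_mult_right[OF this, of "c j"] show ?thesis by (simp add: mult_ac)
      qed
      then have "(\<psi> has_derivative (\<lambda>d. \<Sum>j<N. c j * ((v j \<bullet> d) * h (v j \<bullet> y)))) (at y)"
        unfolding \<psi>_def by (intro has_derivative_sum)
      moreover have "(\<lambda>d. \<Sum>j<N. c j * ((v j \<bullet> d) * h (v j \<bullet> y))) = (\<lambda>d. g y \<bullet> d)"
        by (simp add: g_def inner_sum_left mult_ac)
      ultimately show ?thesis by simp
    qed
    have coercive: "R * norm y \<le> \<psi> y" for y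
    proof -
      have "R * norm y \<le> (\<Sum>j<N. c j * \<bar>v j \<bullet> y\<bar>)" by (rule width)
      also have "\<dots> \<le> \<psi> y" unfolding \<psi>_def
        using c by (intro sum_mono mult_left_mono real_le_rsqrt) auto
      finally show ?thesis .
    qed
    have g_cont: "continuous_on UNIV g"
      unfolding g_def by (intro continuous_intros continuous_on_compose2[OF h_cont[of UNIV]]) auto
    define C where "C = (\<Sum>j<N. c j)"
    have C0: "0 \<le> C" unfolding C_def using c by (intro sum_nonneg) auto
    let ?K = "\<lambda>k. minkowski_sum K (cball 0 (C / real (Suc k)))"
    have step: "ennreal (real ?n * (R' * A) * M ^ (?n - 1)) \<le> (\<Sum>j<N. ennreal (2 * c j) * shadow (v j) (?K k))" for k
    proof -
      \<comment> \<open>The total length of the shifts is then \<open>C / real (Suc k)\<close>, the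
        radius of the enlargement \<open>?K k\<close>.\<close>
      define t where "t = 1 / real (Suc k)"
      have t: "0 < t" by (simp add: t_def)
      obtain \<Gamma> :: "((real ^ 'n) \<times> (real ^ 'n)) set" where \<Gamma>: "compact \<Gamma>" "fst ` \<Gamma> \<subseteq> K"
        "\<And>x y x' y'. (x, y) \<in> \<Gamma> \<Longrightarrow> (x', y') \<in> \<Gamma> \<Longrightarrow> 0 \<le> (x - x') \<bullet> (y - y')"
        "(root DIM(real ^ 'n) (?m K) + t * root DIM(real ^ 'n) (?m (cball (0::real ^ 'n) R'))) ^ DIM(real ^ 'n)
          \<le> ?m ((\<lambda>(x, y). x + t *\<^sub>R g y) ` \<Gamma>)"
        by (rule monotone_displacement[OF K R' der coercive g_cont t]) blast
      let ?G = "(\<lambda>(x, y). x + t *\<^sub>R g y) ` \<Gamma>"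
      have "?m (cball (0::real ^ 'n) R') = R' ^ ?n * ?m (cball (0::real ^ 'n) 1)"
      proof -
        have "cball (0::real ^ 'n) R' = (*\<^sub>R) R' ` cball 0 1" using R'(1) by (simp add: cball_scale)
        then show ?thesis using measure_scaleR_image[of "cball (0::real ^ 'n) 1" R'] R'(1) by simp
      qed
      then have rD: "?r (?m (cball (0::real ^ 'n) R')) = R' * A"
        using R'(1) by (simp add: A_def real_root_mult real_root_power_cancel)
      have "?m K + real ?n * (t * (R' * A)) * M ^ (?n - 1) \<le> (M + t * (R' * A)) ^ ?n"
        using power_add_ge_linear[of M "t * (R' * A)" ?n] M0 t R' Mn by simp
      also have "\<dots> \<le> ?m ?G" using \<Gamma>(4) by (simp add: M_def rD)
      finally have le: "?m K + real ?n * (t * (R' * A)) * M ^ (?n - 1) \<le> ?m ?G" .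
      have cG: "compact ?G"
        unfolding case_prod_beta
        by (intro compact_continuous_image \<Gamma>(1) continuous_intros continuous_on_compose2[OF g_cont]) auto
      have Geq: "?G = (\<lambda>(x, y). x + (\<Sum>j<N. (t * c j * h (v j \<bullet> y)) *\<^sub>R v j)) ` \<Gamma>"
        by (simp add: g_def scaleR_sum_right mult.assoc)
      have "0 \<le> real ?n * (t * (R' * A)) * M ^ (?n - 1)"
        using M0 t R' by (intro mult_nonneg_nonneg zero_le_power) auto
      then have "ennreal (?m K) + ennreal (real ?n * (t * (R' * A)) * M ^ (?n - 1))
          = ennreal (?m K + real ?n * (t * (R' * A)) * M ^ (?n - 1))"
        by (intro ennreal_plus[symmetric] measure_nonneg)
      also have "\<dots> \<le> emeasure lborel ?G"
        unfolding emeasure_lborel_eq_measure[OF compact_imp_bounded[OF cG]] by (rule ennreal_leI[OF le])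
      also have "\<dots> \<le> emeasure lborel K + (\<Sum>j<N. ennreal (2 * (t * c j)) * shadow (v j) (minkowski_sum K (cball 0 (\<Sum>j<N. t * c j))))"
        unfolding Geq
      proof (rule directional_displacement_volume[where a="\<lambda>j s. t * c j * h s", OF v K(1) \<Gamma>(1,2,3)])
        show "continuous_on UNIV (\<lambda>s. t * c j * h s)" for j by (intro continuous_intros h_cont)
        show "mono (\<lambda>s. t * c j * h s)" if "j < N" for j
          using monoD[OF h_mono] c[OF that] t by (intro monoI mult_left_mono) auto
        show "\<bar>t * c j * h s\<bar> \<le> t * c j" if "j < N" for j s
          using c[OF that] t h_bound[of s] by (simp add: abs_mult mult_left_le)
      qed
      also have "(\<Sum>j<N. t * c j) = C / real (Suc k)" by (simp add: C_def t_def sum_divide_distrib)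
      finally have "ennreal (?m K) + ennreal (real ?n * (t * (R' * A)) * M ^ (?n - 1))
        \<le> ennreal (?m K) + (\<Sum>j<N. ennreal (2 * (t * c j)) * shadow (v j) (?K k))"
        by (simp add: emeasure_lborel_eq_measure[OF compact_imp_bounded[OF K(1)]])
      then have "ennreal (real ?n * (t * (R' * A)) * M ^ (?n - 1)) \<le> (\<Sum>j<N. ennreal (2 * (t * c j)) * shadow (v j) (?K k))"
        by (simp add: ennreal_add_left_cancel_le)
      also have "\<dots> = ennreal t * (\<Sum>j<N. ennreal (2 * c j) * shadow (v j) (?K k))"
        unfolding sum_distrib_left
      proof (rule sum.cong[OF refl])
        fix j assume "j \<in> {..<N}"
        then have "ennreal (t * (2 * c j)) = ennreal t * ennreal (2 * c j)"
          using t c by (intro ennreal_mult) auto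
        moreover have "2 * (t * c j) = t * (2 * c j)" by simp
        ultimately show "ennreal (2 * (t * c j)) * shadow (v j) (?K k) = ennreal t * (ennreal (2 * c j) * shadow (v j) (?K k))"
          by (simp only: mult.assoc)
      qed
      finally have "ennreal (1 / t) * ennreal (real ?n * (t * (R' * A)) * M ^ (?n - 1))
        \<le> ennreal (1 / t) * (ennreal t * (\<Sum>j<N. ennreal (2 * c j) * shadow (v j) (?K k)))"
        by (rule mult_left_mono) simp
      moreover have "ennreal (1 / t) * ennreal (real ?n * (t * (R' * A)) * M ^ (?n - 1)) = ennreal (real ?n * (R' * A) * M ^ (?n - 1))"
        using t M0 R' by (simp add: ennreal_mult[symmetric])
      moreover have "ennreal (1 / t) * (ennreal t * X) = X" for X
        using t by (simp add: mult.assoc[symmetric] ennreal_mult[symmetric])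
      ultimately show ?thesis by simp
    qed
    have "(\<lambda>k. \<Sum>j<N. ennreal (2 * c j) * shadow (v j) (?K k)) \<longlonglongrightarrow> S"
      unfolding S_def using v C0
      by (intro tendsto_sum ennreal_tendsto_cmult shadow_enlargement_tendsto K(1)) auto
    then show ?thesis by (rule LIMSEQ_le_const) (use step in auto)
  qed
  \<comment> \<open>Adding 2 to \<open>k\<close> keeps the factor strictly between 0 and 1 from
    \<open>k = 0\<close> on, as \<open>main\<close> requires.\<close>
  have "(\<lambda>k. ennreal (real ?n * ((R * (1 - 1 / real (k + 2))) * A) * M ^ (?n - 1))) \<longlonglongrightarrow> ennreal (real ?n * ((R * (1 - 0)) * A) * M ^ (?n - 1))"
    by (intro tendsto_ennrealI tendsto_intros LIMSEQ_ignore_initial_segment[OF lim_1_over_n])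
  then have "ennreal (real ?n * ((R * (1 - 0)) * A) * M ^ (?n - 1)) \<le> S"
  proof (rule LIMSEQ_le_const2)
    have "ennreal (real ?n * ((R * (1 - 1 / real (k + 2))) * A) * M ^ (?n - 1)) \<le> S" for k
    proof (rule main)
      have 1: "0 < 1 - 1 / real (k + 2)" "1 - 1 / real (k + 2) < 1" by (simp_all add: field_simps)
      show "0 < R * (1 - 1 / real (k + 2))" using R 1(1) by (rule mult_pos_pos)
      show "R * (1 - 1 / real (k + 2)) < R" using mult_strict_left_mono[OF 1(2) R] by simp
    qed
    then show "\<exists>M'. \<forall>k\<ge>M'. ennreal (real ?n * ((R * (1 - 1 / real (k + 2))) * A) * M ^ (?n - 1)) \<le> S" by blast
  qed
  then show ?thesis by (simp add: S_def A_def M_def)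
qed

section \<open>The upper bound for the shadow of a ball\<close>

lemma shadow_eq_hausdorff_measure:
  fixes v :: "real ^ 'n"
  assumes X: "compact X" and v: "norm v = 1"
  shows "shadow v X = hausdorff_measure (CARD('n) - 1) (hyperplane_proj v ` X)"
proof -
  have "hyperplane_proj v ` X \<in> sets borel" by (rule borel_compact[OF compact_hyperplane_proj[OF X]])
  moreover have "hyperplane_proj v ` X \<inter> {x. v \<bullet> x = 0} = hyperplane_proj v ` X"
    using inner_hyperplane_proj[OF v] by auto
  ultimately show ?thesis by (simp add: shadow_def emeasure_hyperplane_measure)
qed

lemma hyperplane_proj_orthogonal:
  assumes g: "orthogonal_transformation g"
  shows "hyperplane_proj (g v) (g x) = g (hyperplane_proj v x)"
  using g unfolding hyperplane_proj_def orthogonal_transformation_def by (simp add: linear_diff linear_scale)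

lemma shadow_orthogonal:
  fixes v :: "real ^ 'n" and g :: "real ^ 'n \<Rightarrow> real ^ 'n"
  assumes g: "orthogonal_transformation g" and X: "compact X" and v: "norm v = 1"
  shows "shadow (g v) (g ` X) = shadow v X"
proof -
  have lin: "linear g" using g by (simp add: orthogonal_transformation_def)
  have "compact (g ` X)"
    by (intro compact_continuous_image X linear_continuous_on) (simp add: lin linear_conv_bounded_linear[symmetric])
  moreover have "norm (g v) = 1" using v orthogonal_transformation_norm[OF g] by simp
  moreover have "hyperplane_proj (g v) ` g ` X = g ` hyperplane_proj v ` X"
    by (simp add: image_image hyperplane_proj_orthogonal[OF g])
  moreover have "dist (g x) (g y) = dist x y" for x y
    using g orthogonal_transformation_isometry[of g] by blast
  ultimately show ?thesis
    using X v by (simp add: shadow_eq_hausdorff_measure hausdorff_measure_isometry)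
qed

lemma shadow_cball_indep:
  fixes u v :: "real ^ 'n"
  assumes "norm u = 1" "norm v = 1"
  shows "shadow u (cball 0 r) = shadow v (cball 0 r)"
proof -
  obtain g :: "real ^ 'n \<Rightarrow> real ^ 'n" where g: "orthogonal_transformation g" "g u = v"
    by (rule orthogonal_transformation_exists_1[OF assms])
  have "g ` cball 0 r = cball 0 r"
  proof (rule set_eqI)
    fix x
    obtain y where y: "x = g y" using orthogonal_transformation_surj[OF g(1)] by (metis surjD)
    show "x \<in> g ` cball 0 r \<longleftrightarrow> x \<in> cball 0 r"
      unfolding y inj_image_mem_iff[OF orthogonal_transformation_inj[OF g(1)]]
      by (simp add: orthogonal_transformation_norm[OF g(1)])
  qed
  then show ?thesis using shadow_orthogonal[OF g(1) compact_cball assms(1), of 0 r] g(2) by simp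
qed

text \<open>The counterpart of \<open>emeasure_monotone_shift\<close> in the other direction: the
  sum contains \<open>S\<close> shifted to the right by \<open>c\<close> and, disjoint from it, an
  interval of length \<open>2 * c\<close> centred at the least point of \<open>S\<close>.\<close>

lemma emeasure_real_thicken_ge:
  fixes S :: "real set"
  assumes S: "compact S" "S \<noteq> {}" and c: "0 \<le> c"
  shows "emeasure lborel S + ennreal (2 * c) \<le> emeasure lborel (minkowski_sum S {-c..c})"
proof -
  define m where "m = Inf S"
  have m: "m \<in> S" unfolding m_def using S by (intro closed_contains_Inf compact_imp_closed bounded_imp_bdd_below compact_imp_bounded)
  have mle: "m \<le> s" if "s \<in> S" for s
    unfolding m_def using that S by (intro cInf_lower bounded_imp_bdd_below compact_imp_bounded)
  have cS: "compact ((+) c ` S)" using S by (intro compact_translation)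
  have "emeasure lborel ((+) c ` S) = emeasure lborel S"
  proof -
    have "emeasure lborel S = emeasure (distr lborel borel ((+) (- c))) S" by (simp add: lborel_distr_plus)
    also have "\<dots> = emeasure lborel ((+) (- c) -` S)"
      using S by (subst emeasure_distr) (auto intro: borel_compact)
    also have "(+) (- c) -` S = (+) c ` S" by force
    finally show ?thesis by simp
  qed
  then have "emeasure lborel S + ennreal (2 * c) = emeasure lborel ((+) c ` S) + emeasure lborel {m - c..<m + c}"
    using c by simp
  also have "\<dots> = emeasure lborel ((+) c ` S \<union> {m - c..<m + c})"
    using cS mle by (intro plus_emeasure) (force intro: borel_compact)+
  also have "\<dots> \<le> emeasure lborel (minkowski_sum S {-c..c})"
  proof (rule emeasure_mono)
    show "(+) c ` S \<union> {m - c..<m + c} \<subseteq> minkowski_sum S {-c..c}"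
    proof
      fix x assume "x \<in> (+) c ` S \<union> {m - c..<m + c}"
      then consider s where "s \<in> S" "x = s + c" | "x \<in> {m - c..<m + c}" by (auto simp: add.commute)
      then show "x \<in> minkowski_sum S {-c..c}"
      proof cases
        case 1
        then show ?thesis using c unfolding minkowski_sum_def by force
      next
        case 2
        then have "x = m + (x - m)" "x - m \<in> {-c..c}" by auto
        then show ?thesis using m unfolding minkowski_sum_def by blast
      qed
    qed
    show "minkowski_sum S {- c..c} \<in> sets lborel"
      using compact_minkowski_sum[OF S(1), of "{-c..c}"] by (auto intro: borel_compact)
  qed
  finally show ?thesis .
qed

text \<open>Lines over the projection of \<open>X\<close> gain at least \<open>2 * c\<close>, all
  others are left as they were; integration over the lines gives the shadow term.\<close>

lemma emeasure_segment_sum_ge: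
  fixes v :: "real ^ 'n"
  assumes v: "norm v = 1" and X: "compact X" and c: "0 \<le> c"
  shows "emeasure lborel X + ennreal (2 * c) * shadow v X \<le> emeasure lborel (minkowski_sum X ((\<lambda>b. b *\<^sub>R v) ` {-c..c}))"
proof -
  define X' where "X' = minkowski_sum X ((\<lambda>b. b *\<^sub>R v) ` {-c..c})"
  have cX': "compact X'"
    unfolding X'_def by (intro compact_minkowski_sum X compact_continuous_image continuous_intros) simp
  have cp: "compact (hyperplane_proj v ` X)" by (rule compact_hyperplane_proj[OF X])
  have bX [measurable]: "X \<in> sets borel" "X' \<in> sets borel" "hyperplane_proj v ` X \<in> sets borel"
    using X cX' cp by (auto intro: borel_compact)
  have "emeasure lborel X + ennreal (2 * c) * shadow v X
    = (\<integral>\<^sup>+ s. emeasure lborel {t. s + t *\<^sub>R v \<in> X} \<partial>hyperplane_measure v) + ennreal (2 * c) * emeasure (hyperplane_measure v) (hyperplane_proj v ` X)"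
    using emeasure_lborel_slices[OF v bX(1)] by (simp add: shadow_def)
  also have "\<dots> = (\<integral>\<^sup>+ s. emeasure lborel {t. s + t *\<^sub>R v \<in> X} + ennreal (2 * c) * indicator (hyperplane_proj v ` X) s \<partial>hyperplane_measure v)"
    by (subst nn_integral_add) (auto simp: nn_integral_cmult_indicator)
  also have "\<dots> \<le> (\<integral>\<^sup>+ s. emeasure lborel {t. s + t *\<^sub>R v \<in> X'} \<partial>hyperplane_measure v)"
  proof (rule nn_integral_mono_AE, use AE_hyperplane_measure[of v] in eventually_elim)
    fix s assume s: "v \<bullet> s = 0"
    let ?S = "{t. s + t *\<^sub>R v \<in> X}"
    have cS: "compact ?S" by (rule compact_slice[OF X v])
    have sub: "minkowski_sum ?S {-c..c} \<subseteq> {t. s + t *\<^sub>R v \<in> X'}"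
    proof
      fix t assume "t \<in> minkowski_sum ?S {-c..c}"
      then obtain \<tau> b where tb: "s + \<tau> *\<^sub>R v \<in> X" "b \<in> {-c..c}" "t = \<tau> + b" by (auto simp: minkowski_sum_def)
      then have "s + t *\<^sub>R v = (s + \<tau> *\<^sub>R v) + b *\<^sub>R v" by (simp add: scaleR_add_left add.assoc)
      then show "t \<in> {t. s + t *\<^sub>R v \<in> X'}" using tb unfolding X'_def minkowski_sum_def by blast
    qed
    have m': "{t. s + t *\<^sub>R v \<in> X'} \<in> sets lborel" using compact_slice[OF cX' v, of s] by (auto intro: borel_compact)
    show "emeasure lborel ?S + ennreal (2 * c) * indicator (hyperplane_proj v ` X) s \<le> emeasure lborel {t. s + t *\<^sub>R v \<in> X'}"
    proof (cases "s \<in> hyperplane_proj v ` X")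
      case True
      then obtain x where x: "x \<in> X" "s = x - (v \<bullet> x) *\<^sub>R v" by (auto simp: hyperplane_proj_def)
      then have "v \<bullet> x \<in> ?S" by simp
      then have "?S \<noteq> {}" by blast
      have "emeasure lborel ?S + ennreal (2 * c) \<le> emeasure lborel (minkowski_sum ?S {-c..c})"
        by (rule emeasure_real_thicken_ge[OF cS \<open>?S \<noteq> {}\<close> c])
      also have "\<dots> \<le> emeasure lborel {t. s + t *\<^sub>R v \<in> X'}" by (rule emeasure_mono[OF sub m'])
      finally show ?thesis using True by simp
    next
      case False
      have "?S \<subseteq> minkowski_sum ?S {-c..c}"
      proof
        fix \<tau> assume "\<tau> \<in> ?S"
        moreover have "0 \<in> {-c..c}" using c by simp
        ultimately have "\<tau> + 0 \<in> minkowski_sum ?S {-c..c}" unfolding minkowski_sum_def by blast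
        then show "\<tau> \<in> minkowski_sum ?S {-c..c}" by simp
      qed
      then have "emeasure lborel ?S \<le> emeasure lborel {t. s + t *\<^sub>R v \<in> X'}" using sub m' by (intro emeasure_mono) auto
      then show ?thesis using False by simp
    qed
  qed
  also have "\<dots> = emeasure lborel X'" by (rule emeasure_lborel_slices[OF v bX(2), symmetric])
  finally show ?thesis by (simp add: X'_def)
qed

lemma measure_cball_scale:
  "0 \<le> r \<Longrightarrow> measure lborel (cball (0::'a::euclidean_space) r) = r ^ DIM('a) * measure lborel (cball (0::'a) 1)"
proof (cases "r = 0")
  case False
  assume "0 \<le> r"
  then have "cball (0::'a) r = (*\<^sub>R) r ` cball 0 1" using False by (simp add: cball_scale)
  then show ?thesis using measure_scaleR_image[of "cball (0::'a) 1" r] \<open>0 \<le> r\<close> by simp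
qed simp

lemma power_diff_le_linear:
  fixes a b :: real
  assumes "0 \<le> a" "a \<le> b"
  shows "b ^ n - a ^ n \<le> real n * (b - a) * b ^ (n - 1)"
proof (induction n)
  case (Suc n)
  have "b ^ Suc n - a ^ Suc n = b * (b ^ n - a ^ n) + (b - a) * a ^ n" by (simp add: algebra_simps)
  also have "\<dots> \<le> b * (real n * (b - a) * b ^ (n - 1)) + (b - a) * b ^ n"
    using Suc assms by (intro add_mono mult_left_mono power_mono) auto
  also have "\<dots> = real (Suc n) * (b - a) * b ^ (Suc n - 1)"
    by (cases n) (simp_all add: algebra_simps)
  finally show ?case .
qed simp

text \<open>The segments from \<open>- t c\<^sub>j v\<^sub>j\<close> to
  \<open>t c\<^sub>j v\<^sub>j\<close> are added to the ball one at a time. The growing set always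
  contains the ball, whose shadow \<open>w\<close> is the same in all directions, so the volume
  rises by at least \<open>2 t w\<close> in total; yet the final set lies in the ball of radius
  \<open>r + t R\<close>. Dividing by \<open>t\<close> and letting it tend to 0 compares
  \<open>2 w\<close> with \<open>R\<close> times the derivative of the volume in the radius.\<close>

lemma shadow_cball_le:
  fixes v :: "nat \<Rightarrow> real ^ 'n" and c :: "nat \<Rightarrow> real" and u :: "real ^ 'n"
  assumes v: "\<And>j. j < N \<Longrightarrow> norm (v j) = 1" and c: "\<And>j. j < N \<Longrightarrow> 0 \<le> c j" and c1: "(\<Sum>j<N. c j) = 1"
    and R: "0 \<le> R" and width: "\<And>e. (\<Sum>j<N. c j * \<bar>v j \<bullet> e\<bar>) \<le> R * norm e"
    and u: "norm u = 1" and r: "0 < r"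
  shows "2 * shadow u (cball 0 r) \<le> ennreal (real CARD('n) * R * measure lborel (cball (0::real ^ 'n) 1) * r ^ (CARD('n) - 1))"
proof -
  let ?n = "CARD('n)"
  define B where "B = measure lborel (cball (0::real ^ 'n) 1)"
  have B0: "0 \<le> B" by (simp add: B_def)
  have "shadow u (cball 0 r) < top"
    unfolding shadow_def using compact_hyperplane_proj[of "cball 0 r" u]
    by (intro hyperplane_measure_bounded_finite[OF u] compact_imp_bounded borel_compact) auto
  then obtain w where w: "shadow u (cball 0 r) = ennreal w" "0 \<le> w"
    by (cases "shadow u (cball 0 r)") auto
  have step: "2 * w \<le> real ?n * R * B * (r + t * R) ^ (?n - 1)" if t: "0 < t" for t
  proof -
    define W where "W = rec_nat (cball (0::real ^ 'n) r) (\<lambda>i X. minkowski_sum X ((\<lambda>b. b *\<^sub>R v i) ` {- (t * c i)..t * c i}))"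
    have W0: "W 0 = cball 0 r" and WS: "W (Suc i) = minkowski_sum (W i) ((\<lambda>b. b *\<^sub>R v i) ` {- (t * c i)..t * c i})" for i
      by (simp_all add: W_def)
    \<comment> \<open>The last conjunct bounds the support function of \<open>W i\<close>. For
      \<open>i = N\<close> and \<open>e = x\<close> it yields the inclusion in a ball of radius
      \<open>r + t * R\<close>.\<close>
    have W: "compact (W i) \<and> cball 0 r \<subseteq> W i \<and> emeasure lborel (cball (0::real ^ 'n) r) + ennreal (2 * t * (\<Sum>j<i. c j)) * ennreal w \<le> emeasure lborel (W i)
        \<and> (\<forall>x\<in>W i. \<forall>e. x \<bullet> e \<le> r * norm e + t * (\<Sum>j<i. c j * \<bar>v j \<bullet> e\<bar>))" if "i \<le> N" for i
      using that
    proof (induction i)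
      case 0
      have "x \<bullet> e \<le> r * norm e" if "norm x \<le> r" for x e :: "real ^ 'n"
        using norm_cauchy_schwarz[of x e] mult_right_mono[OF that, of "norm e"] by simp
      then show ?case by (simp add: W0)
    next
      case (Suc i)
      then have i: "i < N" and IH: "compact (W i)" "cball 0 r \<subseteq> W i"
        "emeasure lborel (cball (0::real ^ 'n) r) + ennreal (2 * t * (\<Sum>j<i. c j)) * ennreal w \<le> emeasure lborel (W i)"
        "\<And>x e. x \<in> W i \<Longrightarrow> x \<bullet> e \<le> r * norm e + t * (\<Sum>j<i. c j * \<bar>v j \<bullet> e\<bar>)" by auto
      have tc: "0 \<le> t * c i" using t c[OF i] by simp
      have sc: "0 \<le> (\<Sum>j<i. c j)" using c i by (intro sum_nonneg) auto
      have 1: "compact (W (Suc i))"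
        unfolding WS by (intro compact_minkowski_sum IH compact_continuous_image continuous_intros) simp
      have 2: "cball 0 r \<subseteq> W (Suc i)"
      proof
        fix x :: "real ^ 'n" assume "x \<in> cball 0 r"
        then have "x \<in> W i" using IH(2) by blast
        moreover have "0 *\<^sub>R v i \<in> (\<lambda>b. b *\<^sub>R v i) ` {- (t * c i)..t * c i}" using tc by (intro imageI) simp
        ultimately have "x + 0 *\<^sub>R v i \<in> W (Suc i)" unfolding WS minkowski_sum_def by blast
        then show "x \<in> W (Suc i)" by simp
      qed
      have "shadow u (cball 0 r) = shadow (v i) (cball 0 r)" by (rule shadow_cball_indep[OF u v[OF i]])
      also have "\<dots> \<le> shadow (v i) (W i)" by (rule shadow_mono[OF IH(1,2)])
      finally have ws: "ennreal w \<le> shadow (v i) (W i)" by (simp add: w)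
      have "ennreal (2 * t * (\<Sum>j<Suc i. c j)) * ennreal w = ennreal (2 * t * (\<Sum>j<i. c j)) * ennreal w + ennreal (2 * (t * c i)) * ennreal w"
      proof -
        have "2 * t * (\<Sum>j<Suc i. c j) = 2 * t * (\<Sum>j<i. c j) + 2 * (t * c i)" by (simp add: algebra_simps)
        moreover have "ennreal (2 * t * (\<Sum>j<i. c j) + 2 * (t * c i)) = ennreal (2 * t * (\<Sum>j<i. c j)) + ennreal (2 * (t * c i))"
          using t sc tc by (intro ennreal_plus) auto
        ultimately show ?thesis by (simp only: distrib_right)
      qed
      then have "emeasure lborel (cball (0::real ^ 'n) r) + ennreal (2 * t * (\<Sum>j<Suc i. c j)) * ennreal w
        = (emeasure lborel (cball (0::real ^ 'n) r) + ennreal (2 * t * (\<Sum>j<i. c j)) * ennreal w) + ennreal (2 * (t * c i)) * ennreal w"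
        by (simp only: add.assoc)
      also have "\<dots> \<le> emeasure lborel (W i) + ennreal (2 * (t * c i)) * shadow (v i) (W i)"
        by (intro add_mono IH(3) mult_left_mono ws) simp
      also have "\<dots> \<le> emeasure lborel (W (Suc i))"
        unfolding WS by (rule emeasure_segment_sum_ge[OF v[OF i] IH(1) tc])
      finally have 3: "emeasure lborel (cball (0::real ^ 'n) r) + ennreal (2 * t * (\<Sum>j<Suc i. c j)) * ennreal w \<le> emeasure lborel (W (Suc i))" .
      have 4: "x \<bullet> e \<le> r * norm e + t * (\<Sum>j<Suc i. c j * \<bar>v j \<bullet> e\<bar>)" if x: "x \<in> W (Suc i)" for x e
      proof -
        obtain y b where y: "y \<in> W i" "x = y + b *\<^sub>R v i" and b: "b \<in> {- (t * c i)..t * c i}"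
          using x unfolding WS minkowski_sum_def by blast
        have b: "\<bar>b\<bar> \<le> t * c i" using b by auto
        have "b * (v i \<bullet> e) \<le> \<bar>b\<bar> * \<bar>v i \<bullet> e\<bar>" by (metis abs_ge_self abs_mult)
        also have "\<dots> \<le> (t * c i) * \<bar>v i \<bullet> e\<bar>" by (intro mult_right_mono b) simp
        finally have "x \<bullet> e \<le> y \<bullet> e + t * (c i * \<bar>v i \<bullet> e\<bar>)" by (simp add: y(2) inner_add_left mult.assoc)
        then show ?thesis using IH(4)[OF y(1), of e] by (simp add: distrib_left)
      qed
      show ?case using 1 2 3 4 by blast
    qed
    have sub: "W N \<subseteq> cball 0 (r + t * R)"
    proof
      fix x assume x: "x \<in> W N"
      have "x \<bullet> x \<le> r * norm x + t * (\<Sum>j<N. c j * \<bar>v j \<bullet> x\<bar>)" using W[of N] x by blast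
      also have "\<dots> \<le> r * norm x + t * (R * norm x)" using width[of x] t by (intro add_left_mono mult_left_mono) auto
      finally have "norm x * norm x \<le> (r + t * R) * norm x" by (simp add: dot_square_norm power2_eq_square algebra_simps)
      moreover have "0 \<le> r + t * R" using r t R by simp
      ultimately have "norm x \<le> r + t * R" by (cases "x = 0") auto
      then show "x \<in> cball 0 (r + t * R)" by simp
    qed
    have "emeasure lborel (cball (0::real ^ 'n) r) + ennreal (2 * t) * ennreal w \<le> emeasure lborel (W N)"
      using W[of N] c1 by simp
    also have "\<dots> \<le> emeasure lborel (cball (0::real ^ 'n) (r + t * R))" by (rule emeasure_mono[OF sub]) simp
    finally have "ennreal (r ^ ?n * B) + ennreal (2 * t) * ennreal w \<le> ennreal ((r + t * R) ^ ?n * B)"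
      using r t R by (simp add: emeasure_lborel_eq_measure measure_cball_scale[of r] measure_cball_scale[of "r + t * R"] B_def)
    then have "ennreal (r ^ ?n * B + 2 * t * w) \<le> ennreal ((r + t * R) ^ ?n * B)"
      using r t B0 w by (simp add: ennreal_mult)
    then have "r ^ ?n * B + 2 * t * w \<le> (r + t * R) ^ ?n * B"
      using r t R B0 by (subst (asm) ennreal_le_iff) auto
    then have "t * (2 * w) \<le> ((r + t * R) ^ ?n - r ^ ?n) * B" by (simp add: algebra_simps)
    also have "\<dots> \<le> (real ?n * (r + t * R - r) * (r + t * R) ^ (?n - 1)) * B"
      using r t R B0 by (intro mult_right_mono power_diff_le_linear) auto
    also have "\<dots> = t * (real ?n * R * B * (r + t * R) ^ (?n - 1))" by (simp add: mult_ac)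
    finally show ?thesis using t by simp
  qed
  have "(\<lambda>k. real ?n * R * B * (r + (1 / real (k + 1)) * R) ^ (?n - 1)) \<longlonglongrightarrow> real ?n * R * B * (r + 0 * R) ^ (?n - 1)"
    by (intro tendsto_intros LIMSEQ_ignore_initial_segment[OF lim_1_over_n])
  then have "2 * w \<le> real ?n * R * B * (r + 0 * R) ^ (?n - 1)"
    by (rule LIMSEQ_le_const) (intro exI[of _ 0] allI impI step, simp)
  then have "ennreal (2 * w) \<le> ennreal (real ?n * R * B * r ^ (?n - 1))" by (intro ennreal_leI) simp
  then show ?thesis using w by (simp add: B_def ennreal_mult)
qed

section \<open>Averages over directions\<close>

text \<open>For \<open>x\<close> uniform in this shell, \<open>sgn x\<close> is a uniformly
  distributed unit vector, so averages over the sphere can be written as integrals with respect to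
  \<open>lborel\<close>. Keeping away from 0 makes \<open>sgn\<close> uniformly continuous.\<close>

definition annulus :: "'a::real_normed_vector set" where
  "annulus = {x. 1 \<le> norm x \<and> norm x \<le> 2}"

text \<open>The mean of \<open>\<bar>v \<bullet> e\<bar>\<close> over unit vectors \<open>v\<close>,
  which is the mean width of the segment from 0 to \<open>e\<close>.\<close>

definition mean_width :: "'a::euclidean_space \<Rightarrow> real" where
  "mean_width e = (\<integral>x. indicator annulus x * \<bar>sgn x \<bullet> e\<bar> \<partial>lborel) / measure lborel (annulus :: 'a set)"

lemma compact_annulus: "compact (annulus :: 'a::euclidean_space set)"
proof -
  have "(annulus :: 'a set) = cball 0 2 \<inter> - ball 0 1" by (auto simp: annulus_def)
  moreover have "compact (cball 0 2 \<inter> - ball (0::'a) 1)"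
    by (intro compact_Int_closed compact_cball closed_Compl open_ball)
  ultimately show ?thesis by metis
qed

lemma measure_annulus_pos: "0 < measure lborel (annulus :: 'a::euclidean_space set)"
proof -
  obtain b :: 'a where b: "b \<in> Basis" using nonempty_Basis by blast
  have "ball ((3/2) *\<^sub>R b) (1/2) \<subseteq> annulus"
  proof
    fix x assume "x \<in> ball ((3/2) *\<^sub>R b) (1/2)"
    then have d: "norm ((3/2) *\<^sub>R b - x) < 1/2" by (simp add: dist_norm)
    have "norm ((3/2) *\<^sub>R b) = 3/2" using b by simp
    then show "x \<in> annulus"
      using d norm_triangle_ineq2[of "(3/2) *\<^sub>R b" x] norm_triangle_ineq2[of x "(3/2) *\<^sub>R b"]
      by (simp add: annulus_def norm_minus_commute)
  qed
  then have "measure lborel (ball ((3/2) *\<^sub>R b) (1/2)) \<le> measure lborel (annulus :: 'a set)"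
    using emeasure_lborel_bounded[OF compact_imp_bounded[OF compact_annulus]]
    by (intro measure_mono_fmeasurable) (auto simp: fmeasurable_def borel_compact compact_annulus)
  then show ?thesis using content_ball_pos[of "1/2" "(3/2) *\<^sub>R b"] by linarith
qed

lemma continuous_on_sgn_annulus: "continuous_on annulus (sgn :: 'a::euclidean_space \<Rightarrow> 'a)"
  unfolding sgn_div_norm by (intro continuous_intros) (auto simp: annulus_def)

lemma sgn_orthogonal:
  assumes "orthogonal_transformation g"
  shows "sgn (g x) = g (sgn x)"
  using assms orthogonal_transformation_norm[OF assms, of x]
  by (simp add: sgn_div_norm orthogonal_transformation_def linear_scale)

lemma borel_annulus [measurable]: "(annulus :: 'a::euclidean_space set) \<in> sets borel"
  by (rule borel_compact[OF compact_annulus])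

lemma annulus_finite: "emeasure lborel (annulus :: 'a::euclidean_space set) < top"
  by (rule emeasure_lborel_bounded[OF compact_imp_bounded[OF compact_annulus]])

lemma mean_width_orthogonal:
  fixes g :: "'a::euclidean_space \<Rightarrow> 'a"
  assumes g: "orthogonal_transformation g"
  shows "mean_width (g e) = mean_width e"
proof -
  have [measurable]: "g \<in> borel_measurable borel" by (rule orthogonal_transformation_borel_measurable[OF g])
  have "(\<integral>x. indicator annulus x * \<bar>sgn x \<bullet> g e\<bar> \<partial>lborel) = (\<integral>x. indicator annulus x * \<bar>sgn x \<bullet> g e\<bar> \<partial>distr lborel borel g)"
    by (simp only: lborel_distr_orthogonal[OF g])
  also have "\<dots> = (\<integral>x. indicator annulus (g x) * \<bar>sgn (g x) \<bullet> g e\<bar> \<partial>lborel)"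
    by (subst integral_distr) auto
  also have "\<dots> = (\<integral>x. indicator annulus x * \<bar>sgn x \<bullet> e\<bar> \<partial>lborel)"
    using g orthogonal_transformation_norm[OF g]
    by (intro Bochner_Integration.integral_cong)
      (auto simp: indicator_def annulus_def sgn_orthogonal[OF g] orthogonal_transformation_def)
  finally show ?thesis by (simp add: mean_width_def)
qed

lemma mean_width_nonneg: "0 \<le> mean_width e"
  unfolding mean_width_def by (intro divide_nonneg_nonneg integral_nonneg_AE) auto

text \<open>Orthogonal maps act transitively on unit vectors, so only the length of \<open>e\<close>
  matters. The value at a unit vector is the constant of the isotropic case.\<close>

lemma mean_width_eq:
  fixes e u :: "real ^ 'n"
  assumes u: "norm u = 1"
  shows "mean_width e = mean_width u * norm e"
proof (cases "e = 0")
  case False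
  have n1: "norm (sgn e) = 1" using False by (simp add: norm_sgn)
  obtain g :: "real ^ 'n \<Rightarrow> real ^ 'n" where g: "orthogonal_transformation g" "g u = sgn e"
    by (rule orthogonal_transformation_exists_1[OF u n1])
  have "e = norm e *\<^sub>R sgn e" using False by (simp add: sgn_div_norm)
  then have "\<bar>sgn x \<bullet> e\<bar> = norm e * \<bar>sgn x \<bullet> sgn e\<bar>" for x
    by (metis abs_mult abs_norm_cancel inner_scaleR_right)
  then have "mean_width e = norm e * mean_width (sgn e)"
    unfolding mean_width_def by (simp add: mult.left_commute)
  then show ?thesis using mean_width_orthogonal[OF g(1), of u] g(2) by simp
qed (simp add: mean_width_def)

lemma integrable_annulus_width:
  "integrable lborel (\<lambda>x::'a::euclidean_space. indicator annulus x * \<bar>sgn x \<bullet> e\<bar>)"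
proof (rule Bochner_Integration.integrable_bound[of _ "\<lambda>x. indicator annulus x * norm e"])
  show "integrable lborel (\<lambda>x::'a. indicator annulus x * norm e)"
    using annulus_finite by (intro integrable_mult_left integrable_real_indicator) auto
  show "AE x in lborel. norm (indicator annulus x * \<bar>sgn x \<bullet> e\<bar>) \<le> norm (indicator annulus x * norm e)"
  proof (rule AE_I2)
    fix x :: 'a
    have "norm (sgn x) \<le> 1" by (simp add: norm_sgn)
    then have "\<bar>sgn x \<bullet> e\<bar> \<le> norm e"
      using Cauchy_Schwarz_ineq2[of "sgn x" e] mult_right_mono[of "norm (sgn x)" 1 "norm e"] by simp
    then show "norm (indicator annulus x * \<bar>sgn x \<bullet> e\<bar>) \<le> norm (indicator annulus x * norm e)"
      by (simp add: indicator_def)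
  qed
qed measurable

text \<open>A function cannot exceed its average everywhere. The average is multiplied by the
  measure of \<open>P\<close>, so that null sets and infinite values are covered.\<close>

lemma exists_below_average:
  assumes [measurable]: "P \<in> sets M" "h \<in> borel_measurable M" and fin: "emeasure M P < top" and ne: "P \<noteq> {}"
  shows "\<exists>x\<in>P. h x * emeasure M P \<le> (\<integral>\<^sup>+ x. h x * indicator P x \<partial>M)"
proof (rule ccontr)
  assume "\<not> ?thesis"
  then have less: "(\<integral>\<^sup>+ x. h x * indicator P x \<partial>M) < h x * emeasure M P" if "x \<in> P" for x
    using that by (auto simp: not_le)
  define I where "I = (\<integral>\<^sup>+ x. h x * indicator P x \<partial>M)"
  obtain x0 where x0: "x0 \<in> P" using ne by blast
  have p0: "emeasure M P \<noteq> 0" using less[OF x0] by auto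
  have Ifin: "I < top" using less[OF x0] unfolding I_def by (rule order.strict_trans2) simp
  define b where "b = I / emeasure M P"
  have hb: "b < h x" if "x \<in> P" for x
  proof -
    have "I < h x * emeasure M P" using less[OF that] by (simp add: I_def)
    then show ?thesis unfolding b_def using p0 fin by (simp add: divide_less_ennreal less_top)
  qed
  have bI: "(\<integral>\<^sup>+ x. b * indicator P x \<partial>M) = I"
  proof -
    have "(\<integral>\<^sup>+ x. b * indicator P x \<partial>M) = b * emeasure M P" by (rule nn_integral_cmult_indicator) simp
    also have "\<dots> = I" unfolding b_def using p0 fin by (simp add: ennreal_divide_times ennreal_divide_self)
    finally show ?thesis .
  qed
  have "(\<integral>\<^sup>+ x. b * indicator P x \<partial>M) < (\<integral>\<^sup>+ x. h x * indicator P x \<partial>M)"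
  proof (rule nn_integral_less)
    show "(\<integral>\<^sup>+ x. b * indicator P x \<partial>M) \<noteq> \<infinity>" using bI Ifin by simp
    show "AE x in M. b * indicator P x \<le> h x * indicator P x"
      using hb by (intro AE_I2) (auto simp: indicator_def intro: less_imp_le)
    show "\<not> (AE x in M. h x * indicator P x \<le> b * indicator P x)"
    proof
      assume "AE x in M. h x * indicator P x \<le> b * indicator P x"
      then have "AE x in M. x \<notin> P"
        by eventually_elim (use hb in \<open>force simp: indicator_def\<close>)
      then have "emeasure M P = 0" by (subst (asm) AE_iff_measurable[of P]) (use sets.sets_into_space[OF assms(1)] in auto)
      then show False using p0 by simp
    qed
  qed auto
  then show False using bI by (simp add: I_def)
qed

text \<open>The annulus is cut into small pieces with one sample point in each. For the mean width
  every point of a piece will do, by uniform continuity of \<open>sgn\<close>. For \<open>h\<close>,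
  which is merely measurable, the point is taken where \<open>h\<close> is at most its average over
  the piece; the resulting one-sided bound is the one wanted, since the mean shadow is to be bounded
  from below by a sampled sum.\<close>

lemma direction_sampling:
  fixes h :: "'a::euclidean_space \<Rightarrow> ennreal"
  assumes h [measurable]: "h \<in> borel_measurable borel" and eps: "0 < \<epsilon>"
  obtains N :: nat and v :: "nat \<Rightarrow> 'a" and c :: "nat \<Rightarrow> real" where
    "\<And>j. j < N \<Longrightarrow> norm (v j) = 1" "\<And>j. j < N \<Longrightarrow> 0 \<le> c j" "(\<Sum>j<N. c j) = 1"
    "\<And>e. \<bar>(\<Sum>j<N. c j * \<bar>v j \<bullet> e\<bar>) - mean_width e\<bar> \<le> \<epsilon> * norm e"
    "(\<Sum>j<N. ennreal (c j) * h (v j)) * emeasure lborel (annulus :: 'a set) \<le> (\<integral>\<^sup>+ x. h (sgn x) * indicator annulus x \<partial>lborel)"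
proof -
  let ?A = "annulus :: 'a set"
  define V where "V = measure lborel ?A"
  have V: "0 < V" unfolding V_def by (rule measure_annulus_pos)
  have eV: "emeasure lborel ?A = ennreal V" unfolding V_def by (rule emeasure_lborel_eq_measure[OF compact_imp_bounded[OF compact_annulus]])
  obtain d where d: "0 < d" "\<And>x y. x \<in> ?A \<Longrightarrow> y \<in> ?A \<Longrightarrow> dist y x < d \<Longrightarrow> dist (sgn y) (sgn x) < \<epsilon>"
    using compact_uniformly_continuous[OF continuous_on_sgn_annulus compact_annulus] eps
    unfolding uniformly_continuous_on_def by metis
  obtain Y where Y: "Y \<subseteq> ?A" "finite Y" "?A \<subseteq> (\<Union>y\<in>Y. ball y (d / 2))"
  proof (rule compactE_image[OF compact_annulus, of ?A "\<lambda>y. ball y (d / 2)"])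
    show "?A \<subseteq> (\<Union>y\<in>?A. ball y (d / 2))" using d(1) by force
  qed auto
  obtain y :: "nat \<Rightarrow> 'a" and N where y: "Y = y ` {..<N}" using Y(2) by (metis finite_imp_nat_seg_image_inj_on lessThan_def)
  \<comment> \<open>Balls of radius \<open>d / 2\<close> made disjoint, so that two points of the
    same piece are less than \<open>d\<close> apart.\<close>
  define P where "P j = (?A \<inter> ball (y j) (d / 2)) - (\<Union>i<j. ball (y i) (d / 2))" for j
  have Pm [measurable]: "P j \<in> sets borel" for j unfolding P_def by measurable
  have PA: "P j \<subseteq> ?A" for j by (auto simp: P_def)
  have Pdisj: "P i \<inter> P j = {}" if "i \<noteq> j" for i j
    using that by (cases i j rule: linorder_cases) (auto simp: P_def)
  have Pun: "(\<Union>j<N. P j) = ?A"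
  proof
    show "?A \<subseteq> (\<Union>j<N. P j)"
    proof
      fix x assume x: "x \<in> ?A"
      then obtain p where "p \<in> Y" "x \<in> ball p (d / 2)" using Y(3) by blast
      then have ex: "\<exists>j. j < N \<and> x \<in> ball (y j) (d / 2)" unfolding y by blast
      define j where "j = (LEAST j. j < N \<and> x \<in> ball (y j) (d / 2))"
      have j: "j < N" "x \<in> ball (y j) (d / 2)" using LeastI_ex[OF ex] by (simp_all add: j_def)
      have "x \<notin> ball (y i) (d / 2)" if "i < j" for i
      proof -
        have "\<not> (i < N \<and> x \<in> ball (y i) (d / 2))"
          by (rule not_less_Least) (use that in \<open>simp only: j_def\<close>)
        then show ?thesis using that j(1) by (meson order.strict_trans)
      qed
      then have "x \<in> P j" using x j by (auto simp: P_def)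
      then show "x \<in> (\<Union>j<N. P j)" using j by blast
    qed
  qed (use PA in auto)
  have Pb: "bounded (P j)" for j using bounded_subset[OF compact_imp_bounded[OF compact_annulus] PA] .
  have Pfin: "emeasure lborel (P j) < top" for j by (rule emeasure_lborel_bounded[OF Pb])
  have Psmall: "dist x x' < d" if "x \<in> P j" "x' \<in> P j" for x x' j
  proof -
    have "dist (y j) x < d / 2" "dist (y j) x' < d / 2" using that by (auto simp: P_def)
    then show ?thesis using dist_triangle_half_r by blast
  qed
  \<comment> \<open>An empty piece gets weight 0, but its sample point must still lie in the annulus
    for \<open>v j\<close> to be a unit vector.\<close>
  have "\<exists>x. x \<in> ?A \<and> (P j \<noteq> {} \<longrightarrow> x \<in> P j \<and> h (sgn x) * emeasure lborel (P j) \<le> (\<integral>\<^sup>+ x. h (sgn x) * indicator (P j) x \<partial>lborel))" for j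
  proof (cases "P j = {}")
    case True
    have "?A \<noteq> {}" using V by (auto simp: V_def)
    then show ?thesis using True by blast
  next
    case False
    have "\<exists>x\<in>P j. h (sgn x) * emeasure lborel (P j) \<le> (\<integral>\<^sup>+ x. h (sgn x) * indicator (P j) x \<partial>lborel)"
      by (rule exists_below_average) (use Pfin False in auto)
    then show ?thesis using PA by blast
  qed
  then obtain x where x: "\<And>j. x j \<in> ?A" "\<And>j. P j \<noteq> {} \<Longrightarrow> x j \<in> P j"
    "\<And>j. P j \<noteq> {} \<Longrightarrow> h (sgn (x j)) * emeasure lborel (P j) \<le> (\<integral>\<^sup>+ x. h (sgn x) * indicator (P j) x \<partial>lborel)"
    by metis
  define v where "v j = sgn (x j)" for j
  define c where "c j = measure lborel (P j) / V" for j
  \<comment> \<open>The value type is left general because the identity serves both for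
    \<open>real\<close> and for \<open>ennreal\<close>.\<close>
  have ind: "(\<Sum>j<N. indicator (P j) z) = (indicator ?A z :: 'b::{comm_monoid_add, zero_neq_one})" for z
  proof (cases "z \<in> ?A")
    case True
    then obtain j where j: "j < N" "z \<in> P j" using Pun by blast
    have "(\<Sum>i<N. indicator (P i) z) = (\<Sum>i<N. if i = j then 1 else (0::'b))"
      using j Pdisj by (intro sum.cong) (auto simp: indicator_def)
    then show ?thesis using j True by simp
  next
    case False
    then have "z \<notin> P j" for j using PA by blast
    then show ?thesis using False by simp
  qed
  have mP: "(\<integral>z. indicator (P j) z * a \<partial>lborel) = measure lborel (P j) * a" for j and a :: real
    by simp
  have intP: "integrable lborel (\<lambda>z. indicator (P j) z * a :: real)" for j a
    using Pfin by (intro integrable_mult_left integrable_real_indicator) auto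
  have intPw: "integrable lborel (\<lambda>z. indicator (P j) z * \<bar>sgn z \<bullet> e\<bar>)" for j e
    by (rule Bochner_Integration.integrable_bound[OF integrable_annulus_width[of e]])
      (use PA in \<open>auto simp: indicator_def\<close>)
  have sumP: "(\<Sum>j<N. measure lborel (P j)) = V"
  proof -
    have "V = (\<integral>z. indicator ?A z * 1 \<partial>lborel)" by (simp add: V_def)
    also have "\<dots> = (\<integral>z. (\<Sum>j<N. indicator (P j) z * 1) \<partial>lborel)" by (simp only: ind mult_1_right)
    also have "\<dots> = (\<Sum>j<N. measure lborel (P j))"
      by (subst Bochner_Integration.integral_sum[OF intP]) simp
    finally show ?thesis by simp
  qed
  show thesis
  proof
    show "norm (v j) = 1" for j using x(1)[of j] by (auto simp: v_def norm_sgn annulus_def)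
    show "0 \<le> c j" for j using V by (simp add: c_def)
    show "(\<Sum>j<N. c j) = 1" using V by (simp add: c_def sum_divide_distrib[symmetric] sumP)
    show "\<bar>(\<Sum>j<N. c j * \<bar>v j \<bullet> e\<bar>) - mean_width e\<bar> \<le> \<epsilon> * norm e" for e
    proof -
      have "(\<integral>z. indicator ?A z * \<bar>sgn z \<bullet> e\<bar> \<partial>lborel) = (\<integral>z. (\<Sum>j<N. indicator (P j) z * \<bar>sgn z \<bullet> e\<bar>) \<partial>lborel)"
        by (simp only: ind sum_distrib_right[symmetric])
      also have "\<dots> = (\<Sum>j<N. \<integral>z. indicator (P j) z * \<bar>sgn z \<bullet> e\<bar> \<partial>lborel)"
        by (rule Bochner_Integration.integral_sum[OF intPw])
      finally have mw: "mean_width e * V = (\<Sum>j<N. \<integral>z. indicator (P j) z * \<bar>sgn z \<bullet> e\<bar> \<partial>lborel)"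
        using V by (simp add: mean_width_def V_def)
      have "\<bar>measure lborel (P j) * \<bar>v j \<bullet> e\<bar> - (\<integral>z. indicator (P j) z * \<bar>sgn z \<bullet> e\<bar> \<partial>lborel)\<bar> \<le> measure lborel (P j) * (\<epsilon> * norm e)" for j
      proof -
        have "measure lborel (P j) * \<bar>v j \<bullet> e\<bar> - (\<integral>z. indicator (P j) z * \<bar>sgn z \<bullet> e\<bar> \<partial>lborel)
          = (\<integral>z. indicator (P j) z * \<bar>v j \<bullet> e\<bar> - indicator (P j) z * \<bar>sgn z \<bullet> e\<bar> \<partial>lborel)"
          by (simp only: Bochner_Integration.integral_diff[OF intP intPw] mP)
        also have "\<bar>\<dots>\<bar> \<le> (\<integral>z. indicator (P j) z * (\<epsilon> * norm e) \<partial>lborel)"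
        proof (rule order_trans[OF integral_abs_bound integral_mono])
          show "integrable lborel (\<lambda>z. \<bar>indicator (P j) z * \<bar>v j \<bullet> e\<bar> - indicator (P j) z * \<bar>sgn z \<bullet> e\<bar>\<bar>)"
            by (intro integrable_abs Bochner_Integration.integrable_diff intP intPw)
          show "integrable lborel (\<lambda>z. indicator (P j) z * (\<epsilon> * norm e))" by (rule intP)
          fix z
          have "\<bar>\<bar>v j \<bullet> e\<bar> - \<bar>sgn z \<bullet> e\<bar>\<bar> \<le> \<epsilon> * norm e" if z: "z \<in> P j"
          proof -
            have "x j \<in> P j" using x(2) z by blast
            then have "dist (v j) (sgn z) < \<epsilon>" unfolding v_def using d(2)[of z "x j"] Psmall[of "x j" j z] z PA by blast
            then have "norm (v j - sgn z) \<le> \<epsilon>" by (simp add: dist_norm)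
            have "\<bar>\<bar>v j \<bullet> e\<bar> - \<bar>sgn z \<bullet> e\<bar>\<bar> \<le> \<bar>(v j - sgn z) \<bullet> e\<bar>" by (simp add: inner_diff_left abs_triangle_ineq3)
            also have "\<dots> \<le> norm (v j - sgn z) * norm e" by (rule Cauchy_Schwarz_ineq2)
            also have "\<dots> \<le> \<epsilon> * norm e" using \<open>norm (v j - sgn z) \<le> \<epsilon>\<close> by (intro mult_right_mono) auto
            finally show ?thesis .
          qed
          then show "\<bar>indicator (P j) z * \<bar>v j \<bullet> e\<bar> - indicator (P j) z * \<bar>sgn z \<bullet> e\<bar>\<bar> \<le> indicator (P j) z * (\<epsilon> * norm e)"
            by (simp add: indicator_def)
        qed
        finally show ?thesis by (simp only: mP)
      qed
      then have "\<bar>\<Sum>j<N. measure lborel (P j) * \<bar>v j \<bullet> e\<bar> - (\<integral>z. indicator (P j) z * \<bar>sgn z \<bullet> e\<bar> \<partial>lborel)\<bar> \<le> (\<Sum>j<N. measure lborel (P j) * (\<epsilon> * norm e))"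
        by (intro order_trans[OF sum_abs] sum_mono)
      also have "\<dots> = V * (\<epsilon> * norm e)" by (simp only: sum_distrib_right[symmetric] sumP)
      finally have "\<bar>(\<Sum>j<N. measure lborel (P j) * \<bar>v j \<bullet> e\<bar>) - mean_width e * V\<bar> \<le> V * (\<epsilon> * norm e)"
        by (simp only: sum_subtractf mw)
      moreover have "(\<Sum>j<N. measure lborel (P j) * \<bar>v j \<bullet> e\<bar>) - mean_width e * V = V * ((\<Sum>j<N. c j * \<bar>v j \<bullet> e\<bar>) - mean_width e)"
        using V by (simp add: c_def right_diff_distrib sum_distrib_left mult.commute)
      ultimately show ?thesis using V by (simp add: abs_mult)
    qed
    have "(\<Sum>j<N. ennreal (c j) * h (v j)) * emeasure lborel ?A = (\<Sum>j<N. h (v j) * emeasure lborel (P j))"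
      unfolding sum_distrib_right
    proof (rule sum.cong[OF refl])
      fix j
      have "ennreal (c j) * ennreal V = emeasure lborel (P j)"
        using V by (simp add: c_def emeasure_lborel_eq_measure[OF Pb] ennreal_mult[symmetric])
      then have "h (v j) * emeasure lborel (P j) = h (v j) * (ennreal (c j) * ennreal V)" by simp
      then show "ennreal (c j) * h (v j) * emeasure lborel ?A = h (v j) * emeasure lborel (P j)"
        by (simp only: eV mult_ac)
    qed
    also have "\<dots> \<le> (\<Sum>j<N. \<integral>\<^sup>+ z. h (sgn z) * indicator (P j) z \<partial>lborel)"
    proof (rule sum_mono)
      fix j
      show "h (v j) * emeasure lborel (P j) \<le> (\<integral>\<^sup>+ z. h (sgn z) * indicator (P j) z \<partial>lborel)"
        using x(3)[of j] by (cases "P j = {}") (auto simp: v_def)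
    qed
    also have "\<dots> = (\<integral>\<^sup>+ z. (\<Sum>j<N. h (sgn z) * indicator (P j) z) \<partial>lborel)"
      by (rule nn_integral_sum[symmetric]) measurable
    also have "\<dots> = (\<integral>\<^sup>+ z. h (sgn z) * indicator ?A z \<partial>lborel)"
      by (simp only: sum_distrib_left[symmetric] ind)
    finally show "(\<Sum>j<N. ennreal (c j) * h (v j)) * emeasure lborel ?A \<le> (\<integral>\<^sup>+ z. h (sgn z) * indicator ?A z \<partial>lborel)" .
  qed
qed

section \<open>The invariant measure on hyperplanes\<close>

lemma orth_proj_hyperplane:
  assumes u: "norm u = 1"
  shows "orth_proj {x. u \<bullet> x = 0} = hyperplane_proj (u :: 'a::euclidean_space)"
proof
  fix x
  show "orth_proj {x. u \<bullet> x = 0} x = hyperplane_proj u x"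
    unfolding orth_proj_def
  proof (rule the_equality)
    show "hyperplane_proj u x \<in> {x. u \<bullet> x = 0} \<and> (\<forall>w\<in>{x. u \<bullet> x = 0}. orthogonal (x - hyperplane_proj u x) w)"
      using inner_hyperplane_proj[OF u] by (simp add: hyperplane_proj_def orthogonal_def)
    fix y assume y: "y \<in> {x. u \<bullet> x = 0} \<and> (\<forall>w\<in>{x. u \<bullet> x = 0}. orthogonal (x - y) w)"
    let ?d = "hyperplane_proj u x - y"
    have d: "u \<bullet> ?d = 0" using y inner_hyperplane_proj[OF u] by (simp add: inner_diff_right)
    then have "(x - y) \<bullet> ?d = 0" using y by (simp add: orthogonal_def)
    moreover have "(x - hyperplane_proj u x) \<bullet> ?d = 0" using d by (simp add: hyperplane_proj_def)
    moreover have "?d = (x - y) - (x - hyperplane_proj u x)" by simp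
    ultimately have "?d \<bullet> ?d = 0" by (metis diff_zero inner_diff_left)
    then show "y = hyperplane_proj u x" by simp
  qed
qed

lemma grassmannian_hyperplane:
  fixes V :: "(real ^ 'n) set"
  shows "V \<in> grassmannian (CARD('n) - 1) \<longleftrightarrow> (\<exists>u. norm u = 1 \<and> V = {x. u \<bullet> x = 0})"
proof
  assume "V \<in> grassmannian (CARD('n) - 1)"
  then have V: "subspace V" "dim V = DIM(real ^ 'n) - 1" by (auto simp: grassmannian_def)
  obtain a where a: "a \<noteq> 0" "span V = {x. a \<bullet> x = 0}" by (rule lowdim_eq_hyperplane[OF V(2)])
  then have "V = {x. sgn a \<bullet> x = 0}" using span_eq_iff[of V] V(1) by (auto simp: sgn_div_norm)
  then show "\<exists>u. norm u = 1 \<and> V = {x. u \<bullet> x = 0}" using a(1) by (intro exI[of _ "sgn a"]) (simp add: norm_sgn)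
next
  assume "\<exists>u. norm u = 1 \<and> V = {x. u \<bullet> x = 0}"
  then obtain u where u: "norm u = 1" "V = {x. u \<bullet> x = 0}" by blast
  then have "u \<noteq> 0" by auto
  then show "V \<in> grassmannian (CARD('n) - 1)"
    using dim_hyperplane[of u] by (simp add: grassmannian_def u(2) subspace_hyperplane)
qed

abbreviation proj_matrix :: "(real ^ 'n) set \<Rightarrow> real ^ 'n ^ 'n" where
  "proj_matrix V \<equiv> matrix (orth_proj V)"

lemma matrix_hyperplane_proj:
  fixes u :: "real ^ 'n"
  shows "matrix (hyperplane_proj u) = (\<chi> i j. (if i = j then 1 else 0) - u $ i * u $ j)"
  by (simp add: matrix_def hyperplane_proj_def vec_eq_iff inner_axis) (auto simp: axis_def)

lemma matrix_hyperplane_proj_mult: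
  fixes u :: "real ^ 'n"
  shows "matrix (hyperplane_proj u) *v x = hyperplane_proj u x"
proof -
  have "(\<Sum>j\<in>UNIV. ((if i = j then 1 else 0) - u $ i * u $ j) * x $ j)
    = (\<Sum>j\<in>UNIV. (if i = j then x $ j else 0) - u $ i * (u $ j * x $ j))" for i
    by (intro sum.cong refl) (auto simp: algebra_simps)
  also have "\<dots> i = x $ i - (x \<bullet> u) * u $ i" for i
    by (simp add: sum_subtractf sum_distrib_left[symmetric] inner_vec_def mult.commute)
  finally show ?thesis
    by (simp add: matrix_vector_mult_def matrix_hyperplane_proj hyperplane_proj_def vec_eq_iff inner_commute)
qed

lemma continuous_on_matrix_hyperplane_proj: "continuous_on S (\<lambda>u :: real ^ 'n. matrix (hyperplane_proj u))"
  unfolding matrix_hyperplane_proj by (intro continuous_intros)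

text \<open>The distance is the Frobenius distance. Since it depends on \<open>u \<bullet> w\<close>
  only, orthogonal maps act isometrically on the projection matrices, and proximity of hyperplanes
  can be measured through their normals.\<close>

lemma dist_matrix_hyperplane_proj:
  fixes u w :: "real ^ 'n"
  assumes "norm u = 1" "norm w = 1"
  shows "(dist (matrix (hyperplane_proj u)) (matrix (hyperplane_proj w)))\<^sup>2 = 2 - 2 * (u \<bullet> w)\<^sup>2"
proof -
  have uu: "(\<Sum>i\<in>UNIV. u $ i * u $ i) = 1" and ww: "(\<Sum>i\<in>UNIV. w $ i * w $ i) = 1"
    using assms by (simp_all add: norm_eq_1 inner_vec_def)
  have pr: "(\<Sum>i\<in>UNIV. \<Sum>j\<in>UNIV. (a i * a' i) * (b j * b' j)) = (\<Sum>i\<in>UNIV. a i * a' i) * (\<Sum>j\<in>UNIV. b j * b' j)"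
    for a a' b b' :: "'n \<Rightarrow> real"
    by (simp add: sum_product)
  have "(dist (matrix (hyperplane_proj u)) (matrix (hyperplane_proj w)))\<^sup>2
    = (\<Sum>i\<in>UNIV. \<Sum>j\<in>UNIV. (w $ i * w $ j - u $ i * u $ j) * (w $ i * w $ j - u $ i * u $ j))"
    by (simp add: dist_norm power2_norm_eq_inner inner_vec_def matrix_hyperplane_proj)
  also have "\<dots> = (\<Sum>i\<in>UNIV. \<Sum>j\<in>UNIV. (w $ i * w $ i) * (w $ j * w $ j) - ((2 * u $ i) * w $ i) * (u $ j * w $ j) + (u $ i * u $ i) * (u $ j * u $ j))"
    by (intro sum.cong refl) (simp add: algebra_simps)
  also have "\<dots> = 2 - 2 * (u \<bullet> w)\<^sup>2"
    by (simp only: sum.distrib sum_subtractf pr uu ww)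
      (simp add: inner_vec_def power2_eq_square sum_distrib_left[symmetric] mult.assoc)
  finally show ?thesis .
qed

lemma proj_matrix_hyperplane:
  "norm (u :: real ^ 'n) = 1 \<Longrightarrow> proj_matrix {x. u \<bullet> x = 0} = matrix (hyperplane_proj u)"
  by (simp add: orth_proj_hyperplane)

lemma orthogonal_image_hyperplane:
  fixes g :: "'a::euclidean_space \<Rightarrow> 'a"
  assumes g: "orthogonal_transformation g"
  shows "g ` {x. u \<bullet> x = 0} = {x. g u \<bullet> x = 0}"
proof (rule set_eqI)
  fix x
  obtain y where y: "x = g y" using orthogonal_transformation_surj[OF g] by (metis surjD)
  show "x \<in> g ` {x. u \<bullet> x = 0} \<longleftrightarrow> x \<in> {x. g u \<bullet> x = 0}"
    unfolding y inj_image_mem_iff[OF orthogonal_transformation_inj[OF g]]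
    using g by (simp add: orthogonal_transformation_def)
qed

lemma orthogonal_image_grassmannian:
  fixes g :: "real ^ 'n \<Rightarrow> real ^ 'n" and V :: "(real ^ 'n) set"
  assumes g: "orthogonal_transformation g" and V: "V \<in> grassmannian (CARD('n) - 1)"
  shows "g ` V \<in> grassmannian (CARD('n) - 1)"
proof -
  obtain u where u: "norm u = 1" "V = {x. u \<bullet> x = 0}" using V unfolding grassmannian_hyperplane by blast
  then show ?thesis
    unfolding grassmannian_hyperplane using orthogonal_image_hyperplane[OF g] orthogonal_transformation_norm[OF g] by metis
qed

lemma dist_proj_matrix_orthogonal:
  fixes g :: "real ^ 'n \<Rightarrow> real ^ 'n" and V W :: "(real ^ 'n) set"
  assumes g: "orthogonal_transformation g" and "V \<in> grassmannian (CARD('n) - 1)" "W \<in> grassmannian (CARD('n) - 1)"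
  shows "dist (proj_matrix (g ` V)) (proj_matrix (g ` W)) = dist (proj_matrix V) (proj_matrix W)"
proof -
  obtain u w where u: "norm u = 1" "V = {x. u \<bullet> x = 0}" and w: "norm w = 1" "W = {x. w \<bullet> x = 0}"
    using assms unfolding grassmannian_hyperplane by blast
  have n: "norm (g u) = 1" "norm (g w) = 1" using u w orthogonal_transformation_norm[OF g] by simp_all
  have "g u \<bullet> g w = u \<bullet> w" using g by (simp add: orthogonal_transformation_def)
  then have "(dist (proj_matrix (g ` V)) (proj_matrix (g ` W)))\<^sup>2 = (dist (proj_matrix V) (proj_matrix W))\<^sup>2"
    using dist_matrix_hyperplane_proj[OF n] dist_matrix_hyperplane_proj[OF u(1) w(1)] n u w
    by (simp add: orthogonal_image_hyperplane[OF g] proj_matrix_hyperplane)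
  then show ?thesis by (rule power2_eq_imp_eq) simp_all
qed

lemma space_grassmann_borel: "space (grassmann_borel k) = grassmannian k"
  by (simp add: grassmann_borel_def)

lemma sets_grassmann_borel: "sets (grassmann_borel k) = {proj_matrix -` A \<inter> grassmannian k | A. A \<in> sets borel}"
  unfolding grassmann_borel_def by (rule sets_vimage_algebra2) simp

lemma proj_matrix_measurable: "proj_matrix \<in> borel_measurable (grassmann_borel k)"
  unfolding grassmann_borel_def by (rule measurable_vimage_algebra1) simp

text \<open>The law of the hyperplane orthogonal to a random direction. At 0, which is outside the
  annulus, \<open>sgn\<close> would give the whole space instead of a hyperplane; an arbitrary axis
  is substituted so that the map takes values in the Grassmannian everywhere.\<close>

definition grassmann_reference :: "(real ^ 'n) set measure" where
  "grassmann_reference = distr (uniform_measure lborel annulus) (grassmann_borel (CARD('n) - 1))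
     (\<lambda>x. {z. (if x = 0 then axis (SOME i. True) 1 else sgn x) \<bullet> z = 0})"

lemma hyperplane_map_measurable:
  "(\<lambda>x :: real ^ 'n. {z. (if x = 0 then axis (SOME i. True) 1 else sgn x) \<bullet> z = 0})
     \<in> measurable borel (grassmann_borel (CARD('n) - 1))" (is "?H \<in> _")
  unfolding grassmann_borel_def
proof (rule measurable_vimage_algebra2)
  let ?u = "\<lambda>x :: real ^ 'n. if x = 0 then axis (SOME i. True) 1 else sgn x"
  have n: "norm (?u x) = 1" for x by (simp add: norm_axis_1 norm_sgn)
  show "?H \<in> space borel \<rightarrow> grassmannian (CARD('n) - 1)"
  proof (rule Pi_I)
    fix x :: "real ^ 'n"
    show "?H x \<in> grassmannian (CARD('n) - 1)" unfolding grassmannian_hyperplane using n[of x] by blast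
  qed
  have "?u \<in> borel_measurable borel" by measurable
  moreover have "(\<lambda>u :: real ^ 'n. matrix (hyperplane_proj u)) \<in> borel_measurable borel"
    by (intro borel_measurable_continuous_onI continuous_on_matrix_hyperplane_proj)
  ultimately have "(\<lambda>x. matrix (hyperplane_proj (?u x))) \<in> borel_measurable borel"
    by (rule measurable_compose)
  then show "(\<lambda>x. proj_matrix (?H x)) \<in> borel_measurable borel"
    by (subst proj_matrix_hyperplane[OF n])
qed

lemma prob_space_uniform_annulus: "prob_space (uniform_measure lborel (annulus :: 'a::euclidean_space set))"
  using measure_annulus_pos[where 'a='a] annulus_finite[where 'a='a]
  by (intro prob_space_uniform_measure) (auto simp: measure_def less_top)

lemma nn_integral_grassmann_reference:
  fixes f :: "(real ^ 'n) set \<Rightarrow> ennreal"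
  assumes f: "f \<in> borel_measurable (grassmann_borel (CARD('n) - 1))"
  shows "(\<integral>\<^sup>+ V. f V \<partial>grassmann_reference)
    = (\<integral>\<^sup>+ x. f {z. sgn x \<bullet> z = 0} * indicator annulus x \<partial>lborel) / emeasure lborel (annulus :: (real ^ 'n) set)"
proof -
  let ?H = "\<lambda>x :: real ^ 'n. {z. (if x = 0 then axis (SOME i. True) 1 else sgn x) \<bullet> z = 0}"
  have H: "?H \<in> measurable lborel (grassmann_borel (CARD('n) - 1))" using hyperplane_map_measurable by simp
  have fH: "(\<lambda>x. f (?H x)) \<in> borel_measurable lborel" by (rule measurable_compose[OF H f])
  have "(\<integral>\<^sup>+ V. f V \<partial>grassmann_reference) = (\<integral>\<^sup>+ x. f (?H x) \<partial>uniform_measure lborel annulus)"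
    unfolding grassmann_reference_def using H f
    by (subst nn_integral_distr) (simp_all cong: measurable_cong_sets)
  also have "\<dots> = (\<integral>\<^sup>+ x. f (?H x) * indicator annulus x \<partial>lborel) / emeasure lborel (annulus :: (real ^ 'n) set)"
    by (rule nn_integral_uniform_measure[OF fH]) simp
  also have "(\<integral>\<^sup>+ x. f (?H x) * indicator annulus x \<partial>lborel) = (\<integral>\<^sup>+ x. f {z. sgn x \<bullet> z = 0} * indicator annulus x \<partial>lborel)"
    by (intro nn_integral_cong) (auto simp: indicator_def annulus_def)
  finally show ?thesis .
qed

text \<open>In terms of projection matrices, \<open>g\<close> acts by conjugation with
  \<open>matrix g\<close>, which is a continuous map of matrices.\<close>

lemma orthogonal_image_measurable:
  fixes g :: "real ^ 'n \<Rightarrow> real ^ 'n"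
  assumes g: "orthogonal_transformation g"
  shows "(\<lambda>V. g ` V) \<in> measurable (grassmann_borel (CARD('n) - 1)) (grassmann_borel (CARD('n) - 1))"
proof -
  let ?k = "CARD('n) - 1"
  have lin: "linear g" using g by (simp add: orthogonal_transformation_def)
  have eq: "proj_matrix (g ` V) = matrix g ** proj_matrix V ** transpose (matrix g)" if V: "V \<in> grassmannian ?k" for V
  proof -
    obtain u where u: "norm u = 1" "V = {x. u \<bullet> x = 0}" using V unfolding grassmannian_hyperplane by blast
    have gu: "norm (g u) = 1" using u orthogonal_transformation_norm[OF g] by simp
    have om: "orthogonal_matrix (matrix g)" using g orthogonal_transformation_matrix by blast
    have "proj_matrix (g ` V) *v x = (matrix g ** proj_matrix V ** transpose (matrix g)) *v x" for x
    proof -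
      obtain y where y: "x = g y" using orthogonal_transformation_surj[OF g] by (metis surjD)
      have "transpose (matrix g) *v x = y"
      proof -
        have "transpose (matrix g) *v (matrix g *v y) = y"
          using om by (simp add: matrix_vector_mul_assoc orthogonal_matrix)
        then show ?thesis by (simp add: y matrix_works lin)
      qed
      then have "(matrix g ** proj_matrix V ** transpose (matrix g)) *v x = g (hyperplane_proj u y)"
        by (simp add: matrix_vector_mul_assoc[symmetric] u proj_matrix_hyperplane matrix_hyperplane_proj_mult matrix_works lin)
      also have "\<dots> = proj_matrix (g ` V) *v x"
        by (simp add: u(2) orthogonal_image_hyperplane[OF g] proj_matrix_hyperplane[OF gu] matrix_hyperplane_proj_mult y hyperplane_proj_orthogonal[OF g])
      finally show ?thesis by simp
    qed
    then show ?thesis by (simp add: matrix_eq)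
  qed
  have "(\<lambda>P :: real ^ 'n ^ 'n. matrix g ** P ** transpose (matrix g)) \<in> borel_measurable borel"
    unfolding matrix_matrix_mult_def by (intro borel_measurable_continuous_onI continuous_intros)
  from measurable_compose[OF proj_matrix_measurable this]
  have "(\<lambda>V. matrix g ** proj_matrix V ** transpose (matrix g)) \<in> borel_measurable (grassmann_borel ?k)" .
  then have "(\<lambda>V. proj_matrix (g ` V)) \<in> borel_measurable (grassmann_borel ?k)"
    by (rule measurable_cong[THEN iffD1, rotated]) (simp add: eq space_grassmann_borel)
  then show ?thesis
    unfolding grassmann_borel_def[of ?k, where 'n='n]
    by (intro measurable_vimage_algebra2) (auto simp: orthogonal_image_grassmannian[OF g, simplified] grassmann_borel_def)
qed

text \<open>Orthogonal maps preserve \<open>lborel\<close>, preserve the annulus and commute with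
  \<open>sgn\<close>, so the law of the random hyperplane inherits the invariance.\<close>

lemma invariant_grassmann_reference:
  "invariant_grassmann_prob (CARD('n) - 1) (grassmann_reference :: (real ^ 'n) set measure)"
  unfolding invariant_grassmann_prob_def
proof (intro conjI allI impI)
  let ?k = "CARD('n) - 1"
  let ?S = "grassmann_reference :: (real ^ 'n) set measure"
  let ?H = "\<lambda>x :: real ^ 'n. {z. (if x = 0 then axis (SOME i. True) 1 else sgn x) \<bullet> z = 0}"
  have H: "?H \<in> measurable (uniform_measure lborel annulus) (grassmann_borel ?k)"
    using hyperplane_map_measurable by (simp cong: measurable_cong_sets)
  show "prob_space ?S" unfolding grassmann_reference_def by (rule prob_space.prob_space_distr[OF prob_space_uniform_annulus H])
  show sS: "sets ?S = sets (grassmann_borel ?k)" by (simp add: grassmann_reference_def)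
  fix g :: "real ^ 'n \<Rightarrow> real ^ 'n" assume g: "orthogonal_transformation g"
  have g0: "x \<noteq> 0 \<and> g x \<noteq> 0" if "1 \<le> norm x" for x using that orthogonal_transformation_norm[OF g, of x] by auto
  have gm: "(\<lambda>V. g ` V) \<in> measurable ?S ?S"
    using orthogonal_image_measurable[OF g] sS by (simp cong: measurable_cong_sets)
  have gm': "g \<in> borel_measurable borel" by (rule orthogonal_transformation_borel_measurable[OF g])
  show "distr ?S ?S (\<lambda>V. g ` V) = ?S"
  proof (rule measure_eqI)
    fix A assume "A \<in> sets (distr ?S ?S (\<lambda>V. g ` V))"
    then have A: "A \<in> sets (grassmann_borel ?k)" by (simp add: sS)
    have iA: "indicator A \<in> borel_measurable (grassmann_borel ?k)" using A by simp
    have igA: "(\<lambda>V. indicator A (g ` V)) \<in> borel_measurable (grassmann_borel ?k)"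
      by (rule measurable_compose[OF orthogonal_image_measurable[OF g] iA])
    have "emeasure (distr ?S ?S (\<lambda>V. g ` V)) A = (\<integral>\<^sup>+ V. indicator A V \<partial>distr ?S ?S (\<lambda>V. g ` V))"
      using A by (simp add: sS)
    also have "\<dots> = (\<integral>\<^sup>+ V. indicator A (g ` V) \<partial>?S)"
      using gm iA by (subst nn_integral_distr) (simp_all add: sS cong: measurable_cong_sets)
    also have "\<dots> = (\<integral>\<^sup>+ x. indicator A (g ` {z. sgn x \<bullet> z = 0}) * indicator annulus x \<partial>lborel) / emeasure lborel (annulus :: (real ^ 'n) set)"
      by (rule nn_integral_grassmann_reference[OF igA])
    also have "(\<integral>\<^sup>+ x. indicator A (g ` {z. sgn x \<bullet> z = 0}) * indicator annulus x \<partial>lborel)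
       = (\<integral>\<^sup>+ x. indicator A (?H (g x)) * indicator annulus (g x) \<partial>lborel)"
      using orthogonal_transformation_norm[OF g] g0
      by (intro nn_integral_cong) (auto simp: orthogonal_image_hyperplane[OF g] sgn_orthogonal[OF g] annulus_def indicator_def)
    also have "\<dots> = (\<integral>\<^sup>+ x. indicator A (?H x) * indicator annulus x \<partial>distr lborel borel g)"
      using gm' measurable_compose[OF hyperplane_map_measurable iA]
      by (subst nn_integral_distr) (auto intro!: borel_measurable_times_ennreal borel_measurable_indicator)
    also have "\<dots> = (\<integral>\<^sup>+ x. indicator A {z. sgn x \<bullet> z = 0} * indicator annulus x \<partial>lborel)"
      unfolding lborel_distr_orthogonal[OF g] by (intro nn_integral_cong) (auto simp: indicator_def annulus_def)
    also have "\<dots> / emeasure lborel (annulus :: (real ^ 'n) set) = (\<integral>\<^sup>+ V. indicator A V \<partial>?S)"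
      by (rule nn_integral_grassmann_reference[OF iA, symmetric])
    finally show "emeasure (distr ?S ?S (\<lambda>V. g ` V)) A = emeasure ?S A" using A by (simp add: sS)
  qed simp
qed

section \<open>Uniqueness of the invariant measure\<close>

lemma nn_integral_indicator_less:
  assumes [measurable]: "f \<in> borel_measurable M"
  shows "(\<integral>\<^sup>+ x. indicator {d :: real. d < r} (f x) \<partial>M) = emeasure M {x \<in> space M. f x < r}"
proof -
  have "(\<integral>\<^sup>+ x. indicator {d. d < r} (f x) \<partial>M) = (\<integral>\<^sup>+ x. indicator {x \<in> space M. f x < r} x \<partial>M)"
    by (intro nn_integral_cong) (auto simp: indicator_def)
  also have "\<dots> = emeasure M {x \<in> space M. f x < r}" by (rule nn_integral_indicator) measurable
  finally show ?thesis .
qed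

text \<open>Integrating the indicator of \<open>dist (\<Phi> x) (\<Phi> y) < r\<close> in the two
  possible orders gives \<open>s\<close> and \<open>m\<close>, because both measures have total mass
  1.\<close>

lemma uniformly_distributed_radii_eq:
  fixes M N :: "'b measure" and \<Phi> :: "'b \<Rightarrow> 'a::{second_countable_topology, metric_space}"
  assumes M: "prob_space M" and N: "prob_space N"
    and \<Phi>M [measurable]: "\<Phi> \<in> borel_measurable M" and \<Phi>N [measurable]: "\<Phi> \<in> borel_measurable N"
    and bN: "\<And>x. x \<in> space M \<Longrightarrow> emeasure N {y \<in> space N. dist (\<Phi> x) (\<Phi> y) < r} = s"
    and bM: "\<And>y. y \<in> space N \<Longrightarrow> emeasure M {x \<in> space M. dist (\<Phi> x) (\<Phi> y) < r} = m"
  shows "s = m"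
proof -
  interpret M: prob_space M by fact
  interpret N: prob_space N by fact
  interpret P: pair_sigma_finite M N ..
  define k where "k x y = (indicator {d. d < r} (dist (\<Phi> x) (\<Phi> y)) :: ennreal)" for x y
  have k_meas [measurable]: "(\<lambda>(x, y). k x y) \<in> borel_measurable (M \<Otimes>\<^sub>M N)" unfolding k_def by measurable
  have kN: "(\<integral>\<^sup>+ y. k x y \<partial>N) = s" if "x \<in> space M" for x
    unfolding k_def by (subst nn_integral_indicator_less) (simp_all add: bN[OF that])
  have kM: "(\<integral>\<^sup>+ x. k x y \<partial>M) = m" if "y \<in> space N" for y
    unfolding k_def by (subst nn_integral_indicator_less) (simp_all add: bM[OF that])
  have "s = (\<integral>\<^sup>+ x. \<integral>\<^sup>+ y. k x y \<partial>N \<partial>M)"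
    using kN M.emeasure_space_1 by (simp cong: nn_integral_cong_simp)
  also have "\<dots> = (\<integral>\<^sup>+ y. \<integral>\<^sup>+ x. k x y \<partial>M \<partial>N)" by (rule P.Fubini'[symmetric]) measurable
  also have "\<dots> = m" using kM N.emeasure_space_1 by (simp cong: nn_integral_cong_simp)
  finally show ?thesis .
qed

text \<open>Both measures give all balls of radius \<open>r\<close> the same mass, so integrating the indicator of
  \<open>dist (\<Phi> x) (\<Phi> y) < r\<close> in either order compares the mass of \<open>C\<close> with that of its \<open>r\<close>-neighbourhood.\<close>

lemma uniformly_distributed_le:
  fixes M N :: "'b measure" and \<Phi> :: "'b \<Rightarrow> 'a::{second_countable_topology, metric_space}"
  assumes M: "prob_space M" and N: "prob_space N"
    and \<Phi>M [measurable]: "\<Phi> \<in> borel_measurable M" and \<Phi>N [measurable]: "\<Phi> \<in> borel_measurable N"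
    and bN: "\<And>x r. x \<in> space M \<Longrightarrow> 0 < r \<Longrightarrow> emeasure N {y \<in> space N. dist (\<Phi> x) (\<Phi> y) < r} = s r"
    and bM: "\<And>y r. y \<in> space N \<Longrightarrow> 0 < r \<Longrightarrow> emeasure M {x \<in> space M. dist (\<Phi> x) (\<Phi> y) < r} = s r"
    and pos: "\<And>r. 0 < r \<Longrightarrow> 0 < s r" and C: "closed C"
  shows "emeasure M {x \<in> space M. \<Phi> x \<in> C} \<le> emeasure N {y \<in> space N. \<Phi> y \<in> C}"
proof (cases "C = {}")
  case False
  interpret M: prob_space M by fact
  interpret N: prob_space N by fact
  interpret P: pair_sigma_finite M N ..
  have [measurable]: "C \<in> sets borel" using C by (rule borel_closed)
  define k where "k r x y = (indicator {d. d < r} (dist (\<Phi> x) (\<Phi> y)) :: ennreal)" for r :: real and x y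
  have k_meas [measurable]: "(\<lambda>(x, y). k r x y) \<in> borel_measurable (M \<Otimes>\<^sub>M N)" for r unfolding k_def by measurable
  have kN: "(\<integral>\<^sup>+ y. k r x y \<partial>N) = s r" if "x \<in> space M" "0 < r" for x r
    unfolding k_def by (subst nn_integral_indicator_less) (simp_all add: bN[OF that])
  have kM: "(\<integral>\<^sup>+ x. k r x y \<partial>M) = s r" if "y \<in> space N" "0 < r" for y r
    unfolding k_def by (subst nn_integral_indicator_less) (simp_all add: bM[OF that])
  define D where "D r = {y \<in> space N. infdist (\<Phi> y) C \<le> r}" for r
  have [measurable]: "(\<lambda>p. infdist p C) \<in> borel_measurable borel"
    by (intro borel_measurable_continuous_onI continuous_intros)
  have D_meas [measurable]: "D r \<in> sets N" for r unfolding D_def by measurable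
  have le: "emeasure M {x \<in> space M. \<Phi> x \<in> C} \<le> emeasure N (D r)" if r: "0 < r" for r
  proof -
    let ?C = "{x \<in> space M. \<Phi> x \<in> C}"
    have "emeasure M ?C * s r = (\<integral>\<^sup>+ x. indicator ?C x * s r \<partial>M)"
      by (subst nn_integral_multc) auto
    also have "\<dots> = (\<integral>\<^sup>+ x. \<integral>\<^sup>+ y. indicator ?C x * k r x y \<partial>N \<partial>M)"
      using r by (intro nn_integral_cong) (simp add: nn_integral_cmult kN)
    also have "\<dots> \<le> (\<integral>\<^sup>+ x. \<integral>\<^sup>+ y. indicator (D r) y * k r x y \<partial>N \<partial>M)"
    proof (intro nn_integral_mono)
      fix x y assume xy: "x \<in> space M" "y \<in> space N"
      show "indicator ?C x * k r x y \<le> indicator (D r) y * k r x y"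
      proof (cases "\<Phi> x \<in> C \<and> dist (\<Phi> x) (\<Phi> y) < r")
        case True
        then have "infdist (\<Phi> y) C \<le> r" by (intro infdist_le2[of "\<Phi> x"]) (auto simp: dist_commute)
        then show ?thesis using xy by (simp add: D_def indicator_def)
      qed (auto simp: k_def indicator_def)
    qed
    also have "\<dots> = (\<integral>\<^sup>+ y. \<integral>\<^sup>+ x. indicator (D r) y * k r x y \<partial>M \<partial>N)"
      by (rule P.Fubini'[symmetric]) measurable
    also have "\<dots> = (\<integral>\<^sup>+ y. indicator (D r) y * s r \<partial>N)"
      using r by (intro nn_integral_cong) (simp add: nn_integral_cmult kM)
    also have "\<dots> = emeasure N (D r) * s r" by (subst nn_integral_multc) auto
    finally have "s r * emeasure M ?C \<le> s r * emeasure N (D r)" by (simp add: mult.commute)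
    moreover have "s r \<noteq> top"
    proof -
      obtain x where "x \<in> space M" using M.not_empty by blast
      then show ?thesis using bN[OF _ r, of x] N.emeasure_finite by (metis infinity_ennreal_def)
    qed
    ultimately show ?thesis using pos[OF r] by (simp add: ennreal_mult_le_mult_iff)
  qed
  have "(\<lambda>n. emeasure N (D (1 / real (Suc n)))) \<longlonglongrightarrow> emeasure N (\<Inter>n. D (1 / real (Suc n)))"
  proof (rule Lim_emeasure_decseq)
    show "decseq (\<lambda>n. D (1 / real (Suc n)))"
    proof (rule decseq_SucI)
      fix n
      have "1 / real (Suc (Suc n)) \<le> 1 / real (Suc n)" by (simp add: field_simps)
      then show "D (1 / real (Suc (Suc n))) \<subseteq> D (1 / real (Suc n))" unfolding D_def using order_trans by blast
    qed
  qed (auto simp: D_meas)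
  moreover have "(\<Inter>n. D (1 / real (Suc n))) = {y \<in> space N. \<Phi> y \<in> C}"
  proof (intro set_eqI iffI)
    fix y assume y: "y \<in> (\<Inter>n. D (1 / real (Suc n)))"
    have "infdist (\<Phi> y) C \<le> 0"
    proof (rule ccontr)
      assume "\<not> ?thesis"
      then obtain n where "inverse (real (Suc n)) < infdist (\<Phi> y) C" using reals_Archimedean[of "infdist (\<Phi> y) C"] by auto
      moreover have "infdist (\<Phi> y) C \<le> 1 / real (Suc n)" using y by (simp add: D_def)
      ultimately show False by (simp add: divide_inverse)
    qed
    then have "infdist (\<Phi> y) C = 0" using infdist_nonneg[of "\<Phi> y" C] by linarith
    then have "\<Phi> y \<in> C" using in_closed_iff_infdist_zero[OF C False] by simp
    then show "y \<in> {y \<in> space N. \<Phi> y \<in> C}" using y by (simp add: D_def)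
  qed (auto simp: D_def)
  ultimately have "(\<lambda>n. emeasure N (D (1 / real (Suc n)))) \<longlonglongrightarrow> emeasure N {y \<in> space N. \<Phi> y \<in> C}" by simp
  then show ?thesis by (rule LIMSEQ_le_const) (auto intro!: le)
qed simp

lemma space_invariant_grassmann:
  "invariant_grassmann_prob k \<mu> \<Longrightarrow> space \<mu> = grassmannian k"
  unfolding invariant_grassmann_prob_def using sets_eq_imp_space_eq space_grassmann_borel by metis

lemma proj_matrix_measurable_invariant:
  assumes "invariant_grassmann_prob k \<mu>"
  shows "proj_matrix \<in> borel_measurable \<mu>"
proof -
  have "sets \<mu> = sets (grassmann_borel k)" using assms by (simp add: invariant_grassmann_prob_def)
  then show ?thesis using proj_matrix_measurable measurable_cong_sets by blast
qed

text \<open>Some orthogonal map carries \<open>V\<close> to \<open>W\<close>; it acts isometrically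
  and preserves \<mu>.\<close>

lemma invariant_grassmann_ball_mass:
  fixes \<mu> :: "(real ^ 'n) set measure"
  assumes inv: "invariant_grassmann_prob (CARD('n) - 1) \<mu>"
    and V: "V \<in> grassmannian (CARD('n) - 1)" and W: "W \<in> grassmannian (CARD('n) - 1)"
  shows "emeasure \<mu> {U \<in> space \<mu>. dist (proj_matrix V) (proj_matrix U) < r}
    = emeasure \<mu> {U \<in> space \<mu>. dist (proj_matrix W) (proj_matrix U) < r}"
proof -
  obtain v w where v: "norm v = 1" "V = {x. v \<bullet> x = 0}" and w: "norm w = 1" "W = {x. w \<bullet> x = 0}"
    using V W unfolding grassmannian_hyperplane by blast
  obtain g where g: "orthogonal_transformation g" "g v = w"
    using orthogonal_transformation_exists_1[OF v(1) w(1)] by blast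
  have sp: "space \<mu> = grassmannian (CARD('n) - 1)" by (rule space_invariant_grassmann[OF inv])
  have sets: "sets \<mu> = sets (grassmann_borel (CARD('n) - 1))" using inv by (simp add: invariant_grassmann_prob_def)
  have gm: "(\<lambda>V. g ` V) \<in> measurable \<mu> \<mu>"
    using orthogonal_image_measurable[OF g(1)] by (subst measurable_cong_sets[OF sets sets])
  have gV: "g ` V = W" using g by (simp add: v w orthogonal_image_hyperplane)
  have [measurable]: "proj_matrix \<in> borel_measurable \<mu>" by (rule proj_matrix_measurable_invariant[OF inv])
  have S: "{U \<in> space \<mu>. dist (proj_matrix W) (proj_matrix U) < r} \<in> sets \<mu>" by measurable
  have "emeasure \<mu> {U \<in> space \<mu>. dist (proj_matrix W) (proj_matrix U) < r}
     = emeasure (distr \<mu> \<mu> (\<lambda>V. g ` V)) {U \<in> space \<mu>. dist (proj_matrix W) (proj_matrix U) < r}"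
    using inv g(1) by (simp add: invariant_grassmann_prob_def)
  also have "\<dots> = emeasure \<mu> ((\<lambda>V. g ` V) -` {U \<in> space \<mu>. dist (proj_matrix W) (proj_matrix U) < r} \<inter> space \<mu>)"
    by (rule emeasure_distr[OF gm S])
  also have "(\<lambda>V. g ` V) -` {U \<in> space \<mu>. dist (proj_matrix W) (proj_matrix U) < r} \<inter> space \<mu>
      = {U \<in> space \<mu>. dist (proj_matrix V) (proj_matrix U) < r}"
    using dist_proj_matrix_orthogonal[OF g(1) V] orthogonal_image_grassmannian[OF g(1)]
    unfolding sp gV by auto
  finally show ?thesis by simp
qed

text \<open>If \<open>v\<close> is a unit normal of \<open>V\<close>, the point
  \<open>(3/2) *\<^sub>R v\<close> is in the interior of the annulus, and all points of a small ball
  around it have directions whose hyperplanes are close to \<open>V\<close>.\<close>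

lemma grassmann_reference_ball_pos:
  fixes V :: "(real ^ 'n) set"
  assumes V: "V \<in> grassmannian (CARD('n) - 1)" and r: "0 < r"
  shows "0 < emeasure grassmann_reference {U \<in> space grassmann_reference. dist (proj_matrix V) (proj_matrix U) < r}"
proof -
  let ?k = "CARD('n) - 1"
  let ?f = "\<lambda>U. indicator {U \<in> grassmannian ?k. dist (proj_matrix V) (proj_matrix U) < r} U :: ennreal"
  have sp: "space (grassmann_reference :: (real ^ 'n) set measure) = grassmannian ?k"
    by (rule space_invariant_grassmann[OF invariant_grassmann_reference])
  obtain v where v: "norm v = 1" "V = {x. v \<bullet> x = 0}" using V unfolding grassmannian_hyperplane by blast
  let ?S = "{x :: real ^ 'n. 1 < norm x \<and> norm x < 2}"
  let ?F = "\<lambda>x :: real ^ 'n. dist (matrix (hyperplane_proj v)) (matrix (hyperplane_proj (sgn x)))"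
  have oS: "open ?S" by (intro open_Collect_conj open_Collect_less continuous_intros)
  have "continuous_on ?S (\<lambda>x. matrix (hyperplane_proj (sgn x)))"
    by (intro continuous_on_compose2[OF continuous_on_matrix_hyperplane_proj[of UNIV]] continuous_on_sgn continuous_intros) auto
  then have "continuous_on ?S ?F" by (intro continuous_intros)
  then have "open (?S \<inter> ?F -` {..<r})" by (rule continuous_open_preimage[OF _ oS]) simp
  moreover have "(3/2) *\<^sub>R v \<in> ?S \<inter> ?F -` {..<r}" using v r by (simp add: sgn_scaleR) (simp add: sgn_div_norm)
  ultimately obtain e where e: "0 < e" "ball ((3/2) *\<^sub>R v) e \<subseteq> ?S \<inter> ?F -` {..<r}" using openE by blast
  have sets: "{U \<in> grassmannian ?k. dist (proj_matrix V) (proj_matrix U) < r} \<in> sets (grassmann_borel ?k)"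
  proof -
    have [measurable]: "proj_matrix \<in> borel_measurable (grassmann_borel ?k :: (real ^ 'n) set measure)"
      by (rule proj_matrix_measurable)
    have "{U \<in> space (grassmann_borel ?k). dist (proj_matrix V) (proj_matrix U) < r} \<in> sets (grassmann_borel ?k)" by measurable
    then show ?thesis by (simp add: space_grassmann_borel)
  qed
  have "0 < emeasure lborel (ball ((3/2) *\<^sub>R v) e)" using content_ball_pos[OF e(1), of "(3/2) *\<^sub>R v"]
    by (auto simp: measure_def zero_less_iff_neq_zero)
  also have "\<dots> = (\<integral>\<^sup>+ x. indicator (ball ((3/2) *\<^sub>R v) e) x \<partial>lborel)" by simp
  also have "\<dots> \<le> (\<integral>\<^sup>+ x. ?f {z. sgn x \<bullet> z = 0} * indicator annulus x \<partial>lborel)"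
  proof (rule nn_integral_mono)
    fix x :: "real ^ 'n"
    show "indicator (ball ((3/2) *\<^sub>R v) e) x \<le> ?f {z. sgn x \<bullet> z = 0} * indicator annulus x"
    proof (cases "x \<in> ball ((3/2) *\<^sub>R v) e")
      case True
      then have x: "1 < norm x" "norm x < 2" "?F x < r" using e(2) by auto
      then have n: "norm (sgn x) = 1" by (auto simp: norm_sgn)
      then have "{z. sgn x \<bullet> z = 0} \<in> grassmannian ?k" unfolding grassmannian_hyperplane by blast
      then show ?thesis using x proj_matrix_hyperplane[OF n] proj_matrix_hyperplane[OF v(1)]
        by (simp add: v(2) annulus_def indicator_def)
    qed simp
  qed
  finally have "0 < (\<integral>\<^sup>+ x. ?f {z. sgn x \<bullet> z = 0} * indicator annulus x \<partial>lborel) / emeasure lborel (annulus :: (real ^ 'n) set)"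
    using annulus_finite[where 'a="real ^ 'n"] by (simp add: ennreal_zero_less_divide less_top)
  also have "\<dots> = (\<integral>\<^sup>+ U. ?f U \<partial>grassmann_reference)"
    using sets by (intro nn_integral_grassmann_reference[symmetric]) simp
  also have "\<dots> = emeasure grassmann_reference {U \<in> grassmannian ?k. dist (proj_matrix V) (proj_matrix U) < r}"
    using sets by (intro nn_integral_indicator) (simp add: grassmann_reference_def)
  finally show ?thesis unfolding sp .
qed

text \<open>Two probability measures that are uniformly distributed with respect to the same
  distance coincide: \<open>uniformly_distributed_le\<close> in both directions gives equality on
  closed sets, which generate the Borel sets. Together with existence, this is what makes the
  definite description in \<open>grassmann_measure\<close> denote the reference measure.\<close>

lemma invariant_grassmann_unique:
  fixes \<mu> :: "(real ^ 'n) set measure"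
  assumes inv: "invariant_grassmann_prob (CARD('n) - 1) \<mu>"
  shows "\<mu> = grassmann_reference"
proof -
  let ?k = "CARD('n) - 1"
  let ?N = "grassmann_reference :: (real ^ 'n) set measure"
  note ref = invariant_grassmann_reference[where 'n='n]
  have M: "prob_space \<mu>" and N: "prob_space ?N" using inv ref by (simp_all add: invariant_grassmann_prob_def)
  have sM: "sets \<mu> = sets (grassmann_borel ?k)" and sN: "sets ?N = sets (grassmann_borel ?k)"
    using inv ref by (simp_all add: invariant_grassmann_prob_def)
  have spM: "space \<mu> = grassmannian ?k" and spN: "space ?N = grassmannian ?k"
    by (rule space_invariant_grassmann[OF inv], rule space_invariant_grassmann[OF ref])
  have pM: "proj_matrix \<in> borel_measurable \<mu>" and pN: "proj_matrix \<in> borel_measurable ?N"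
    by (rule proj_matrix_measurable_invariant[OF inv], rule proj_matrix_measurable_invariant[OF ref])
  obtain v0 :: "real ^ 'n" where "norm v0 = 1" by (rule vector_choose_size[of 1]) simp
  then have V0: "{x. v0 \<bullet> x = 0} \<in> grassmannian ?k" unfolding grassmannian_hyperplane by blast
  define s where "s r = emeasure ?N {U \<in> space ?N. dist (proj_matrix {x. v0 \<bullet> x = 0}) (proj_matrix U) < r}" for r
  define m where "m r = emeasure \<mu> {U \<in> space \<mu>. dist (proj_matrix {x. v0 \<bullet> x = 0}) (proj_matrix U) < r}" for r
  have bN: "emeasure ?N {U \<in> space ?N. dist (proj_matrix V) (proj_matrix U) < r} = s r" if "V \<in> grassmannian ?k" for V r
    unfolding s_def by (rule invariant_grassmann_ball_mass[OF ref that V0])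
  have bM: "emeasure \<mu> {U \<in> space \<mu>. dist (proj_matrix V) (proj_matrix U) < r} = m r" if "V \<in> grassmannian ?k" for V r
    unfolding m_def by (rule invariant_grassmann_ball_mass[OF inv that V0])
  have bN': "emeasure ?N {U \<in> space ?N. dist (proj_matrix U) (proj_matrix V) < r} = s r" if "V \<in> grassmannian ?k" for V r
    using bN[OF that] by (subst dist_commute)
  have bM': "emeasure \<mu> {U \<in> space \<mu>. dist (proj_matrix U) (proj_matrix V) < r} = m r" if "V \<in> grassmannian ?k" for V r
    using bM[OF that] by (subst dist_commute)
  \<comment> \<open>\<open>uniformly_distributed_le\<close> works with one mass function for both
    measures; its positivity is inherited from the reference measure.\<close>
  have sm: "s = m"
  proof (rule ext)
    fix r
    show "s r = m r"
      by (rule uniformly_distributed_radii_eq[OF M N pM pN]) (rule bN bM', simp only: spM spN)+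
  qed
  have pos: "0 < s r" if "0 < r" for r unfolding s_def by (rule grassmann_reference_ball_pos[OF V0 that])
  have closed_eq: "emeasure \<mu> {V \<in> space \<mu>. proj_matrix V \<in> C} = emeasure ?N {V \<in> space ?N. proj_matrix V \<in> C}"
    if C: "closed C" for C
  proof (rule antisym)
    show "emeasure \<mu> {V \<in> space \<mu>. proj_matrix V \<in> C} \<le> emeasure ?N {V \<in> space ?N. proj_matrix V \<in> C}"
      by (rule uniformly_distributed_le[OF M N pM pN _ _ pos C]) (rule bN bM'[folded sm], simp only: spM spN)+
    show "emeasure ?N {V \<in> space ?N. proj_matrix V \<in> C} \<le> emeasure \<mu> {V \<in> space \<mu>. proj_matrix V \<in> C}"
      by (rule uniformly_distributed_le[OF N M pN pM _ _ pos C]) (rule bN' bM[folded sm], simp only: spM spN)+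
  qed
  have fin: "emeasure (distr \<mu> borel proj_matrix) UNIV \<noteq> \<infinity>"
    using prob_space.emeasure_space_1[OF M] pM by (simp add: emeasure_distr)
  have "distr \<mu> borel proj_matrix = distr ?N borel proj_matrix"
  proof (rule measure_eqI_generator_eq[where E="Collect closed" and \<Omega>=UNIV and A="\<lambda>_. UNIV"])
    show "Int_stable (Collect closed :: (real ^ 'n ^ 'n) set set)" by (auto simp: Int_stable_def)
    show "emeasure (distr \<mu> borel proj_matrix) X = emeasure (distr ?N borel proj_matrix) X" if "X \<in> Collect closed" for X
      using closed_eq[of X] that pM pN by (simp add: emeasure_distr borel_closed vimage_def Int_def conj_commute)
  qed (use fin in \<open>simp_all add: borel_eq_closed\<close>)
  note d = this
  show ?thesis
  proof (rule measure_eqI)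
    fix X assume "X \<in> sets \<mu>"
    then obtain A where A: "A \<in> sets borel" "X = proj_matrix -` A \<inter> grassmannian ?k" by (auto simp: sM sets_grassmann_borel)
    have "emeasure \<mu> X = emeasure (distr \<mu> borel proj_matrix) A" using A pM by (simp add: emeasure_distr spM)
    also have "\<dots> = emeasure ?N X" unfolding d using A pN by (simp add: emeasure_distr spN)
    finally show "emeasure \<mu> X = emeasure ?N X" .
  qed (simp add: sM sN)
qed

lemma grassmann_measure_eq_reference:
  "grassmann_measure (CARD('n) - 1) = (grassmann_reference :: (real ^ 'n) set measure)"
  unfolding grassmann_measure_def
  by (rule the_equality) (use invariant_grassmann_reference invariant_grassmann_unique in auto)

section \<open>Mean shadow area\<close>

text \<open>Computes the shadow from the projection matrix alone, as the volume of a slab of thickness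
  \<open>1\<close>; this makes its measurability in the direction a consequence of Fubini's theorem.\<close>

definition slab_volume :: "(real ^ 'n) set \<Rightarrow> real ^ 'n ^ 'n \<Rightarrow> ennreal" where
  "slab_volume K P = emeasure lborel {x. norm (x - P *v x) \<le> 1 / 2 \<and> (\<exists>k. k \<in> K \<and> P *v x = P *v k)}"

text \<open>Joint closedness in the matrix and the point is what allows Fubini's theorem to be
  applied. The existential quantifier over \<open>K\<close> is a projection along a compact factor,
  which preserves closedness.\<close>

lemma slab_closed:
  assumes K: "compact K"
  shows "closed {z :: (real ^ 'n ^ 'n) \<times> (real ^ 'n). norm (snd z - fst z *v snd z) \<le> 1 / 2 \<and> (\<exists>k. k \<in> K \<and> fst z *v snd z = fst z *v k)}"
proof -
  let ?T = "{y :: (real ^ 'n) \<times> (real ^ 'n ^ 'n) \<times> (real ^ 'n). fst (snd y) *v snd (snd y) = fst (snd y) *v fst y}"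
  have "closed ?T" unfolding matrix_vector_mult_def by (intro closed_Collect_eq continuous_intros)
  from closed_compact_projection[OF K this]
  have c2: "closed {z :: (real ^ 'n ^ 'n) \<times> (real ^ 'n). \<exists>k. k \<in> K \<and> fst z *v snd z = fst z *v k}" by simp
  have "closed {z :: (real ^ 'n ^ 'n) \<times> (real ^ 'n). norm (snd z - fst z *v snd z) \<le> 1 / 2}"
    unfolding matrix_vector_mult_def by (intro closed_Collect_le continuous_intros)
  then show ?thesis using c2 by (rule closed_Collect_conj)
qed

lemma slab_volume_measurable:
  assumes K: "compact (K :: (real ^ 'n) set)"
  shows "slab_volume K \<in> borel_measurable borel"
proof -
  let ?Q = "{z :: (real ^ 'n ^ 'n) \<times> (real ^ 'n). norm (snd z - fst z *v snd z) \<le> 1 / 2 \<and> (\<exists>k. k \<in> K \<and> fst z *v snd z = fst z *v k)}"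
  have "sets (borel \<Otimes>\<^sub>M lborel :: ((real ^ 'n ^ 'n) \<times> (real ^ 'n)) measure) = sets (borel \<Otimes>\<^sub>M borel)"
    by (intro sets_pair_measure_cong) simp_all
  also have "\<dots> = sets borel" by (simp only: borel_prod)
  finally have "?Q \<in> sets (borel \<Otimes>\<^sub>M lborel)" using borel_closed[OF slab_closed[OF K]] by (simp only:)
  from lborel.measurable_emeasure_Pair[OF this]
  show ?thesis by (simp add: slab_volume_def[abs_def] vimage_def)
qed

text \<open>A line orthogonal to the hyperplane meets the slab in an interval of length 1 if it
  passes through the projection of \<open>K\<close>, and not at all otherwise.\<close>

lemma slab_volume_hyperplane_proj:
  fixes K :: "(real ^ 'n) set"
  assumes K: "compact K" and u: "norm u = 1"
  shows "slab_volume K (matrix (hyperplane_proj u)) = shadow u K"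
proof -
  let ?A = "{x. norm (x - hyperplane_proj u x) \<le> 1 / 2 \<and> (\<exists>k. k \<in> K \<and> hyperplane_proj u x = hyperplane_proj u k)}"
  have cK: "compact (hyperplane_proj u ` K)" by (rule compact_hyperplane_proj[OF K])
  have "?A = {x. norm (x - hyperplane_proj u x) \<le> 1 / 2} \<inter> hyperplane_proj u -` (hyperplane_proj u ` K)" by auto
  moreover have "closed {x. norm (x - hyperplane_proj u x) \<le> 1 / 2}"
    by (intro closed_Collect_le continuous_intros continuous_on_hyperplane_proj)
  moreover have "closed (hyperplane_proj u -` (hyperplane_proj u ` K))"
    using compact_imp_closed[OF cK] continuous_on_hyperplane_proj[of UNIV u]
    by (simp add: closed_vimage continuous_on_closed_vimage)
  ultimately have A: "?A \<in> sets borel" by (simp add: closed_Int borel_closed)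
  have "emeasure lborel ?A = (\<integral>\<^sup>+ s. emeasure lborel {t. s + t *\<^sub>R u \<in> ?A} \<partial>hyperplane_measure u)"
    by (rule emeasure_lborel_slices[OF u A])
  also have "\<dots> = (\<integral>\<^sup>+ s. indicator (hyperplane_proj u ` K) s \<partial>hyperplane_measure u)"
  proof (rule nn_integral_cong_AE)
    show "AE s in hyperplane_measure u. emeasure lborel {t. s + t *\<^sub>R u \<in> ?A} = indicator (hyperplane_proj u ` K) s"
      using AE_hyperplane_measure[of u]
    proof eventually_elim
      case (elim s)
      have "hyperplane_proj u (s + t *\<^sub>R u) = s" for t
        using elim u by (simp add: hyperplane_proj_def inner_add_right norm_eq_1)
      then have "{t. s + t *\<^sub>R u \<in> ?A} = (if s \<in> hyperplane_proj u ` K then {-1/2..1/2} else {})"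
        using u by (auto simp: abs_le_iff)
      then show ?case by simp
    qed
  qed
  also have "\<dots> = shadow u K"
    unfolding shadow_def using borel_closed[OF compact_imp_closed[OF cK]] by (intro nn_integral_indicator) simp
  finally show ?thesis by (simp add: slab_volume_def matrix_hyperplane_proj_mult)
qed

lemma slab_volume_proj_matrix:
  fixes K :: "(real ^ 'n) set"
  assumes K: "compact K" and V: "V \<in> grassmannian (CARD('n) - 1)"
  shows "slab_volume K (proj_matrix V) = hausdorff_measure (CARD('n) - 1) (orth_proj V ` K)"
proof -
  obtain u where u: "norm u = 1" "V = {x. u \<bullet> x = 0}" using V unfolding grassmannian_hyperplane by blast
  show ?thesis
    using slab_volume_hyperplane_proj[OF K u(1)] shadow_eq_hausdorff_measure[OF K u(1)]
    by (simp add: u orth_proj_hyperplane)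
qed

text \<open>For compact \<open>K\<close> the integrand is a measurable function of the projection
  matrix, so the abstract average becomes an integral over the annulus, to which
  \<open>direction_sampling\<close> applies.\<close>

lemma fav_compact:
  fixes K :: "(real ^ 'n) set"
  assumes K: "compact K"
  shows "fav (CARD('n) - 1) K
    = (\<integral>\<^sup>+ x. slab_volume K (matrix (hyperplane_proj (sgn x))) * indicator annulus x \<partial>lborel) / emeasure lborel (annulus :: (real ^ 'n) set)"
proof -
  let ?k = "CARD('n) - 1"
  have sp: "space (grassmann_reference :: (real ^ 'n) set measure) = grassmannian ?k"
    by (rule space_invariant_grassmann[OF invariant_grassmann_reference])
  have "fav ?k K = (\<integral>\<^sup>+ V. hausdorff_measure ?k (orth_proj V ` K) \<partial>grassmann_reference)"
    by (simp only: fav_def grassmann_measure_eq_reference)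
  also have "\<dots> = (\<integral>\<^sup>+ V. slab_volume K (proj_matrix V) \<partial>grassmann_reference)"
    using slab_volume_proj_matrix[OF K] by (intro nn_integral_cong) (simp add: sp)
  also have "\<dots> = (\<integral>\<^sup>+ x. slab_volume K (proj_matrix {z. sgn x \<bullet> z = 0}) * indicator annulus x \<partial>lborel) / emeasure lborel (annulus :: (real ^ 'n) set)"
    by (rule nn_integral_grassmann_reference) (rule measurable_compose[OF proj_matrix_measurable slab_volume_measurable[OF K]])
  also have "(\<integral>\<^sup>+ x. slab_volume K (proj_matrix {z. sgn x \<bullet> z = 0}) * indicator annulus x \<partial>lborel)
     = (\<integral>\<^sup>+ x. slab_volume K (matrix (hyperplane_proj (sgn x))) * indicator annulus x \<partial>lborel)"
  proof (rule nn_integral_cong)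
    fix x :: "real ^ 'n"
    show "slab_volume K (proj_matrix {z. sgn x \<bullet> z = 0}) * indicator annulus x
      = slab_volume K (matrix (hyperplane_proj (sgn x))) * indicator annulus x"
    proof (cases "x \<in> annulus")
      case True
      then have "norm (sgn x) = 1" by (auto simp: norm_sgn annulus_def)
      then show ?thesis by (simp only: proj_matrix_hyperplane)
    qed simp
  qed
  finally show ?thesis .
qed

section \<open>Lower bound for compact sets and upper bound for balls\<close>

lemma fav_mono:
  "A \<subseteq> B \<Longrightarrow> fav k A \<le> fav k B"
  unfolding fav_def by (intro nn_integral_mono hausdorff_measure_mono image_mono)

text \<open>Directions are sampled with error \<epsilon>. Their weighted sum of shadows is at most
  the mean shadow, while \<open>weighted_shadow_inequality\<close> applies to them with the constant
  \<open>mean_width u - \<epsilon>\<close>; then \<epsilon> tends to 0. If the mean width were 0,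
  the left-hand side would vanish.\<close>

theorem fav_compact_ge:
  fixes K :: "(real ^ 'n) set"
  assumes K: "compact K" "0 < measure lborel K" and u: "norm (u :: real ^ 'n) = 1"
  shows "ennreal (real CARD('n) * (mean_width u * root CARD('n) (measure lborel (cball (0::real ^ 'n) 1))) * root CARD('n) (measure lborel K) ^ (CARD('n) - 1))
    \<le> 2 * fav (CARD('n) - 1) K"
proof (cases "mean_width u = 0")
  case False
  define R where "R = mean_width u"
  define b where "b = root CARD('n) (measure lborel (cball (0::real ^ 'n) 1))"
  define k where "k = root CARD('n) (measure lborel K) ^ (CARD('n) - 1)"
  define h where "h v = slab_volume K (matrix (hyperplane_proj v))" for v
  let ?A = "annulus :: (real ^ 'n) set"
  have R: "0 < R" using False mean_width_nonneg[of u] by (simp add: R_def)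
  have h: "h \<in> borel_measurable borel"
    unfolding h_def
    by (rule measurable_compose[OF borel_measurable_continuous_onI[OF continuous_on_matrix_hyperplane_proj] slab_volume_measurable[OF K(1)]])
  have A: "emeasure lborel ?A \<noteq> 0" "emeasure lborel ?A \<noteq> top"
    using measure_annulus_pos[where 'a="real ^ 'n"] annulus_finite[where 'a="real ^ 'n"] by (auto simp: measure_def)
  have le: "ennreal (real CARD('n) * ((R - \<epsilon>) * b) * k) \<le> 2 * fav (CARD('n) - 1) K" if e: "0 < \<epsilon>" "\<epsilon> < R" for \<epsilon>
  proof -
    obtain N :: nat and v :: "nat \<Rightarrow> real ^ 'n" and c where s:
      "\<And>j. j < N \<Longrightarrow> norm (v j) = 1" "\<And>j. j < N \<Longrightarrow> 0 \<le> c j" "(\<Sum>j<N. c j) = 1"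
      "\<And>e. \<bar>(\<Sum>j<N. c j * \<bar>v j \<bullet> e\<bar>) - mean_width e\<bar> \<le> \<epsilon> * norm e"
      "(\<Sum>j<N. ennreal (c j) * h (v j)) * emeasure lborel ?A \<le> (\<integral>\<^sup>+ x. h (sgn x) * indicator ?A x \<partial>lborel)"
      by (rule direction_sampling[OF h e(1)]) blast
    have "(R - \<epsilon>) * norm e \<le> (\<Sum>j<N. c j * \<bar>v j \<bullet> e\<bar>)" for e
      using s(4)[of e] by (simp add: mean_width_eq[OF u, of e] R_def algebra_simps abs_le_iff)
    then have "ennreal (real CARD('n) * ((R - \<epsilon>) * b) * k) \<le> (\<Sum>j<N. ennreal (2 * c j) * shadow (v j) K)"
      unfolding b_def k_def using e by (intro weighted_shadow_inequality[OF K s(1,2)]) auto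
    also have "\<dots> = 2 * (\<Sum>j<N. ennreal (c j) * h (v j))"
      unfolding sum_distrib_left
      by (intro sum.cong refl) (simp add: h_def slab_volume_hyperplane_proj[OF K(1)] s(1,2) ennreal_mult' mult.assoc)
    also have "(\<Sum>j<N. ennreal (c j) * h (v j)) \<le> fav (CARD('n) - 1) K"
    proof -
      have "(\<Sum>j<N. ennreal (c j) * h (v j)) = (\<Sum>j<N. ennreal (c j) * h (v j)) * emeasure lborel ?A / emeasure lborel ?A"
        using A by (simp add: ennreal_mult_divide_eq)
      also have "\<dots> \<le> (\<integral>\<^sup>+ x. h (sgn x) * indicator ?A x \<partial>lborel) / emeasure lborel ?A"
        by (rule divide_right_mono_ennreal[OF s(5)])
      finally show ?thesis by (simp only: fav_compact[OF K(1)] h_def)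
    qed
    finally show ?thesis by (simp add: mult_left_mono)
  qed
  have "((\<lambda>\<epsilon>. ennreal (real CARD('n) * ((R - \<epsilon>) * b) * k)) \<longlongrightarrow> ennreal (real CARD('n) * ((R - 0) * b) * k)) (at_right 0)"
    by (intro tendsto_intros)
  moreover have "eventually (\<lambda>\<epsilon>. ennreal (real CARD('n) * ((R - \<epsilon>) * b) * k) \<le> 2 * fav (CARD('n) - 1) K) (at_right 0)"
    using le R by (intro eventually_at_rightI[of 0 R]) auto
  ultimately have "ennreal (real CARD('n) * ((R - 0) * b) * k) \<le> 2 * fav (CARD('n) - 1) K"
    by (rule tendsto_upperbound) simp
  then show ?thesis by (simp add: R_def b_def k_def)
qed simp

lemma shadow_cball_le_mean_width:
  fixes u :: "real ^ 'n"
  assumes u: "norm u = 1" and r: "0 < r"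
  shows "2 * shadow u (cball 0 r) \<le> ennreal (real CARD('n) * mean_width u * measure lborel (cball (0::real ^ 'n) 1) * r ^ (CARD('n) - 1))"
proof -
  let ?f = "\<lambda>R. ennreal (real CARD('n) * R * measure lborel (cball (0::real ^ 'n) 1) * r ^ (CARD('n) - 1))"
  have le: "2 * shadow u (cball 0 r) \<le> ?f (mean_width u + \<epsilon>)" if e: "0 < \<epsilon>" for \<epsilon>
  proof -
    obtain N :: nat and v :: "nat \<Rightarrow> real ^ 'n" and c where s:
      "\<And>j. j < N \<Longrightarrow> norm (v j) = 1" "\<And>j. j < N \<Longrightarrow> 0 \<le> c j" "(\<Sum>j<N. c j) = 1"
      "\<And>e. \<bar>(\<Sum>j<N. c j * \<bar>v j \<bullet> e\<bar>) - mean_width e\<bar> \<le> \<epsilon> * norm e"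
      \<comment> \<open>With the zero function for \<open>h\<close>, the sampling reduces to the
        approximation of the mean width.\<close>
      by (rule direction_sampling[of "\<lambda>_. 0", OF _ e]) auto
    have "(\<Sum>j<N. c j * \<bar>v j \<bullet> e\<bar>) \<le> (mean_width u + \<epsilon>) * norm e" for e
      using s(4)[of e] by (simp add: mean_width_eq[OF u, of e] algebra_simps abs_le_iff)
    then show ?thesis
      using e mean_width_nonneg[of u] by (intro shadow_cball_le[OF s(1,2,3) _ _ u r]) auto
  qed
  have "((\<lambda>\<epsilon>. ?f (mean_width u + \<epsilon>)) \<longlongrightarrow> ?f (mean_width u + 0)) (at_right 0)" by (intro tendsto_intros)
  moreover have "eventually (\<lambda>\<epsilon>. 2 * shadow u (cball 0 r) \<le> ?f (mean_width u + \<epsilon>)) (at_right 0)"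
    using le by (intro eventually_at_rightI[of 0 1]) auto
  ultimately have "2 * shadow u (cball 0 r) \<le> ?f (mean_width u + 0)"
    by (rule tendsto_lowerbound) simp
  then show ?thesis by simp
qed

lemma hausdorff_measure_proj_cball:
  fixes w c :: "real ^ 'n"
  assumes w: "norm w = 1"
  shows "hausdorff_measure (CARD('n) - 1) (hyperplane_proj w ` cball c r) = shadow w (cball 0 r)"
proof -
  have "cball c r = (\<lambda>y. c + y) ` cball 0 r" by (simp add: cball_translation[of c 0 r, simplified])
  moreover have "hyperplane_proj w (c + y) = hyperplane_proj w c + hyperplane_proj w y" for y
    by (simp add: hyperplane_proj_def algebra_simps)
  ultimately have "hyperplane_proj w ` cball c r = (\<lambda>x. hyperplane_proj w c + x) ` hyperplane_proj w ` cball 0 r"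
    unfolding image_image by (metis (mono_tags, lifting) image_cong image_image)
  then have "hausdorff_measure (CARD('n) - 1) (hyperplane_proj w ` cball c r) = hausdorff_measure (CARD('n) - 1) (hyperplane_proj w ` cball 0 r)"
    by (simp only:) (rule hausdorff_measure_isometry, simp)
  then show ?thesis by (simp add: shadow_eq_hausdorff_measure[OF compact_cball w])
qed

text \<open>Every projection of the ball is a translate of one of the centred ball, and all of them
  obey the same bound, which therefore passes to the average over a probability measure.\<close>

lemma fav_cball_le:
  fixes u c :: "real ^ 'n"
  assumes u: "norm u = 1" and r: "0 < r"
  shows "2 * fav (CARD('n) - 1) (cball c r)
    \<le> ennreal (real CARD('n) * mean_width u * measure lborel (cball (0::real ^ 'n) 1) * r ^ (CARD('n) - 1))"
proof -
  define C where "C = real CARD('n) * mean_width u * measure lborel (cball (0::real ^ 'n) 1) * r ^ (CARD('n) - 1)"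
  let ?k = "CARD('n) - 1"
  have two: "2 * ennreal (C / 2) = ennreal C"
    using ennreal_mult'[of 2 "C / 2"] by simp
  have sp: "space (grassmann_reference :: (real ^ 'n) set measure) = grassmannian ?k"
    by (rule space_invariant_grassmann[OF invariant_grassmann_reference])
  have pr: "prob_space (grassmann_reference :: (real ^ 'n) set measure)"
    using invariant_grassmann_reference[where 'n='n] by (simp add: invariant_grassmann_prob_def)
  have le: "hausdorff_measure ?k (orth_proj V ` cball c r) \<le> ennreal (C / 2)" if V: "V \<in> grassmannian ?k" for V :: "(real ^ 'n) set"
  proof -
    obtain w where w: "norm w = 1" "V = {x. w \<bullet> x = 0}" using V unfolding grassmannian_hyperplane by blast
    have "2 * shadow w (cball 0 r) \<le> ennreal C"
      unfolding C_def using shadow_cball_le_mean_width[OF w(1) r] mean_width_eq[OF u, of w] w(1) by simp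
    then have "2 * shadow w (cball 0 r) \<le> 2 * ennreal (C / 2)" by (simp only: two)
    then have "shadow w (cball 0 r) \<le> ennreal (C / 2)" by (simp add: ennreal_mult_le_mult_iff)
    then show ?thesis by (simp only: w(2) orth_proj_hyperplane[OF w(1)] hausdorff_measure_proj_cball[OF w(1)])
  qed
  have "fav ?k (cball c r) = (\<integral>\<^sup>+ V. hausdorff_measure ?k (orth_proj V ` cball c r) \<partial>grassmann_reference)"
    by (simp only: fav_def grassmann_measure_eq_reference)
  also have "\<dots> \<le> (\<integral>\<^sup>+ V. ennreal (C / 2) \<partial>(grassmann_reference :: (real ^ 'n) set measure))"
    using le by (intro nn_integral_mono) (simp add: sp)
  also have "\<dots> = ennreal (C / 2)" using prob_space.emeasure_space_1[OF pr] by simp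
  finally have "2 * fav ?k (cball c r) \<le> 2 * ennreal (C / 2)" by (rule mult_left_mono) simp
  then have "2 * fav ?k (cball c r) \<le> ennreal C" by (simp only: two)
  then show ?thesis by (simp only: C_def)
qed

section \<open>From compact sets to Borel sets\<close>

lemma emeasure_lborel_inner_compact:
  fixes E :: "'a::euclidean_space set"
  assumes E: "E \<in> sets borel" "emeasure lborel E < top" and x: "ennreal x < emeasure lborel E"
  obtains K where "compact K" "K \<subseteq> E" "x < measure lborel K"
proof -
  \<comment> \<open>Restricting to \<open>E\<close> gives a finite measure, the setting of
    \<open>inner_regular\<close>.\<close>
  let ?M = "density lborel (indicator E)"
  have M: "emeasure ?M A = emeasure lborel (E \<inter> A)" if "A \<in> sets borel" for A
    using E(1) that by (intro emeasure_restricted) simp_all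
  have "emeasure ?M E = (SUP K \<in> {K. K \<subseteq> E \<and> compact K}. emeasure ?M K)"
    using E M[of UNIV] by (intro inner_regular) auto
  then have "ennreal x < (SUP K \<in> {K. K \<subseteq> E \<and> compact K}. emeasure ?M K)" using x M[OF E(1)] by simp
  then obtain K where K: "K \<subseteq> E" "compact K" "ennreal x < emeasure ?M K" by (auto simp: less_SUP_iff)
  have "emeasure ?M K = emeasure lborel K" using M[OF borel_compact[OF K(2)]] K(1) by (simp add: Int_absorb1)
  also have "\<dots> = ennreal (measure lborel K)"
    using emeasure_lborel_bounded[OF compact_imp_bounded[OF K(2)]] by (simp add: emeasure_eq_ennreal_measure)
  finally have "x < measure lborel K"
    using K(3) by (metis ennreal_less_iff ennreal_neg linorder_not_less measure_nonneg order_less_le_trans not_le)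
  with K show ?thesis using that by blast
qed

text \<open>Compact subsets of \<open>E\<close> with volume above any \<open>x\<close> below the
  common volume \<open>M\<close> bound \<open>fav\<close> of \<open>E\<close> from below, by a
  quantity continuous in \<open>x\<close>. Its limit at \<open>x = M\<close> is the upper bound for
  the ball.\<close>

theorem corollary1p3:
  fixes E B :: "(real ^ 'n) set" and c :: "real ^ 'n" and r :: real
  assumes "CARD('n) \<ge> 2"
    and "E \<in> sets borel"
    and "r > 0" and "B = ball c r \<or> B = cball c r"
    and "hausdorff_measure CARD('n) E = hausdorff_measure CARD('n) B"
  shows "fav (CARD('n) - 1) E \<ge> fav (CARD('n) - 1) B"
proof -
  let ?n = "CARD('n)"
  define b where "b = measure lborel (cball (0::real ^ 'n) 1)"
  define M where "M = r ^ ?n * b"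
  have r: "0 < r" by fact
  have b: "0 < b" using content_cball_pos[of 1 "0::real ^ 'n"] by (simp add: b_def)
  have M: "0 < M" using r b by (simp add: M_def)
  obtain u :: "real ^ 'n" where u: "norm u = 1" by (rule vector_choose_size[of 1]) simp
  have mB: "measure lborel B = M"
  proof -
    have "measure lborel (cball c r) = measure lborel (cball (0 :: real ^ 'n) r)"
      using r by (simp add: content_cball)
    moreover have "measure lborel (ball c r) = measure lborel (cball c r)"
      using r by (simp add: content_ball content_cball)
    ultimately show ?thesis using assms(4) measure_cball_scale[of r, where 'a="real ^ 'n"] r by (auto simp: M_def b_def)
  qed
  have sB: "B \<in> sets borel" and bB: "B \<subseteq> cball c r" using assms(4) by auto
  have "emeasure lborel E = emeasure lborel B"
    using assms(5) unfolding hausdorff_measure_eq_lborel[OF assms(2)] hausdorff_measure_eq_lborel[OF sB] .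
  also have "\<dots> = ennreal M"
    using emeasure_lborel_bounded[OF bounded_subset[OF bounded_cball bB]] mB by (metis emeasure_eq_ennreal_measure less_irrefl)
  finally have E: "emeasure lborel E = ennreal M" .
  let ?f = "\<lambda>x. ennreal (real ?n * (mean_width u * root ?n b) * root ?n x ^ (?n - 1))"
  have le: "?f x \<le> 2 * fav (?n - 1) E" if x: "0 < x" "x < M" for x
  proof -
    obtain K where K: "compact K" "K \<subseteq> E" "x < measure lborel K"
      using emeasure_lborel_inner_compact[OF assms(2), of x] E x by (auto simp: ennreal_less_iff)
    have "?f x \<le> ?f (measure lborel K)"
      using K(3) x mean_width_nonneg[of u] b by (intro ennreal_leI mult_left_mono power_mono mult_nonneg_nonneg) auto
    also have "\<dots> \<le> 2 * fav (?n - 1) K" unfolding b_def using K x by (intro fav_compact_ge[OF _ _ u]) auto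
    also have "\<dots> \<le> 2 * fav (?n - 1) E" by (intro mult_left_mono fav_mono K(2)) simp
    finally show ?thesis .
  qed
  have "(?f \<longlongrightarrow> ?f M) (at_left M)" by (intro tendsto_intros)
  moreover have "eventually (\<lambda>x. ?f x \<le> 2 * fav (?n - 1) E) (at_left M)"
    using le M by (intro eventually_at_leftI[of 0 M]) auto
  ultimately have fE: "?f M \<le> 2 * fav (?n - 1) E" by (rule tendsto_upperbound) simp
  \<comment> \<open>The two constants agree: one factor \<open>root ?n b\<close> comes from the ball
    that serves as the target of the transport, and \<open>?n - 1\<close> of them come from the
    common volume \<open>M\<close>; together they give \<open>b\<close>.\<close>
  have "root ?n M = r * root ?n b" using r by (simp add: M_def real_root_mult real_root_power_cancel)
  moreover have "root ?n b * root ?n b ^ (?n - 1) = b"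
    using b by (metis less_imp_le power_eq_if real_root_pow_pos2 zero_less_card_finite neq0_conv)
  ultimately have "real ?n * (mean_width u * root ?n b) * root ?n M ^ (?n - 1) = real ?n * mean_width u * b * r ^ (?n - 1)"
    by (simp add: power_mult_distrib)
  then have "ennreal (real ?n * mean_width u * b * r ^ (?n - 1)) \<le> 2 * fav (?n - 1) E"
    using fE by (simp only:)
  with fav_cball_le[OF u r, of c, folded b_def] have "2 * fav (?n - 1) (cball c r) \<le> 2 * fav (?n - 1) E"
    by (rule order_trans)
  then have "fav (?n - 1) (cball c r) \<le> fav (?n - 1) E" by (simp add: ennreal_mult_le_mult_iff)
  then show ?thesis using fav_mono[OF bB] order_trans by blast
qed

end
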